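(* Let $H$ be a BiHom-Hopf algebra with a bijective antipode $S$ and let $m,n,p,q\in\mathbb{Z}$. Then the category $\mathcal{YD}_{H}^{H}(m,n,p,q)$ is a strict braided monoidal category, where the tensor product of $V,W\in\mathcal{YD}_{H}^{H}(m,n,p,q)$ is $V\otimes W$ with, for $v\in V$, $w\in W$, $h\in H$, $$(v\otimes w)\triangleleft h=v\triangleleft\omega^{-1}(h_{1})\otimes w\triangleleft\psi^{-1}(h_{2}),\qquad \rho(v\otimes w)=v_{(0)}\otimes w_{(0)}\otimes\alpha^{-1}(v_{(1)})\beta^{-1}(w_{(1)}),$$ the braiding is $$c_{V,W}:V\otimes W\to W\otimes V,\quad c_{V,W}(v\otimes w)=\omega_{W}^{-1}(w_{(0)})\otimes\alpha_{V}^{-1}(v)\triangleleft\alpha^{-m+1}\beta^{-n}\omega^{-p+1}\psi^{-q}(w_{(1)}),$$ and its inverse is $$c_{V,W}^{-1}:W\otimes V\to V\otimes W,\quad c_{V,W}^{-1}(w\otimes v)=\alpha_{V}^{-1}(v)\triangleleft S^{-1}\alpha^{-m}\beta^{-n+1}\omega^{-p}\psi^{-q+1}(w_{(1)})\otimes\omega_{W}^{-1}(w_{(0)}).$$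
   Context: All spaces are over a field $\Bbbk$; Sweedler notation $\Delta(h)=h_1\otimes h_2$ (summation suppressed). BiHom-bialgebra: $H=(H,\mu,1,\Delta,\varepsilon,\alpha,\beta,\omega,\psi)$ with $\alpha,\beta,\omega,\psi$ pairwise commuting linear automorphisms of $H$ such that: (algebra) $\alpha(1)=\beta(1)=1$, $a1=\alpha(a)$, $1a=\beta(a)$, $\alpha(a)(bc)=(ab)\beta(c)$, and $\alpha,\beta$ are multiplicative; (coalgebra) $\varepsilon\omega=\varepsilon\psi=\varepsilon$, $c_1\varepsilon(c_2)=\omega(c)$, $\varepsilon(c_1)c_2=\psi(c)$, $\omega(c_1)\otimes\Delta(c_2)=\Delta(c_1)\otimes\psi(c_2)$, and $\omega,\psi$ are comultiplicative; $\Delta(hg)=h_1g_1\otimes h_2g_2$, $\varepsilon(hg)=\varepsilon(h)\varepsilon(g)$, $\Delta(1)=1\otimes1$, $\varepsilon(1)=1_{\Bbbk}$; $\alpha,\beta$ preserve $\Delta,\varepsilon$; $\omega,\psi$ preserve $\mu$ and $1$. A BiHom-Hopf algebra is a BiHom-bialgebra with a linear map $S:H\to H$ (antipode) commuting with $\alpha,\beta,\omega,\psi$ and satisfying $h_1S(h_2)=S(h_1)h_2=\varepsilon(h)1$. A right $H$-module is a space $V$ with pairwise commuting linear automorphisms $\alpha_V,\beta_V,\omega_V,\psi_V$ and a linear map $\triangleleft:V\otimes H\to V$ with $\theta_V(v\triangleleft h)=\theta_V(v)\triangleleft\theta(h)$ for $\theta\in\{\alpha,\beta,\omega,\psi\}$,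 $(v\triangleleft h)\triangleleft\beta(g)=\alpha_V(v)\triangleleft(hg)$ and $v\triangleleft1=\alpha_V(v)$. A right $H$-comodule is a space $V$ with four such automorphisms and a linear map $\rho:V\to V\otimes H$, $\rho(v)=v_{(0)}\otimes v_{(1)}$, with $\rho\theta_V=(\theta_V\otimes\theta)\rho$ for $\theta\in\{\alpha,\beta,\omega,\psi\}$, $\omega_V(v_{(0)})\otimes\Delta(v_{(1)})=\rho(v_{(0)})\otimes\psi(v_{(1)})$ and $v_{(0)}\varepsilon(v_{(1)})=\omega_V(v)$. A right-right BiHom-$(m,n,p,q)$-Yetter-Drinfel'd module over $H$ is a right $H$-module and right $H$-comodule $V$ (same four automorphisms) such that for all $h\in H$, $v\in V$ $$(v\triangleleft h_2)_{(0)}\otimes\alpha^{m-2}\beta^{n+1}\omega^{p-2}\psi^{q+1}(h_1)\,(v\triangleleft h_2)_{(1)}=v_{(0)}\triangleleft\psi(h_1)\otimes\beta(v_{(1)})\,\alpha^{m-1}\beta^{n}\omega^{p-1}\psi^{q}(h_2).$$ $\mathcal{YD}_H^H(m,n,p,q)$ is the category of these with morphisms the linear maps commuting with the four automorphisms that are $H$-linear and $H$-colinear. The automorphisms of $V\otimes W$ are $\alpha_V\otimes\alpha_W$, $\beta_V\otimes\beta_W$, $\omega_V\otimes\omega_W$, $\psi_V\otimes\psi_W$. A monoidal category is strict if all its constraints are identities. *)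

theory Defs
  imports Complex_Main "HOL-Library.FuncSet" "HOL-Library.Function_Algebras"
begin

section \<open>A strict model of the tensor product of vector spaces\<close>

text \<open>
  Strictness of a category of modules presupposes the usual identifications
  \<open>(U \<otimes> V) \<otimes> W = U \<otimes> (V \<otimes> W)\<close> and \<open>k \<otimes> V = V = V \<otimes> k\<close> of vector spaces.  To have these as
  literal equalities, vector spaces are realised as spaces of arrays: an array is a function on
  index lists, a space is a linear subspace all of whose members are supported on lists of one
  common length, and the tensor product is the outer product of arrays.
  Nothing is lost: lemma \<open>every_vector_space_is_a_vspace\<close> shows that every vector space occurs up
  to isomorphism (for a large enough index type), and lemmas \<open>tensor_space_elem\<close> and
  \<open>sweedler_sum_list\<close> give the universal property of the tensor product.
\<close>

type_synonym ('k, 'x) arr = "'x list \<Rightarrow> 'k"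

definition scale_arr :: "'k::field \<Rightarrow> ('k, 'x) arr \<Rightarrow> ('k, 'x) arr" (infixr "*\<^sub>k" 75)
  where "c *\<^sub>k v = (\<lambda>xs. c * v xs)"

interpretation arr: vector_space "scale_arr :: 'k::field \<Rightarrow> ('k, 'x) arr \<Rightarrow> ('k, 'x) arr"
  by unfold_locales (auto simp: scale_arr_def fun_eq_iff algebra_simps)

definition vspace :: "('k::field, 'x) arr set \<Rightarrow> bool"
  where "vspace V \<longleftrightarrow> arr.subspace V \<and> (\<exists>n. \<forall>v\<in>V. \<forall>xs. v xs \<noteq> 0 \<longrightarrow> length xs = n)"

text \<open>If \<open>v\<close> lives on lists of length \<open>n\<close> and \<open>w\<close> on lists of length \<open>m\<close>, then
  \<open>(v \<otimes> w) (xs @ ys) = v xs * w ys\<close> for \<open>length xs = n\<close> and \<open>length ys = m\<close>, all other values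
  being 0.  Summing over all splittings makes it unnecessary to mention \<open>n\<close> and \<open>m\<close>.\<close>

definition tensor :: "('k::field, 'x) arr \<Rightarrow> ('k, 'x) arr \<Rightarrow> ('k, 'x) arr" (infixr "\<otimes>" 70)
  where "v \<otimes> w = (\<lambda>zs. \<Sum>i\<le>length zs. v (take i zs) * w (drop i zs))"

definition tensor_space :: "('k::field, 'x) arr set \<Rightarrow> ('k, 'x) arr set \<Rightarrow> ('k, 'x) arr set"
    (infixr "\<otimes>\<^sub>S" 70)
  where "V \<otimes>\<^sub>S W = arr.span {v \<otimes> w | v w. v \<in> V \<and> w \<in> W}"

definition unit_arr :: "('k::field, 'x) arr"
  where "unit_arr = (\<lambda>xs. if xs = [] then 1 else 0)"

text \<open>The ground field as a vector space; the scalar \<open>c\<close> is the array \<open>c *\<^sub>k unit_arr\<close>.\<close>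

definition ground :: "('k::field, 'x) arr set"
  where "ground = range (\<lambda>c. c *\<^sub>k unit_arr)"

text \<open>Sweedler notation: for \<open>t = (\<Sum>i. v\<^sub>i \<otimes> w\<^sub>i)\<close> in \<open>V \<otimes>\<^sub>S W\<close>, the term
  \<open>sweedler V W t (\<lambda>v w. F v w)\<close> is \<open>\<Sum>i. F v\<^sub>i w\<^sub>i\<close>, i.e. the linear map induced by \<open>F\<close>.  For
  bilinear \<open>F\<close> the choice of the decomposition is irrelevant (\<open>sweedler_sum_list\<close>).\<close>

definition sweedler :: "('k::field, 'x) arr set \<Rightarrow> ('k, 'x) arr set \<Rightarrow> ('k, 'x) arr
    \<Rightarrow> (('k, 'x) arr \<Rightarrow> ('k, 'x) arr \<Rightarrow> 'c::monoid_add) \<Rightarrow> 'c"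
  where "sweedler V W t F =
    (let ps = (SOME ps. set ps \<subseteq> V \<times> W \<and> t = (\<Sum>(v, w)\<leftarrow>ps. v \<otimes> w))
     in \<Sum>(v, w)\<leftarrow>ps. F v w)"

text \<open>Maps are extensional (undefined outside their carrier), so that equality of maps and of
  structures on a carrier is equality in the logic.\<close>

definition lin_map :: "('k::field, 'x) arr set \<Rightarrow> ('k, 'x) arr set \<Rightarrow> (('k, 'x) arr \<Rightarrow> ('k, 'x) arr) set"
  where "lin_map V W = {f \<in> V \<rightarrow>\<^sub>E W.
    (\<forall>x\<in>V. \<forall>y\<in>V. f (x + y) = f x + f y) \<and> (\<forall>c. \<forall>x\<in>V. f (c *\<^sub>k x) = c *\<^sub>k f x)}"

definition lin_aut :: "('k::field, 'x) arr set \<Rightarrow> (('k, 'x) arr \<Rightarrow> ('k, 'x) arr) set"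
  where "lin_aut V = {f \<in> lin_map V V. bij_betw f V V}"

definition lin_form :: "('k::field, 'x) arr set \<Rightarrow> (('k, 'x) arr \<Rightarrow> 'k) set"
  where "lin_form V = {f \<in> V \<rightarrow>\<^sub>E UNIV.
    (\<forall>x\<in>V. \<forall>y\<in>V. f (x + y) = f x + f y) \<and> (\<forall>c. \<forall>x\<in>V. f (c *\<^sub>k x) = c * f x)}"

text \<open>Linear maps \<open>U \<otimes> V \<rightarrow> W\<close> such as multiplications and actions are given as bilinear maps.\<close>

definition bilin_map :: "('k::field, 'x) arr set \<Rightarrow> ('k, 'x) arr set \<Rightarrow> ('k, 'x) arr set
    \<Rightarrow> (('k, 'x) arr \<Rightarrow> ('k, 'x) arr \<Rightarrow> ('k, 'x) arr) set"
  where "bilin_map U V W = {F \<in> U \<rightarrow>\<^sub>E lin_map V W. \<forall>v\<in>V. (\<lambda>u\<in>U. F u v) \<in> lin_map U W}"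

definition tensor_map :: "('k::field, 'x) arr set \<Rightarrow> ('k, 'x) arr set
    \<Rightarrow> (('k, 'x) arr \<Rightarrow> ('k, 'x) arr) \<Rightarrow> (('k, 'x) arr \<Rightarrow> ('k, 'x) arr)
    \<Rightarrow> ('k, 'x) arr \<Rightarrow> ('k, 'x) arr"
  where "tensor_map V W f g = (\<lambda>t\<in>V \<otimes>\<^sub>S W. sweedler V W t (\<lambda>v w. f v \<otimes> g w))"


subsection \<open>Adequacy of the model\<close>

lemma tensor_add_left: "(u + v) \<otimes> w = u \<otimes> w + v \<otimes> w"
  by (simp add: tensor_def fun_eq_iff algebra_simps sum.distrib)

lemma tensor_add_right: "u \<otimes> (v + w) = u \<otimes> v + u \<otimes> w"
  by (simp add: tensor_def fun_eq_iff algebra_simps sum.distrib)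

lemma tensor_scale_left: "(c *\<^sub>k v) \<otimes> w = c *\<^sub>k (v \<otimes> w)"
  by (simp add: tensor_def scale_arr_def fun_eq_iff sum_distrib_left mult.assoc)

lemma tensor_scale_right: "v \<otimes> (c *\<^sub>k w) = c *\<^sub>k (v \<otimes> w)"
  by (simp add: tensor_def scale_arr_def fun_eq_iff sum_distrib_left mult.left_commute)

lemma tensor_assoc: "(u \<otimes> v) \<otimes> w = u \<otimes> (v \<otimes> w)"
proof
  fix zs
  define g where "g i j = u (take i zs) * (v (take j (drop i zs)) * w (drop (i + j) zs))" for i j
  have "((u \<otimes> v) \<otimes> w) zs = (\<Sum>k\<le>length zs. \<Sum>i\<le>k. g i (k - i))"
    unfolding tensor_def g_def
    by (intro sum.cong refl)
       (auto simp: sum_distrib_right min_def take_drop mult.assoc intro!: sum.cong)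
  also have "\<dots> = (\<Sum>(i, j)\<in>{(i, j). i + j \<le> length zs}. g i j)"
    by (rule sum.triangle_reindex_eq [symmetric])
  also have "{(i, j). i + j \<le> length zs} = (SIGMA i:{..length zs}. {..length zs - i})"
    by auto
  also have "(\<Sum>(i, j)\<in>\<dots>. g i j) = (\<Sum>i\<le>length zs. \<Sum>j\<le>length zs - i. g i j)"
    by (rule sum.Sigma [symmetric]) auto
  also have "\<dots> = (u \<otimes> (v \<otimes> w)) zs"
    unfolding tensor_def g_def by (simp add: sum_distrib_left add.commute)
  finally show "((u \<otimes> v) \<otimes> w) zs = (u \<otimes> (v \<otimes> w)) zs" .
qed

lemma tensor_unit_left [simp]: "unit_arr \<otimes> v = v"
proof
  fix zs
  have "(unit_arr \<otimes> v) zs = (\<Sum>i\<in>{0}. unit_arr (take i zs) * v (drop i zs))"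
    unfolding tensor_def by (rule sum.mono_neutral_right) (auto simp: unit_arr_def)
  then show "(unit_arr \<otimes> v) zs = v zs" by (simp add: unit_arr_def)
qed

lemma tensor_unit_right [simp]: "v \<otimes> unit_arr = v"
proof
  fix zs
  have "(v \<otimes> unit_arr) zs = (\<Sum>i\<in>{length zs}. v (take i zs) * unit_arr (drop i zs))"
    unfolding tensor_def by (rule sum.mono_neutral_right) (auto simp: unit_arr_def)
  then show "(v \<otimes> unit_arr) zs = v zs" by (simp add: unit_arr_def)
qed

lemma tensor_append:
  assumes "\<And>xs. v xs \<noteq> 0 \<Longrightarrow> length xs = n" "length xs = n"
  shows "(v \<otimes> w) (xs @ ys) = v xs * w ys"
proof -
  have "(v \<otimes> w) (xs @ ys) = (\<Sum>i\<in>{n}. v (take i (xs @ ys)) * w (drop i (xs @ ys)))"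
    unfolding tensor_def using assms
    by (intro sum.mono_neutral_right) (force dest: assms(1))+
  then show ?thesis using assms(2) by simp
qed

lemma vspace_ground: "vspace ground"
  unfolding vspace_def
proof
  show "arr.subspace (ground :: ('b, 'a) arr set)"
    unfolding arr.subspace_def ground_def
    by (auto simp: image_iff simp flip: arr.scale_left_distrib intro: exI [of _ 0])
  show "\<exists>n. \<forall>v\<in>(ground :: ('b, 'a) arr set). \<forall>xs. v xs \<noteq> 0 \<longrightarrow> length xs = n"
    by (rule exI [of _ 0]) (auto simp: ground_def scale_arr_def unit_arr_def)
qed

lemma vspace_tensor_space:
  assumes "vspace V" "vspace W"
  shows "vspace (V \<otimes>\<^sub>S W)"
proof -
  obtain n m where n: "\<And>v xs. v \<in> V \<Longrightarrow> v xs \<noteq> 0 \<Longrightarrow> length xs = n"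
    and m: "\<And>w xs. w \<in> W \<Longrightarrow> w xs \<noteq> 0 \<Longrightarrow> length xs = m"
    using assms unfolding vspace_def by metis
  have "length zs = n + m" if "t \<in> V \<otimes>\<^sub>S W" "t zs \<noteq> 0" for t zs
    using that unfolding tensor_space_def
  proof (induction rule: arr.span_induct_alt)
    case (step c x y)
    then obtain v w where x: "x = v \<otimes> w" "v \<in> V" "w \<in> W" by auto
    show ?case
    proof (cases "y zs = 0")
      case True
      then have "x zs \<noteq> 0" using step by (auto simp: scale_arr_def)
      then obtain i where "i \<le> length zs" "v (take i zs) * w (drop i zs) \<noteq> 0"
        unfolding x(1) tensor_def by (metis (no_types, lifting) atMost_iff sum.not_neutral_contains_not_neutral)
      then show ?thesis using n [of v "take i zs"] m [of w "drop i zs"] x by auto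
    qed (use step in auto)
  qed auto
  then show ?thesis unfolding vspace_def
    by (auto simp: tensor_space_def)
qed

lemma tensor_space_elem:
  assumes "vspace V"
  shows "t \<in> V \<otimes>\<^sub>S W \<longleftrightarrow> (\<exists>ps. set ps \<subseteq> V \<times> W \<and> t = (\<Sum>(v, w)\<leftarrow>ps. v \<otimes> w))"
proof
  assume "t \<in> V \<otimes>\<^sub>S W"
  then show "\<exists>ps. set ps \<subseteq> V \<times> W \<and> t = (\<Sum>(v, w)\<leftarrow>ps. v \<otimes> w)"
    unfolding tensor_space_def
  proof (induction rule: arr.span_induct_alt)
    case base
    show ?case by (rule exI [of _ "[]"]) auto
  next
    case (step c x y)
    then obtain v w ps where "x = v \<otimes> w" "v \<in> V" "w \<in> W" "set ps \<subseteq> V \<times> W"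
      "y = (\<Sum>(v, w)\<leftarrow>ps. v \<otimes> w)" by blast
    moreover have "c *\<^sub>k v \<in> V" using assms \<open>v \<in> V\<close> by (auto simp: vspace_def arr.subspace_scale)
    ultimately show ?case
      by (intro exI [of _ "(c *\<^sub>k v, w) # ps"]) (auto simp: tensor_scale_left)
  qed
next
  assume "\<exists>ps. set ps \<subseteq> V \<times> W \<and> t = (\<Sum>(v, w)\<leftarrow>ps. v \<otimes> w)"
  then obtain ps where "set ps \<subseteq> V \<times> W" "t = (\<Sum>(v, w)\<leftarrow>ps. v \<otimes> w)" by blast
  then show "t \<in> V \<otimes>\<^sub>S W"
  proof (induction ps arbitrary: t)
    case Nil
    then show ?case using arr.span_zero by (simp add: tensor_space_def zero_fun_def)
  next
    case (Cons p ps)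
    obtain v w where p: "p = (v, w)" by force
    have "v \<otimes> w \<in> V \<otimes>\<^sub>S W"
      using Cons p unfolding tensor_space_def by (intro arr.span_base) auto
    then show ?case
      using Cons p arr.subspace_add [OF arr.subspace_span] unfolding tensor_space_def
      by (simp add: plus_fun_def)
  qed
qed

lemma sum_list_eq_zero_bilinear:
  fixes F :: "('k::field, 'x) arr \<Rightarrow> ('k, 'x) arr \<Rightarrow> 'c::ab_group_add"
  assumes vs: "vector_space s" and V: "vspace V" and W: "vspace W"
    and add1: "\<And>v v' w. v \<in> V \<Longrightarrow> v' \<in> V \<Longrightarrow> w \<in> W \<Longrightarrow> F (v + v') w = F v w + F v' w"
    and scale1: "\<And>c v w. v \<in> V \<Longrightarrow> w \<in> W \<Longrightarrow> F (c *\<^sub>k v) w = s c (F v w)"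
    and add2: "\<And>v w w'. v \<in> V \<Longrightarrow> w \<in> W \<Longrightarrow> w' \<in> W \<Longrightarrow> F v (w + w') = F v w + F v w'"
    and scale2: "\<And>c v w. v \<in> V \<Longrightarrow> w \<in> W \<Longrightarrow> F v (c *\<^sub>k w) = s c (F v w)"
    and ps: "set ps \<subseteq> V \<times> W" and zero: "(\<Sum>(v, w)\<leftarrow>ps. v \<otimes> w) = 0"
  shows "(\<Sum>(v, w)\<leftarrow>ps. F v w) = 0"
proof -
  interpret s: vector_space s by (rule vs)
  have sV: "arr.subspace V" and sW: "arr.subspace W" using V W by (auto simp: vspace_def)
  obtain n where n: "\<And>v xs. v \<in> V \<Longrightarrow> v xs \<noteq> 0 \<Longrightarrow> length xs = n"
    using V unfolding vspace_def by metis
  define S where "S = snd ` set ps"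
  obtain B where B: "B \<subseteq> S" "arr.independent B" "S \<subseteq> arr.span B"
    using arr.maximal_independent_subset [of S] by blast
  have finB: "finite B" using B(1) finite_subset unfolding S_def by fastforce
  have BW: "B \<subseteq> W" using B(1) ps unfolding S_def by force
  define r where "r = arr.representation B"
  have rep: "(\<Sum>b\<in>B. r w b *\<^sub>k b) = w" if "w \<in> S" for w
    unfolding r_def by (rule arr.sum_representation_eq) (use B finB that in auto)
  define U where "U b = (\<Sum>(v, w)\<leftarrow>ps. r w b *\<^sub>k v)" for b
  have general: "(\<Sum>(v, w)\<leftarrow>qs. G v w) = (\<Sum>b\<in>B. G (\<Sum>(v, w)\<leftarrow>qs. r w b *\<^sub>k v) b)
      \<and> (\<forall>b\<in>B. (\<Sum>(v, w)\<leftarrow>qs. r w b *\<^sub>k v) \<in> V)"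
    if "set qs \<subseteq> set ps" "vector_space t"
      and G: "\<And>v v' w. v \<in> V \<Longrightarrow> v' \<in> V \<Longrightarrow> w \<in> W \<Longrightarrow> G (v + v') w = G v w + G v' w"
        "\<And>c v w. v \<in> V \<Longrightarrow> w \<in> W \<Longrightarrow> G (c *\<^sub>k v) w = t c (G v w)"
        "\<And>v w w'. v \<in> V \<Longrightarrow> w \<in> W \<Longrightarrow> w' \<in> W \<Longrightarrow> G v (w + w') = G v w + G v w'"
        "\<And>c v w. v \<in> V \<Longrightarrow> w \<in> W \<Longrightarrow> G v (c *\<^sub>k w) = t c (G v w)"
    for qs and G :: "('k, 'x) arr \<Rightarrow> ('k, 'x) arr \<Rightarrow> 'd::ab_group_add" and t
    using that(1)
  proof (induction qs)
    case Nil
    interpret t: vector_space t by (rule that(2))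
    have "G 0 b = 0" if "b \<in> B" for b
      using G(2) [of 0 b 0] that BW arr.subspace_0 [OF sV] by auto
    then show ?case using arr.subspace_0 [OF sV] by (simp add: zero_fun_def)
  next
    case (Cons p qs)
    interpret t: vector_space t by (rule that(2))
    obtain v w where p: "p = (v, w)" by force
    have v: "v \<in> V" and w: "w \<in> W" and wS: "w \<in> S"
      using Cons.prems ps p unfolding S_def by force+
    have Gsum: "G v (\<Sum>b\<in>C. r w b *\<^sub>k b) = (\<Sum>b\<in>C. t (r w b) (G v b))
        \<and> (\<Sum>b\<in>C. r w b *\<^sub>k b) \<in> W" if "C \<subseteq> B" for C
      using finite_subset [OF that finB] that
    proof (induction C rule: finite_induct)
      case empty
      then show ?case
        using G(4) [of v 0 0] v arr.subspace_0 [OF sW] by (simp add: zero_fun_def)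
    next
      case (insert b C)
      then have "b \<in> W" using BW by auto
      moreover have "G v (r w b *\<^sub>k b + (\<Sum>b\<in>C. r w b *\<^sub>k b))
          = G v (r w b *\<^sub>k b) + G v (\<Sum>b\<in>C. r w b *\<^sub>k b)"
        using insert v calculation by (intro G(3)) (auto simp: arr.subspace_scale [OF sW])
      moreover have "r w b *\<^sub>k b + (\<Sum>b\<in>C. r w b *\<^sub>k b) \<in> W"
        using insert calculation by (auto intro!: arr.subspace_add [OF sW] arr.subspace_scale [OF sW])
      ultimately show ?case using insert G(4) v by (simp add: plus_fun_def)
    qed
    have IH: "(\<Sum>(v, w)\<leftarrow>qs. G v w) = (\<Sum>b\<in>B. G (\<Sum>(v, w)\<leftarrow>qs. r w b *\<^sub>k v) b)"
      "\<forall>b\<in>B. (\<Sum>(v, w)\<leftarrow>qs. r w b *\<^sub>k v) \<in> V"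
      using Cons by auto
    have "(\<Sum>(v, w)\<leftarrow>p # qs. G v w) = (\<Sum>b\<in>B. t (r w b) (G v b))
        + (\<Sum>b\<in>B. G (\<Sum>(v, w)\<leftarrow>qs. r w b *\<^sub>k v) b)"
      using Gsum [of B] rep [OF wS] IH p by simp
    also have "\<dots> = (\<Sum>b\<in>B. G (\<Sum>(v, w)\<leftarrow>p # qs. r w b *\<^sub>k v) b)"
      unfolding sum.distrib [symmetric] using IH(2) BW v p
      by (intro sum.cong refl) (auto simp: G(1,2) arr.subspace_scale [OF sV] subset_iff)
    finally show ?case
      using IH(2) p arr.subspace_add [OF sV arr.subspace_scale [OF sV v]]
      by (simp add: plus_fun_def)
  qed
  have UV: "U b \<in> V" if "b \<in> B" for b
    using general [of ps s F] add1 scale1 add2 scale2 vs that unfolding U_def by simp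
  have "(\<Sum>(v, w)\<leftarrow>ps. v \<otimes> w) = (\<Sum>b\<in>B. U b \<otimes> b)"
    unfolding U_def
    by (rule general [of ps scale_arr tensor, THEN conjunct1])
       (simp_all add: arr.vector_space_axioms tensor_add_left tensor_add_right
          tensor_scale_left tensor_scale_right)
  then have zero': "(\<Sum>b\<in>B. U b \<otimes> b) = 0" using zero by simp
  have sum_app: "(\<Sum>b\<in>C. g b) z = (\<Sum>b\<in>C. g b z)" if "finite C"
    for C and g :: "('k, 'x) arr \<Rightarrow> ('k, 'x) arr" and z
    using that by (induction C rule: finite_induct) auto
  have "U b xs = 0" if "b \<in> B" for b xs
  proof (cases "length xs = n")
    case True
    have "(\<Sum>b\<in>B. U b xs *\<^sub>k b) = 0"
    proof
      fix ys
      have "(\<Sum>b\<in>B. U b xs *\<^sub>k b) ys = (\<Sum>b\<in>B. U b \<otimes> b) (xs @ ys)"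
        unfolding sum_app [OF finB]
        by (intro sum.cong refl) (simp add: tensor_append [OF n [OF UV] True] scale_arr_def)
      then show "(\<Sum>b\<in>B. U b xs *\<^sub>k b) ys = 0 ys" using zero' by simp
    qed
    then show ?thesis
      by (rule arr.independentD [OF B(2) finB subset_refl, where u = "\<lambda>b. U b xs", OF _ that])
  qed (use n UV that in blast)
  then have "U b = 0" if "b \<in> B" for b using that by (auto simp: fun_eq_iff)
  moreover have "F 0 b = 0" if "b \<in> B" for b
    using scale1 [of 0 b 0] that BW arr.subspace_0 [OF sV] by auto
  moreover have "(\<Sum>(v, w)\<leftarrow>ps. F v w) = (\<Sum>b\<in>B. F (U b) b)"
    using general [of ps s F] add1 scale1 add2 scale2 vs unfolding U_def by simp
  ultimately show ?thesis by simp
qed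

lemma sweedler_sum_list:
  fixes F :: "('k::field, 'x) arr \<Rightarrow> ('k, 'x) arr \<Rightarrow> 'c::ab_group_add"
  assumes vs: "vector_space s" and V: "vspace V" and W: "vspace W"
    and add1: "\<And>v v' w. v \<in> V \<Longrightarrow> v' \<in> V \<Longrightarrow> w \<in> W \<Longrightarrow> F (v + v') w = F v w + F v' w"
    and scale1: "\<And>c v w. v \<in> V \<Longrightarrow> w \<in> W \<Longrightarrow> F (c *\<^sub>k v) w = s c (F v w)"
    and add2: "\<And>v w w'. v \<in> V \<Longrightarrow> w \<in> W \<Longrightarrow> w' \<in> W \<Longrightarrow> F v (w + w') = F v w + F v w'"
    and scale2: "\<And>c v w. v \<in> V \<Longrightarrow> w \<in> W \<Longrightarrow> F v (c *\<^sub>k w) = s c (F v w)"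
    and ps: "set ps \<subseteq> V \<times> W"
  shows "sweedler V W (\<Sum>(v, w)\<leftarrow>ps. v \<otimes> w) F = (\<Sum>(v, w)\<leftarrow>ps. F v w)"
proof -
  interpret s: vector_space s by (rule vs)
  let ?P = "\<lambda>qs. set qs \<subseteq> V \<times> W \<and> (\<Sum>(v, w)\<leftarrow>ps. v \<otimes> w) = (\<Sum>(v, w)\<leftarrow>qs. v \<otimes> w)"
  define qs where "qs = (SOME qs. ?P qs)"
  have qs: "?P qs" unfolding qs_def by (rule someI [of ?P ps]) (use ps in simp)
  define rs where "rs = ps @ map (\<lambda>(v, w). ((- 1) *\<^sub>k v, w)) qs"
  have rs: "set rs \<subseteq> V \<times> W"
    using ps qs V unfolding rs_def vspace_def by (auto simp: arr.subspace_neg subset_iff)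
  have neg: "(\<Sum>(v, w)\<leftarrow>map (\<lambda>(v, w). ((- 1) *\<^sub>k v, w)) xs. G v w) = - (\<Sum>(v, w)\<leftarrow>xs. G v w)"
    if "set xs \<subseteq> V \<times> W" "\<And>v w. v \<in> V \<Longrightarrow> w \<in> W \<Longrightarrow> G ((- 1) *\<^sub>k v) w = - G v w"
    for xs and G :: "('k, 'x) arr \<Rightarrow> ('k, 'x) arr \<Rightarrow> 'd::ab_group_add"
    using that(1) by (induction xs) (auto simp: that(2) simp del: arr.scale_minus_left)
  have "(\<Sum>(v, w)\<leftarrow>map (\<lambda>(v, w). ((- 1) *\<^sub>k v, w)) qs. v \<otimes> w) = - (\<Sum>(v, w)\<leftarrow>qs. v \<otimes> w)"
    by (rule neg) (use qs in \<open>simp_all add: tensor_scale_left del: arr.scale_minus_left\<close>, simp)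
  then have "(\<Sum>(v, w)\<leftarrow>rs. v \<otimes> w) = 0"
    unfolding rs_def map_append sum_list_append using qs by simp
  then have "(\<Sum>(v, w)\<leftarrow>rs. F v w) = 0"
    by (intro sum_list_eq_zero_bilinear [where s = s and V = V and W = W]
          vs V W add1 scale1 add2 scale2 rs)
  then have "(\<Sum>(v, w)\<leftarrow>ps. F v w) = (\<Sum>(v, w)\<leftarrow>qs. F v w)"
    unfolding rs_def map_append sum_list_append
    by (subst (asm) neg) (use qs scale1 in \<open>auto simp del: arr.scale_minus_left\<close>)
  then show ?thesis unfolding sweedler_def Let_def qs_def by simp
qed

lemma every_vector_space_is_a_vspace:
  fixes s :: "'k::field \<Rightarrow> 'v::ab_group_add \<Rightarrow> 'v"
  assumes "vector_space s"
  shows "\<exists>f :: 'v \<Rightarrow> ('k, 'v) arr. Vector_Spaces.linear s scale_arr f \<and> inj f \<and> vspace (range f)"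
proof -
  interpret s: vector_space s by (rule assms)
  interpret p: vector_space_pair s "scale_arr :: 'k \<Rightarrow> ('k, 'v) arr \<Rightarrow> ('k, 'v) arr" ..
  obtain B where B: "s.independent B" "UNIV \<subseteq> s.span B"
    using s.maximal_independent_subset [of UNIV] by blast
  then have sp: "v \<in> s.span B" for v by auto
  define f :: "'v \<Rightarrow> ('k, 'v) arr"
    where "f v = (\<lambda>xs. case xs of [b] \<Rightarrow> s.representation B v b | _ \<Rightarrow> 0)" for v
  have lin: "Vector_Spaces.linear s scale_arr f"
    unfolding Vector_Spaces.linear_iff
    by (auto simp: s.vector_space_axioms arr.vector_space_axioms
          f_def fun_eq_iff scale_arr_def s.representation_add [OF B(1) sp sp]
          s.representation_scale [OF B(1) sp] split: list.splits)
  have "inj f"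
  proof (rule injI)
    fix v w assume "f v = f w"
    then have "f v [b] = f w [b]" for b by simp
    then have "s.representation B v = s.representation B w" by (auto simp: f_def)
    moreover have "(\<Sum>b | s.representation B x b \<noteq> 0. s (s.representation B x b) b) = x" for x
      by (rule s.sum_nonzero_representation_eq [OF B(1) sp])
    ultimately show "v = w" by metis
  qed
  moreover have "vspace (range f)"
    unfolding vspace_def
  proof
    show "arr.subspace (range f)"
      using p.linear_subspace_image [OF lin s.subspace_UNIV] .
    show "\<exists>n. \<forall>v\<in>range f. \<forall>xs. v xs \<noteq> 0 \<longrightarrow> length xs = n"
      by (rule exI [of _ 1]) (auto simp: f_def split: list.splits)
  qed
  ultimately show ?thesis using lin by blast
qed


section \<open>BiHom-Hopf algebras\<close>

text \<open>Every object carries four structure automorphisms \<open>\<alpha>, \<beta>, \<omega>, \<psi>\<close>; \<open>tw V Alpha\<close> is \<open>\<alpha>\<^sub>V\<close> etc.\<close>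

datatype twist = Alpha | Beta | Omega | Psi

record ('k, 'x) space_rec =
  car :: "('k, 'x) arr set"
  tw :: "twist \<Rightarrow> ('k, 'x) arr \<Rightarrow> ('k, 'x) arr"

record ('k, 'x) bialg_rec = "('k, 'x) space_rec" +
  mul :: "('k, 'x) arr \<Rightarrow> ('k, 'x) arr \<Rightarrow> ('k, 'x) arr"
  one :: "('k, 'x) arr"
  cop :: "('k, 'x) arr \<Rightarrow> ('k, 'x) arr"
  cou :: "('k, 'x) arr \<Rightarrow> 'k"

record ('k, 'x) hopf_rec = "('k, 'x) bialg_rec" +
  antip :: "('k, 'x) arr \<Rightarrow> ('k, 'x) arr"

definition pw :: "('k::field, 'x, 'z) space_rec_scheme \<Rightarrow> twist \<Rightarrow> int \<Rightarrow> ('k, 'x) arr \<Rightarrow> ('k, 'x) arr"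
  where "pw V \<theta> k x =
    (if 0 \<le> k then (tw V \<theta> ^^ nat k) x else (inv_into (car V) (tw V \<theta>) ^^ nat (- k)) x)"

text \<open>\<open>twp V a b c d = \<alpha>\<^bsup>a\<^esup> \<beta>\<^bsup>b\<^esup> \<omega>\<^bsup>c\<^esup> \<psi>\<^bsup>d\<^esup>\<close>\<close>

definition twp :: "('k::field, 'x, 'z) space_rec_scheme \<Rightarrow> int \<Rightarrow> int \<Rightarrow> int \<Rightarrow> int
    \<Rightarrow> ('k, 'x) arr \<Rightarrow> ('k, 'x) arr"
  where "twp V a b c d x = pw V Alpha a (pw V Beta b (pw V Omega c (pw V Psi d x)))"

locale twisted_space =
  fixes V :: "('k::field, 'x, 'z) space_rec_scheme"
  assumes vspace_car: "vspace (car V)"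
    and tw_aut: "tw V \<theta> \<in> lin_aut (car V)"
    and tw_commute: "x \<in> car V \<Longrightarrow> tw V \<theta> (tw V \<theta>' x) = tw V \<theta>' (tw V \<theta> x)"

locale bihom_algebra = twisted_space A
  for A :: "('k::field, 'x, 'z) bialg_rec_scheme" +
  assumes mul_bilin: "mul A \<in> bilin_map (car A) (car A) (car A)"
    and one_in: "one A \<in> car A"
    and tw_one: "\<theta> \<in> {Alpha, Beta} \<Longrightarrow> tw A \<theta> (one A) = one A"
    and tw_mul: "\<lbrakk>\<theta> \<in> {Alpha, Beta}; a \<in> car A; b \<in> car A\<rbrakk>
      \<Longrightarrow> tw A \<theta> (mul A a b) = mul A (tw A \<theta> a) (tw A \<theta> b)"
    and mul_one: "a \<in> car A \<Longrightarrow> mul A a (one A) = tw A Alpha a"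
    and one_mul: "a \<in> car A \<Longrightarrow> mul A (one A) a = tw A Beta a"
    and mul_assoc: "\<lbrakk>a \<in> car A; b \<in> car A; c \<in> car A\<rbrakk>
      \<Longrightarrow> mul A (tw A Alpha a) (mul A b c) = mul A (mul A a b) (tw A Beta c)"

locale bihom_coalgebra = twisted_space C
  for C :: "('k::field, 'x, 'z) bialg_rec_scheme" +
  assumes cop_lin: "cop C \<in> lin_map (car C) (car C \<otimes>\<^sub>S car C)"
    and cou_lin: "cou C \<in> lin_form (car C)"
    and cou_tw: "\<lbrakk>\<theta> \<in> {Omega, Psi}; c \<in> car C\<rbrakk> \<Longrightarrow> cou C (tw C \<theta> c) = cou C c"
    and cop_tw: "\<lbrakk>\<theta> \<in> {Omega, Psi}; c \<in> car C\<rbrakk>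
      \<Longrightarrow> cop C (tw C \<theta> c) = sweedler (car C) (car C) (cop C c) (\<lambda>c1 c2. tw C \<theta> c1 \<otimes> tw C \<theta> c2)"
    and cou_right: "c \<in> car C
      \<Longrightarrow> sweedler (car C) (car C) (cop C c) (\<lambda>c1 c2. cou C c2 *\<^sub>k c1) = tw C Omega c"
    and cou_left: "c \<in> car C
      \<Longrightarrow> sweedler (car C) (car C) (cop C c) (\<lambda>c1 c2. cou C c1 *\<^sub>k c2) = tw C Psi c"
    and cop_coassoc: "c \<in> car C
      \<Longrightarrow> sweedler (car C) (car C) (cop C c) (\<lambda>c1 c2. tw C Omega c1 \<otimes> cop C c2)
        = sweedler (car C) (car C) (cop C c) (\<lambda>c1 c2. cop C c1 \<otimes> tw C Psi c2)"

locale bihom_bialgebra = bihom_algebra H + bihom_coalgebra H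
  for H :: "('k::field, 'x, 'z) bialg_rec_scheme" +
  assumes cop_mul: "\<lbrakk>h \<in> car H; g \<in> car H\<rbrakk>
      \<Longrightarrow> cop H (mul H h g) =
        sweedler (car H) (car H) (cop H h) (\<lambda>h1 h2.
          sweedler (car H) (car H) (cop H g) (\<lambda>g1 g2. mul H h1 g1 \<otimes> mul H h2 g2))"
    and cou_mul: "\<lbrakk>h \<in> car H; g \<in> car H\<rbrakk> \<Longrightarrow> cou H (mul H h g) = cou H h * cou H g"
    and cop_one: "cop H (one H) = one H \<otimes> one H"
    and cou_one: "cou H (one H) = 1"
    and cop_tw': "\<lbrakk>\<theta> \<in> {Alpha, Beta}; h \<in> car H\<rbrakk>
      \<Longrightarrow> cop H (tw H \<theta> h) = sweedler (car H) (car H) (cop H h) (\<lambda>h1 h2. tw H \<theta> h1 \<otimes> tw H \<theta> h2)"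
    and cou_tw': "\<lbrakk>\<theta> \<in> {Alpha, Beta}; h \<in> car H\<rbrakk> \<Longrightarrow> cou H (tw H \<theta> h) = cou H h"
    and tw_mul': "\<lbrakk>\<theta> \<in> {Omega, Psi}; h \<in> car H; g \<in> car H\<rbrakk>
      \<Longrightarrow> tw H \<theta> (mul H h g) = mul H (tw H \<theta> h) (tw H \<theta> g)"
    and tw_one': "\<theta> \<in> {Omega, Psi} \<Longrightarrow> tw H \<theta> (one H) = one H"

locale bihom_hopf_algebra = bihom_bialgebra H
  for H :: "('k::field, 'x, 'z) hopf_rec_scheme" +
  assumes antip_lin: "antip H \<in> lin_map (car H) (car H)"
    and antip_tw: "h \<in> car H \<Longrightarrow> antip H (tw H \<theta> h) = tw H \<theta> (antip H h)"
    and antip_right: "h \<in> car H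
      \<Longrightarrow> sweedler (car H) (car H) (cop H h) (\<lambda>h1 h2. mul H h1 (antip H h2)) = cou H h *\<^sub>k one H"
    and antip_left: "h \<in> car H
      \<Longrightarrow> sweedler (car H) (car H) (cop H h) (\<lambda>h1 h2. mul H (antip H h1) h2) = cou H h *\<^sub>k one H"


section \<open>Yetter-Drinfel'd modules\<close>

record ('k, 'x) yd_rec = "('k, 'x) space_rec" +
  act :: "('k, 'x) arr \<Rightarrow> ('k, 'x) arr \<Rightarrow> ('k, 'x) arr"
  coact :: "('k, 'x) arr \<Rightarrow> ('k, 'x) arr"

locale right_module = twisted_space V
  for H :: "('k::field, 'x, 'y) bialg_rec_scheme" and V :: "('k, 'x, 'z) yd_rec_scheme" +
  assumes act_bilin: "act V \<in> bilin_map (car V) (car H) (car V)"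
    and act_tw: "\<lbrakk>v \<in> car V; h \<in> car H\<rbrakk> \<Longrightarrow> tw V \<theta> (act V v h) = act V (tw V \<theta> v) (tw H \<theta> h)"
    and act_mul: "\<lbrakk>v \<in> car V; h \<in> car H; g \<in> car H\<rbrakk>
      \<Longrightarrow> act V (act V v h) (tw H Beta g) = act V (tw V Alpha v) (mul H h g)"
    and act_one: "v \<in> car V \<Longrightarrow> act V v (one H) = tw V Alpha v"

locale right_comodule = twisted_space V
  for H :: "('k::field, 'x, 'y) bialg_rec_scheme" and V :: "('k, 'x, 'z) yd_rec_scheme" +
  assumes coact_lin: "coact V \<in> lin_map (car V) (car V \<otimes>\<^sub>S car H)"
    and coact_tw: "v \<in> car V
      \<Longrightarrow> coact V (tw V \<theta> v) = sweedler (car V) (car H) (coact V v) (\<lambda>v0 v1. tw V \<theta> v0 \<otimes> tw H \<theta> v1)"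
    and coact_coassoc: "v \<in> car V
      \<Longrightarrow> sweedler (car V) (car H) (coact V v) (\<lambda>v0 v1. tw V Omega v0 \<otimes> cop H v1)
        = sweedler (car V) (car H) (coact V v) (\<lambda>v0 v1. coact V v0 \<otimes> tw H Psi v1)"
    and coact_cou: "v \<in> car V
      \<Longrightarrow> sweedler (car V) (car H) (coact V v) (\<lambda>v0 v1. cou H v1 *\<^sub>k v0) = tw V Omega v"

locale yetter_drinfeld = right_module H V + right_comodule H V
  for H :: "('k::field, 'x, 'y) bialg_rec_scheme" and V :: "('k, 'x, 'z) yd_rec_scheme"
    and m n p q :: int +
  assumes yd: "\<lbrakk>h \<in> car H; v \<in> car V\<rbrakk>
    \<Longrightarrow> sweedler (car H) (car H) (cop H h) (\<lambda>h1 h2.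
          sweedler (car V) (car H) (coact V (act V v h2)) (\<lambda>x0 x1.
            x0 \<otimes> mul H (twp H (m - 2) (n + 1) (p - 2) (q + 1) h1) x1))
      = sweedler (car V) (car H) (coact V v) (\<lambda>v0 v1.
          sweedler (car H) (car H) (cop H h) (\<lambda>h1 h2.
            act V v0 (tw H Psi h1) \<otimes> mul H (tw H Beta v1) (twp H (m - 1) n (p - 1) q h2)))"

definition YD :: "('k::field, 'x, 'y) bialg_rec_scheme \<Rightarrow> int \<Rightarrow> int \<Rightarrow> int \<Rightarrow> int
    \<Rightarrow> ('k, 'x) yd_rec set"
  where "YD H m n p q = {V. yetter_drinfeld H V m n p q}"

text \<open>A morphism records its source and target.\<close>

datatype ('k, 'x) mor =
  Mor (src: "('k, 'x) yd_rec") (trg: "('k, 'x) yd_rec") (fn: "('k, 'x) arr \<Rightarrow> ('k, 'x) arr")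

definition YD_hom :: "('k::field, 'x, 'y) bialg_rec_scheme
    \<Rightarrow> ('k, 'x) yd_rec \<Rightarrow> ('k, 'x) yd_rec \<Rightarrow> ('k, 'x) mor set"
  where "YD_hom H V W = {Mor V W f | f. f \<in> lin_map (car V) (car W)
    \<and> (\<forall>\<theta>. \<forall>v\<in>car V. f (tw V \<theta> v) = tw W \<theta> (f v))
    \<and> (\<forall>v\<in>car V. \<forall>h\<in>car H. f (act V v h) = act W (f v) h)
    \<and> (\<forall>v\<in>car V. coact W (f v) = sweedler (car V) (car H) (coact V v) (\<lambda>v0 v1. f v0 \<otimes> v1))}"

definition YD_id :: "('k::field, 'x) yd_rec \<Rightarrow> ('k, 'x) mor"
  where "YD_id V = Mor V V (\<lambda>v\<in>car V. v)"

definition YD_comp :: "('k::field, 'x) mor \<Rightarrow> ('k, 'x) mor \<Rightarrow> ('k, 'x) mor"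
  where "YD_comp g f = Mor (src f) (trg g) (compose (car (src f)) (fn g) (fn f))"

definition YD_tensor :: "('k::field, 'x, 'y) bialg_rec_scheme
    \<Rightarrow> ('k, 'x) yd_rec \<Rightarrow> ('k, 'x) yd_rec \<Rightarrow> ('k, 'x) yd_rec"
  where "YD_tensor H V W =
    \<lparr> car = car V \<otimes>\<^sub>S car W,
      tw = (\<lambda>\<theta>. tensor_map (car V) (car W) (tw V \<theta>) (tw W \<theta>)),
      act = (\<lambda>t\<in>car V \<otimes>\<^sub>S car W. \<lambda>h\<in>car H.
        sweedler (car V) (car W) t (\<lambda>v w.
          sweedler (car H) (car H) (cop H h) (\<lambda>h1 h2.
            act V v (pw H Omega (- 1) h1) \<otimes> act W w (pw H Psi (- 1) h2)))),
      coact = (\<lambda>t\<in>car V \<otimes>\<^sub>S car W.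
        sweedler (car V) (car W) t (\<lambda>v w.
          sweedler (car V) (car H) (coact V v) (\<lambda>v0 v1.
            sweedler (car W) (car H) (coact W w) (\<lambda>w0 w1.
              v0 \<otimes> w0 \<otimes> mul H (pw H Alpha (- 1) v1) (pw H Beta (- 1) w1))))) \<rparr>"

definition YD_tensor_mor :: "('k::field, 'x, 'y) bialg_rec_scheme
    \<Rightarrow> ('k, 'x) mor \<Rightarrow> ('k, 'x) mor \<Rightarrow> ('k, 'x) mor"
  where "YD_tensor_mor H f g = Mor (YD_tensor H (src f) (src g)) (YD_tensor H (trg f) (trg g))
    (tensor_map (car (src f)) (car (src g)) (fn f) (fn g))"

text \<open>The unit object: the ground field with identity automorphisms, \<open>1 \<triangleleft> h = \<epsilon>(h)\<close> and
  \<open>\<rho>(1) = 1 \<otimes> 1\<^sub>H\<close>.\<close>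

definition YD_unit :: "('k::field, 'x, 'y) bialg_rec_scheme \<Rightarrow> ('k, 'x) yd_rec"
  where "YD_unit H =
    \<lparr> car = ground,
      tw = (\<lambda>\<theta>. \<lambda>x\<in>ground. x),
      act = (\<lambda>x\<in>ground. \<lambda>h\<in>car H. cou H h *\<^sub>k x),
      coact = (\<lambda>x\<in>ground. x \<otimes> one H) \<rparr>"

definition YD_braiding :: "('k::field, 'x, 'y) bialg_rec_scheme \<Rightarrow> int \<Rightarrow> int \<Rightarrow> int \<Rightarrow> int
    \<Rightarrow> ('k, 'x) yd_rec \<Rightarrow> ('k, 'x) yd_rec \<Rightarrow> ('k, 'x) mor"
  where "YD_braiding H m n p q V W = Mor (YD_tensor H V W) (YD_tensor H W V)
    (\<lambda>t\<in>car V \<otimes>\<^sub>S car W. sweedler (car V) (car W) t (\<lambda>v w.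
      sweedler (car W) (car H) (coact W w) (\<lambda>w0 w1.
        pw W Omega (- 1) w0
          \<otimes> act V (pw V Alpha (- 1) v) (twp H (- m + 1) (- n) (- p + 1) (- q) w1))))"

definition YD_braiding_inv :: "('k::field, 'x, 'y) hopf_rec_scheme \<Rightarrow> int \<Rightarrow> int \<Rightarrow> int \<Rightarrow> int
    \<Rightarrow> ('k, 'x) yd_rec \<Rightarrow> ('k, 'x) yd_rec \<Rightarrow> ('k, 'x) mor"
  where "YD_braiding_inv H m n p q V W = Mor (YD_tensor H W V) (YD_tensor H V W)
    (\<lambda>t\<in>car W \<otimes>\<^sub>S car V. sweedler (car W) (car V) t (\<lambda>w v.
      sweedler (car W) (car H) (coact W w) (\<lambda>w0 w1.
        act V (pw V Alpha (- 1) v)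
          (inv_into (car H) (antip H) (twp H (- m) (- n + 1) (- p) (- q + 1) w1))
          \<otimes> pw W Omega (- 1) w0)))"


section \<open>Braided monoidal categories\<close>

definition is_inverse :: "('o \<Rightarrow> 'o \<Rightarrow> 'a set) \<Rightarrow> ('o \<Rightarrow> 'a) \<Rightarrow> ('a \<Rightarrow> 'a \<Rightarrow> 'a)
    \<Rightarrow> 'o \<Rightarrow> 'o \<Rightarrow> 'a \<Rightarrow> 'a \<Rightarrow> bool"
  where "is_inverse Hom ide Comp A B f g \<longleftrightarrow>
    f \<in> Hom A B \<and> g \<in> Hom B A \<and> Comp g f = ide A \<and> Comp f g = ide B"

definition is_iso :: "('o \<Rightarrow> 'o \<Rightarrow> 'a set) \<Rightarrow> ('o \<Rightarrow> 'a) \<Rightarrow> ('a \<Rightarrow> 'a \<Rightarrow> 'a)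
    \<Rightarrow> 'o \<Rightarrow> 'o \<Rightarrow> 'a \<Rightarrow> bool"
  where "is_iso Hom ide Comp A B f \<longleftrightarrow> (\<exists>g. is_inverse Hom ide Comp A B f g)"

locale category =
  fixes Ob :: "'o set" and Hom :: "'o \<Rightarrow> 'o \<Rightarrow> 'a set" and ide :: "'o \<Rightarrow> 'a"
    and Comp :: "'a \<Rightarrow> 'a \<Rightarrow> 'a" (infixr "\<bullet>" 60)
  assumes Hom_disjoint: "\<lbrakk>A \<in> Ob; B \<in> Ob; A' \<in> Ob; B' \<in> Ob; f \<in> Hom A B; f \<in> Hom A' B'\<rbrakk>
      \<Longrightarrow> A = A' \<and> B = B'"
    and Id_in: "A \<in> Ob \<Longrightarrow> ide A \<in> Hom A A"
    and Comp_in: "\<lbrakk>A \<in> Ob; B \<in> Ob; C \<in> Ob; f \<in> Hom A B; g \<in> Hom B C\<rbrakk> \<Longrightarrow> g \<bullet> f \<in> Hom A C"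
    and Id_left: "\<lbrakk>A \<in> Ob; B \<in> Ob; f \<in> Hom A B\<rbrakk> \<Longrightarrow> ide B \<bullet> f = f"
    and Id_right: "\<lbrakk>A \<in> Ob; B \<in> Ob; f \<in> Hom A B\<rbrakk> \<Longrightarrow> f \<bullet> ide A = f"
    and Comp_assoc: "\<lbrakk>A \<in> Ob; B \<in> Ob; C \<in> Ob; D \<in> Ob; f \<in> Hom A B; g \<in> Hom B C; h \<in> Hom C D\<rbrakk>
      \<Longrightarrow> (h \<bullet> g) \<bullet> f = h \<bullet> (g \<bullet> f)"

locale monoidal_category = category Ob Hom ide Comp
  for Ob :: "'o set" and Hom :: "'o \<Rightarrow> 'o \<Rightarrow> 'a set" and ide :: "'o \<Rightarrow> 'a"
    and Comp :: "'a \<Rightarrow> 'a \<Rightarrow> 'a" (infixr "\<bullet>" 60) +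
  fixes T\<^sub>0 :: "'o \<Rightarrow> 'o \<Rightarrow> 'o" (infixr "\<otimes>\<^sub>0" 70)
    and T\<^sub>1 :: "'a \<Rightarrow> 'a \<Rightarrow> 'a" (infixr "\<otimes>\<^sub>1" 70)
    and I :: 'o
    and assoc :: "'o \<Rightarrow> 'o \<Rightarrow> 'o \<Rightarrow> 'a"
    and lunit :: "'o \<Rightarrow> 'a"
    and runit :: "'o \<Rightarrow> 'a"
  assumes tensor_Ob: "\<lbrakk>A \<in> Ob; B \<in> Ob\<rbrakk> \<Longrightarrow> A \<otimes>\<^sub>0 B \<in> Ob"
    and tensor_Hom: "\<lbrakk>A \<in> Ob; B \<in> Ob; A' \<in> Ob; B' \<in> Ob; f \<in> Hom A A'; g \<in> Hom B B'\<rbrakk>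
      \<Longrightarrow> f \<otimes>\<^sub>1 g \<in> Hom (A \<otimes>\<^sub>0 B) (A' \<otimes>\<^sub>0 B')"
    and tensor_Id: "\<lbrakk>A \<in> Ob; B \<in> Ob\<rbrakk> \<Longrightarrow> ide A \<otimes>\<^sub>1 ide B = ide (A \<otimes>\<^sub>0 B)"
    and tensor_Comp: "\<lbrakk>A \<in> Ob; A' \<in> Ob; A'' \<in> Ob; B \<in> Ob; B' \<in> Ob; B'' \<in> Ob;
        f \<in> Hom A A'; f' \<in> Hom A' A''; g \<in> Hom B B'; g' \<in> Hom B' B''\<rbrakk>
      \<Longrightarrow> (f' \<bullet> f) \<otimes>\<^sub>1 (g' \<bullet> g) = (f' \<otimes>\<^sub>1 g') \<bullet> (f \<otimes>\<^sub>1 g)"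
    and I_Ob: "I \<in> Ob"
    and assoc_iso: "\<lbrakk>A \<in> Ob; B \<in> Ob; C \<in> Ob\<rbrakk>
      \<Longrightarrow> is_iso Hom ide Comp ((A \<otimes>\<^sub>0 B) \<otimes>\<^sub>0 C) (A \<otimes>\<^sub>0 (B \<otimes>\<^sub>0 C)) (assoc A B C)"
    and assoc_natural: "\<lbrakk>A \<in> Ob; B \<in> Ob; C \<in> Ob; A' \<in> Ob; B' \<in> Ob; C' \<in> Ob;
        f \<in> Hom A A'; g \<in> Hom B B'; h \<in> Hom C C'\<rbrakk>
      \<Longrightarrow> assoc A' B' C' \<bullet> ((f \<otimes>\<^sub>1 g) \<otimes>\<^sub>1 h) = (f \<otimes>\<^sub>1 (g \<otimes>\<^sub>1 h)) \<bullet> assoc A B C"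
    and lunit_iso: "A \<in> Ob \<Longrightarrow> is_iso Hom ide Comp (I \<otimes>\<^sub>0 A) A (lunit A)"
    and lunit_natural: "\<lbrakk>A \<in> Ob; B \<in> Ob; f \<in> Hom A B\<rbrakk> \<Longrightarrow> lunit B \<bullet> (ide I \<otimes>\<^sub>1 f) = f \<bullet> lunit A"
    and runit_iso: "A \<in> Ob \<Longrightarrow> is_iso Hom ide Comp (A \<otimes>\<^sub>0 I) A (runit A)"
    and runit_natural: "\<lbrakk>A \<in> Ob; B \<in> Ob; f \<in> Hom A B\<rbrakk> \<Longrightarrow> runit B \<bullet> (f \<otimes>\<^sub>1 ide I) = f \<bullet> runit A"
    and pentagon: "\<lbrakk>A \<in> Ob; B \<in> Ob; C \<in> Ob; D \<in> Ob\<rbrakk>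
      \<Longrightarrow> (ide A \<otimes>\<^sub>1 assoc B C D) \<bullet> assoc A (B \<otimes>\<^sub>0 C) D \<bullet> (assoc A B C \<otimes>\<^sub>1 ide D)
        = assoc A B (C \<otimes>\<^sub>0 D) \<bullet> assoc (A \<otimes>\<^sub>0 B) C D"
    and triangle: "\<lbrakk>A \<in> Ob; B \<in> Ob\<rbrakk>
      \<Longrightarrow> (ide A \<otimes>\<^sub>1 lunit B) \<bullet> assoc A I B = runit A \<otimes>\<^sub>1 ide B"

locale braided_monoidal_category = monoidal_category Ob Hom ide Comp T\<^sub>0 T\<^sub>1 I assoc lunit runit
  for Ob :: "'o set" and Hom :: "'o \<Rightarrow> 'o \<Rightarrow> 'a set" and ide :: "'o \<Rightarrow> 'a"
    and Comp :: "'a \<Rightarrow> 'a \<Rightarrow> 'a" (infixr "\<bullet>" 60)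
    and T\<^sub>0 :: "'o \<Rightarrow> 'o \<Rightarrow> 'o" (infixr "\<otimes>\<^sub>0" 70)
    and T\<^sub>1 :: "'a \<Rightarrow> 'a \<Rightarrow> 'a" (infixr "\<otimes>\<^sub>1" 70)
    and I assoc lunit runit +
  fixes c :: "'o \<Rightarrow> 'o \<Rightarrow> 'a"
  assumes c_iso: "\<lbrakk>A \<in> Ob; B \<in> Ob\<rbrakk> \<Longrightarrow> is_iso Hom ide Comp (A \<otimes>\<^sub>0 B) (B \<otimes>\<^sub>0 A) (c A B)"
    and c_natural: "\<lbrakk>A \<in> Ob; B \<in> Ob; A' \<in> Ob; B' \<in> Ob; f \<in> Hom A A'; g \<in> Hom B B'\<rbrakk>
      \<Longrightarrow> c A' B' \<bullet> (f \<otimes>\<^sub>1 g) = (g \<otimes>\<^sub>1 f) \<bullet> c A B"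
    and hexagon: "\<lbrakk>A \<in> Ob; B \<in> Ob; C \<in> Ob\<rbrakk>
      \<Longrightarrow> assoc B C A \<bullet> c A (B \<otimes>\<^sub>0 C) \<bullet> assoc A B C
        = (ide B \<otimes>\<^sub>1 c A C) \<bullet> assoc B A C \<bullet> (c A B \<otimes>\<^sub>1 ide C)"
    and hexagon_inv: "\<lbrakk>A \<in> Ob; B \<in> Ob; C \<in> Ob;
        is_inverse Hom ide Comp ((C \<otimes>\<^sub>0 A) \<otimes>\<^sub>0 B) (C \<otimes>\<^sub>0 (A \<otimes>\<^sub>0 B)) (assoc C A B) a\<^sub>1;
        is_inverse Hom ide Comp ((A \<otimes>\<^sub>0 B) \<otimes>\<^sub>0 C) (A \<otimes>\<^sub>0 (B \<otimes>\<^sub>0 C)) (assoc A B C) a\<^sub>2;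
        is_inverse Hom ide Comp ((A \<otimes>\<^sub>0 C) \<otimes>\<^sub>0 B) (A \<otimes>\<^sub>0 (C \<otimes>\<^sub>0 B)) (assoc A C B) a\<^sub>3\<rbrakk>
      \<Longrightarrow> a\<^sub>1 \<bullet> c (A \<otimes>\<^sub>0 B) C \<bullet> a\<^sub>2 = (c A C \<otimes>\<^sub>1 ide B) \<bullet> a\<^sub>3 \<bullet> (ide A \<otimes>\<^sub>1 c B C)"

text \<open>Strict: all constraints are identities.  As hom sets are disjoint, this forces
  \<open>(A \<otimes>\<^sub>0 B) \<otimes>\<^sub>0 C = A \<otimes>\<^sub>0 (B \<otimes>\<^sub>0 C)\<close> and \<open>I \<otimes>\<^sub>0 A = A = A \<otimes>\<^sub>0 I\<close> for objects.\<close>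

locale strict_braided_monoidal_category =
  braided_monoidal_category Ob Hom ide Comp T\<^sub>0 T\<^sub>1 I
    "\<lambda>A B C. ide (T\<^sub>0 (T\<^sub>0 A B) C)" "\<lambda>A. ide (T\<^sub>0 I A)" "\<lambda>A. ide (T\<^sub>0 A I)" c
  for Ob Hom ide Comp T\<^sub>0 T\<^sub>1 I c

end

theory Submission
  imports Defs
begin

text \<open>
  The four automorphisms can be twisted away.  With the product \<open>\<alpha>\<^sup>-\<^sup>1(a) \<beta>\<^sup>-\<^sup>1(b)\<close> and the coproduct
  \<open>\<omega>\<^sup>-\<^sup>1(h\<^sub>1) \<otimes> \<psi>\<^sup>-\<^sup>1(h\<^sub>2)\<close> the space \<open>H\<close> is an ordinary bialgebra.  The antipode axioms say that
  \<open>\<alpha>\<^sup>-\<^sup>1\<beta>\<omega>\<^sup>-\<^sup>1\<psi>S\<close> is a right and \<open>\<alpha>\<beta>\<^sup>-\<^sup>1\<omega>\<psi>\<^sup>-\<^sup>1S\<close> a left convolution inverse of the identity; so the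
  two maps coincide and are an ordinary antipode.  With the action \<open>\<alpha>\<^sup>-\<^sup>1(v) \<triangleleft> \<beta>\<^sup>-\<^sup>1(h)\<close> and the coaction
  \<open>\<omega>\<^sup>-\<^sup>1(v\<^sub>0) \<otimes> \<alpha>\<^bsup>1-m\<^esup>\<beta>\<^bsup>1-n\<^esup>\<omega>\<^bsup>1-p\<^esup>\<psi>\<^bsup>-q\<^esup>(v\<^sub>1)\<close> the modules become ordinary right-right Yetter-Drinfel'd
  modules with four commuting automorphisms, the tensor product becomes the usual one, and the braiding
  becomes \<open>v \<otimes> w \<mapsto> w\<^sub>0 \<otimes> v w\<^sub>1\<close> with inverse \<open>w \<otimes> v \<mapsto> v T(w\<^sub>1) \<otimes> w\<^sub>0\<close>, where \<open>T\<close> is the inverse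
  antipode.  The classical computations then apply.

  Linear maps are extended from their carrier to the type of all arrays by composing with a linear
  projection, which frees the Sweedler calculus from membership conditions.
\<close>

section \<open>Multilinear maps and Sweedler sums\<close>

text \<open>Strictness demands equality of records, although every Sweedler sum is read off an
  arbitrarily chosen decomposition. Coproducts and coactions are therefore kept as lists of pairs
  that are never compared with each other: each law says that sums of a bilinear or trilinear test
  map agree, and the tensor itself is recovered by testing with \<open>\<otimes>\<close>.

  The exponents in the coaction have this origin. Twisting its second leg by a product \<phi> of
  powers of the automorphisms disturbs neither coassociativity nor the counit law, so \<phi> is
  free. Written with the untwisted product and coproduct, the compatibility condition has
  \<alpha>^(m-1) \<beta>^(n+1) \<omega>^(p-1) \<psi>^(q+1) on the part of h in the second tensor
  factor, on both sides. Cancelling this factor after substituting \<beta>^(-1) \<psi>^(-1)(h) for h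
  and \<alpha>^(-1)(v) for v leaves exactly the stated \<phi> on the second leg of the coaction on
  both sides, and m, n, p, q disappear.

  Tensor products and the unit object have to satisfy the original axioms, so each axiom is
  translated by an equivalence and not only in one direction.\<close>

definition lin :: "(('k::field, 'x) arr \<Rightarrow> ('k, 'x) arr) \<Rightarrow> bool"
  where "lin f \<longleftrightarrow> (\<forall>x y. f (x + y) = f x + f y) \<and> (\<forall>c x. f (c *\<^sub>k x) = c *\<^sub>k f x)"

definition lin_fn :: "(('k::field, 'x) arr \<Rightarrow> 'k) \<Rightarrow> bool"
  where "lin_fn f \<longleftrightarrow> (\<forall>x y. f (x + y) = f x + f y) \<and> (\<forall>c x. f (c *\<^sub>k x) = c * f x)"

definition bilin :: "(('k::field, 'x) arr \<Rightarrow> ('k, 'x) arr \<Rightarrow> ('k, 'x) arr) \<Rightarrow> bool"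
  where "bilin F \<longleftrightarrow> (\<forall>b. lin (\<lambda>a. F a b)) \<and> (\<forall>a. lin (\<lambda>b. F a b))"

definition trilin :: "(('k::field, 'x) arr \<Rightarrow> ('k, 'x) arr \<Rightarrow> ('k, 'x) arr \<Rightarrow> ('k, 'x) arr) \<Rightarrow> bool"
  where "trilin F \<longleftrightarrow> (\<forall>b c. lin (\<lambda>a. F a b c)) \<and> (\<forall>a c. lin (\<lambda>b. F a b c)) \<and> (\<forall>a b. lin (\<lambda>c. F a b c))"

text \<open>Separating the decomposition from the test map turns Sweedler notation into nested
  finite sums, which can be swapped and merged without knowing which tensor they came from.\<close>

definition sw :: "(('k::field, 'x) arr \<times> ('k, 'x) arr) list
    \<Rightarrow> (('k, 'x) arr \<Rightarrow> ('k, 'x) arr \<Rightarrow> ('k, 'x) arr) \<Rightarrow> ('k, 'x) arr"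
  where "sw ps F = (\<Sum>(a, b)\<leftarrow>ps. F a b)"

text \<open>Rewriting with a law under a Sweedler sum requires the test map to be multilinear. These
  rules decide that syntactically, one structure map at a time.\<close>

named_theorems lin_intros

lemma lin_add: "lin f \<Longrightarrow> f (x + y) = f x + f y"
  and lin_scale: "lin f \<Longrightarrow> f (c *\<^sub>k x) = c *\<^sub>k f x"
  by (auto simp: lin_def)

lemma lin_zero: "lin f \<Longrightarrow> f 0 = 0"
  using lin_scale [of f 0 0] by simp

lemma lin_ident [lin_intros]: "lin (\<lambda>x. x)"
  by (simp add: lin_def)

lemma bilinI [lin_intros]:
  "(\<And>b. lin (\<lambda>a. F a b)) \<Longrightarrow> (\<And>a. lin (\<lambda>b. F a b)) \<Longrightarrow> bilin F"
  by (simp add: bilin_def)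

lemma trilinI [lin_intros]:
  "(\<And>b c. lin (\<lambda>a. F a b c)) \<Longrightarrow> (\<And>a c. lin (\<lambda>b. F a b c)) \<Longrightarrow> (\<And>a b. lin (\<lambda>c. F a b c)) \<Longrightarrow> trilin F"
  by (simp add: trilin_def)

lemma lin_comp: "lin f \<Longrightarrow> lin g \<Longrightarrow> lin (\<lambda>x. f (g x))"
  by (simp add: lin_def)

lemma bilin_left: "bilin F \<Longrightarrow> lin f \<Longrightarrow> lin (\<lambda>x. F (f x) b)"
  by (simp add: lin_def bilin_def)

lemma bilin_right: "bilin F \<Longrightarrow> lin f \<Longrightarrow> lin (\<lambda>x. F a (f x))"
  by (simp add: lin_def bilin_def)

lemma trilin_1: "trilin F \<Longrightarrow> lin f \<Longrightarrow> lin (\<lambda>x. F (f x) b c)"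
  and trilin_2: "trilin F \<Longrightarrow> lin f \<Longrightarrow> lin (\<lambda>x. F a (f x) c)"
  and trilin_3: "trilin F \<Longrightarrow> lin f \<Longrightarrow> lin (\<lambda>x. F a b (f x))"
  by (simp_all add: lin_def trilin_def)

lemmas bilin_lins = bilin_left bilin_right
lemmas trilin_lins = trilin_1 trilin_2 trilin_3

lemma bilin_tensor [lin_intros]: "bilin (\<otimes>)"
  by (simp add: bilin_def lin_def tensor_add_left tensor_add_right tensor_scale_left tensor_scale_right)

lemma lin_tensor_left [lin_intros]: "lin f \<Longrightarrow> lin (\<lambda>x. f x \<otimes> b)"
  and lin_tensor_right [lin_intros]: "lin f \<Longrightarrow> lin (\<lambda>x. a \<otimes> f x)"
  by (simp_all add: bilin_lins [OF bilin_tensor])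

lemma lin_scale_arr [lin_intros]: "lin f \<Longrightarrow> lin (\<lambda>x. c *\<^sub>k f x)"
  by (simp add: lin_def arr.scale_right_distrib mult.commute)

lemma lin_fn_scale: "lin_fn e \<Longrightarrow> lin f \<Longrightarrow> lin (\<lambda>x. e (f x) *\<^sub>k v)"
  by (simp add: lin_def lin_fn_def arr.scale_left_distrib)

lemma sw_Nil [simp]: "sw [] F = 0"
  and sw_Cons [simp]: "sw ((a, b) # ps) F = F a b + sw ps F"
  and sw_append: "sw (ps @ qs) F = sw ps F + sw qs F"
  by (simp_all add: sw_def)

lemma sw_map: "sw (map (\<lambda>(a, b). (f a, g b)) ps) F = sw ps (\<lambda>a b. F (f a) (g b))"
  by (induction ps) auto

lemma lin_sw [lin_intros]: "(\<And>a b. lin (\<lambda>x. F x a b)) \<Longrightarrow> lin (\<lambda>x. sw ps (F x))"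
  by (induction ps) (auto simp: lin_def arr.scale_right_distrib algebra_simps)

lemma sw_lin: "lin f \<Longrightarrow> f (sw ps F) = sw ps (\<lambda>a b. f (F a b))"
  by (induction ps) (simp_all add: lin_zero [of f] lin_add [of f] split_paired_all)

lemma sw_scale: "sw ps (\<lambda>a b. c *\<^sub>k F a b) = c *\<^sub>k sw ps F"
  by (simp add: sw_lin [OF lin_scale_arr, OF lin_ident])

lemma sw_add: "sw ps (\<lambda>a b. F a b + G a b) = sw ps F + sw ps G"
  by (induction ps) (auto simp: algebra_simps)

lemma sw_swap: "sw ps (\<lambda>a b. sw qs (\<lambda>c d. F a b c d)) = sw qs (\<lambda>c d. sw ps (\<lambda>a b. F a b c d))"
proof (induction ps)
  case Nil
  show ?case by (induction qs) auto
qed (auto simp: sw_add)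

lemma sw_cong:
  "set ps \<subseteq> V \<times> W \<Longrightarrow> (\<And>a b. a \<in> V \<Longrightarrow> b \<in> W \<Longrightarrow> F a b = G a b) \<Longrightarrow> sw ps F = sw ps G"
  by (induction ps) auto

lemma sw_in:
  assumes "arr.subspace X" "set ps \<subseteq> V \<times> W" "\<And>a b. a \<in> V \<Longrightarrow> b \<in> W \<Longrightarrow> F a b \<in> X"
  shows "sw ps F \<in> X"
  using assms(2)
proof (induction ps)
  case Nil
  then show ?case using arr.subspace_0 [OF assms(1)] by (simp add: zero_fun_def)
next
  case (Cons p ps)
  then show ?case
    using arr.subspace_add [OF assms(1)] assms(3) by (cases p) (simp add: plus_fun_def)
qed


subsection \<open>Linear extension of maps given on a subspace\<close>

definition proj :: "('k::field, 'x) arr set \<Rightarrow> ('k, 'x) arr \<Rightarrow> ('k, 'x) arr"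
  where "proj V = (SOME p. lin p \<and> range p \<subseteq> V \<and> (\<forall>x\<in>V. p x = x))"

lemma vspace_subspace: "vspace V \<Longrightarrow> arr.subspace V"
  by (simp add: vspace_def)

lemma
  fixes V :: "('k::field, 'x) arr set"
  assumes "vspace V"
  shows lin_proj: "lin (proj V)" and proj_in [simp]: "proj V x \<in> V"
    and proj_ident [simp]: "x \<in> V \<Longrightarrow> proj V x = x"
proof -
  interpret p: vector_space_pair "scale_arr :: 'k \<Rightarrow> ('k, 'x) arr \<Rightarrow> ('k, 'x) arr" scale_arr ..
  have "\<exists>p. lin p \<and> range p \<subseteq> V \<and> (\<forall>x\<in>V. p x = x)"
    \<comment> \<open>A linear left inverse of the identity restricted to the subspace
      \<open>V\<close>, with range in \<open>V\<close>, is a projection onto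
      \<open>V\<close>.\<close>
    using p.linear_exists_left_inverse_on [OF arr.linear_id vspace_subspace [OF assms]]
    unfolding lin_def Vector_Spaces.linear_iff by auto
  from someI_ex [OF this] show "lin (proj V)" "proj V x \<in> V" "x \<in> V \<Longrightarrow> proj V x = x"
    by (auto simp: proj_def)
qed

lemma lin_proj' [lin_intros]: "vspace V \<Longrightarrow> lin f \<Longrightarrow> lin (\<lambda>x. proj V (f x))"
  by (rule lin_comp [OF lin_proj])

lemma lin_mapD:
  assumes "f \<in> lin_map V W"
  shows "x \<in> V \<Longrightarrow> f x \<in> W" "x \<in> V \<Longrightarrow> y \<in> V \<Longrightarrow> f (x + y) = f x + f y"
    "x \<in> V \<Longrightarrow> f (c *\<^sub>k x) = c *\<^sub>k f x" "x \<notin> V \<Longrightarrow> f x = undefined" "f \<in> extensional V"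
  using assms by (auto simp: lin_map_def PiE_def extensional_def)

lemma lin_map_proj: "vspace V \<Longrightarrow> f \<in> lin_map V W \<Longrightarrow> lin (\<lambda>x. f (proj V x))"
  using lin_mapD(2,3) [of f V W] by (simp add: lin_def lin_add [OF lin_proj] lin_scale [OF lin_proj])

lemma lin_mapI:
  assumes "vspace V" "lin f" "\<And>x. x \<in> V \<Longrightarrow> f x \<in> W"
  shows "(\<lambda>x\<in>V. f x) \<in> lin_map V W"
  using assms vspace_subspace [OF assms(1)]
  by (simp add: lin_map_def lin_def arr.subspace_add arr.subspace_scale)

lemma lin_map_cong: "\<lbrakk>f \<in> extensional V; \<And>x. x \<in> V \<Longrightarrow> f x = g x\<rbrakk> \<Longrightarrow> f = (\<lambda>x\<in>V. g x)"
  by (rule extensionalityI [where A = V]) auto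

lemma lin_map_iff:
  assumes "vspace V"
  shows "f \<in> lin_map V W \<longleftrightarrow> f \<in> extensional V \<and> f \<in> V \<rightarrow> W \<and> lin (\<lambda>x. f (proj V x))" (is "_ = ?R")
proof
  assume ?R
  then have "(\<lambda>x\<in>V. f (proj V x)) \<in> lin_map V W"
    using assms by (intro lin_mapI) (simp_all add: Pi_iff)
  moreover have "(\<lambda>x\<in>V. f (proj V x)) = f"
    using \<open>?R\<close> assms by (intro lin_map_cong [symmetric]) auto
  ultimately show "f \<in> lin_map V W" by simp
next
  assume f: "f \<in> lin_map V W"
  have "f \<in> V \<rightarrow> W" by (rule funcsetI) (rule lin_mapD(1) [OF f])
  then show ?R using lin_map_proj [OF assms f] lin_mapD(5) [OF f] by blast
qed

lemma bilin_map_iff: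
  assumes "vspace U" "vspace V"
  shows "F \<in> bilin_map U V W \<longleftrightarrow> F \<in> extensional U \<and> (\<forall>u\<in>U. F u \<in> extensional V)
    \<and> (\<forall>u\<in>U. \<forall>v\<in>V. F u v \<in> W) \<and> bilin (\<lambda>u v. F (proj U u) (proj V v))" (is "_ = ?R")
proof
  assume F: "F \<in> bilin_map U V W"
  then have "F u \<in> lin_map V W" if "u \<in> U" for u using that by (auto simp: bilin_map_def)
  moreover have "(\<lambda>u\<in>U. F u v) \<in> lin_map U W" if "v \<in> V" for v
    using that F by (auto simp: bilin_map_def)
  then have "lin (\<lambda>u. F (proj U u) v)" if "v \<in> V" for v
    using lin_map_proj [OF assms(1), of "\<lambda>u\<in>U. F u v" W] that assms(1) by simp
  moreover have "F \<in> extensional U" using F by (simp add: bilin_map_def PiE_def)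
  ultimately show ?R
    using lin_map_proj [OF assms(2), of "F _" W] lin_mapD(1,5) [of "F _" V W] assms
    by (simp add: bilin_def)
next
  assume R: ?R
  have "F u \<in> lin_map V W" if "u \<in> U" for u
  proof -
    have "lin (\<lambda>v. F (proj U u) (proj V v))" using R by (auto simp: bilin_def)
    then show ?thesis using R that assms(1) by (simp add: lin_map_iff [OF assms(2)])
  qed
  moreover have "(\<lambda>u\<in>U. F u v) \<in> lin_map U W" if "v \<in> V" for v
  proof -
    have "lin (\<lambda>u. F (proj U u) (proj V v))" using R by (auto simp: bilin_def)
    then show ?thesis using R that assms by (simp add: lin_map_iff [OF assms(1)])
  qed
  ultimately show "F \<in> bilin_map U V W" using R by (auto simp: bilin_map_def extensional_def PiE_def)
qed

section \<open>Chosen decompositions of tensors into pure tensors\<close>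

text \<open>The very choice made inside \<open>sweedler\<close>, isolated so that its list can be
  passed to \<open>sw\<close>. Nothing about this list is canonical.\<close>

definition dec :: "('k::field, 'x) arr set \<Rightarrow> ('k, 'x) arr set \<Rightarrow> ('k, 'x) arr
    \<Rightarrow> (('k, 'x) arr \<times> ('k, 'x) arr) list"
  where "dec V W t = (SOME ps. set ps \<subseteq> V \<times> W \<and> t = (\<Sum>(v, w)\<leftarrow>ps. v \<otimes> w))"

lemma sweedler_sw: "sweedler V W t F = sw (dec V W t) F"
  by (simp add: sweedler_def sw_def dec_def Let_def)

lemma dec_tensor:
  assumes "vspace V" "t \<in> V \<otimes>\<^sub>S W"
  shows "set (dec V W t) \<subseteq> V \<times> W" "sw (dec V W t) (\<otimes>) = t"
  using someI_ex [OF assms(2) [unfolded tensor_space_elem [OF assms(1)]]]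
  by (simp_all add: dec_def sw_def)

text \<open>A bilinear map factors through the tensor product, so the chosen decomposition may be
  exchanged for any explicit one. All well-definedness of Sweedler sums goes back to this.\<close>

lemma sw_dec:
  assumes "vspace V" "vspace W" "bilin F" "set ps \<subseteq> V \<times> W"
  shows "sw (dec V W (sw ps (\<otimes>))) F = sw ps F"
  using sweedler_sum_list [OF arr.vector_space_axioms assms(1,2), of F ps] assms(3,4)
  unfolding sweedler_sw sw_def [symmetric] by (simp add: bilin_def lin_def)

lemma sw_dec_tensor:
  assumes "vspace V" "vspace W" "bilin F" "v \<in> V" "w \<in> W"
  shows "sw (dec V W (v \<otimes> w)) F = F v w"
  using sw_dec [OF assms(1-3), of "[(v, w)]"] assms by simp

lemma sw_dec_add:
  assumes "vspace V" "vspace W" "bilin F" "s \<in> V \<otimes>\<^sub>S W" "t \<in> V \<otimes>\<^sub>S W"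
  shows "sw (dec V W (s + t)) F = sw (dec V W s) F + sw (dec V W t) F"
  using sw_dec [OF assms(1-3), of "dec V W s @ dec V W t"] dec_tensor [OF assms(1)] assms(4,5)
  by (simp add: sw_append)

lemma sw_dec_scale:
  assumes "vspace V" "vspace W" "bilin F" "t \<in> V \<otimes>\<^sub>S W"
  shows "sw (dec V W (c *\<^sub>k t)) F = c *\<^sub>k sw (dec V W t) F"
proof -
  \<comment> \<open>Scaling all left components gives an explicit decomposition of the scaled
    tensor, to be compared with the chosen one.\<close>
  define ps where "ps = map (\<lambda>(a, b). (c *\<^sub>k a, b)) (dec V W t)"
  have ps: "sw ps G = c *\<^sub>k sw (dec V W t) G" if "bilin G" for G
    unfolding ps_def using sw_map [of "\<lambda>a. c *\<^sub>k a" "\<lambda>b. b" "dec V W t" G] that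
    by (simp add: bilin_def lin_scale [where f = "\<lambda>a. G a _"] sw_scale)
  have "set ps \<subseteq> V \<times> W"
    using dec_tensor [OF assms(1,4)] vspace_subspace [OF assms(1)]
    unfolding ps_def by (auto simp: arr.subspace_scale)
  from sw_dec [OF assms(1-3) this] show ?thesis
    using ps [OF assms(3)] ps [OF bilin_tensor] dec_tensor [OF assms(1,4)] by simp
qed

lemma lin_sw_dec:
  assumes "vspace V" "vspace W" "bilin F" "lin f" "\<And>x. f x \<in> V \<otimes>\<^sub>S W"
  shows "lin (\<lambda>x. sw (dec V W (f x)) F)"
  using assms by (simp add: lin_def sw_dec_add sw_dec_scale)

lemma sw_dec_sw:
  assumes "vspace V" "vspace W" "bilin F" "set ps \<subseteq> A \<times> B"
    "\<And>a b. a \<in> A \<Longrightarrow> b \<in> B \<Longrightarrow> G a b \<in> V \<otimes>\<^sub>S W"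
  shows "sw (dec V W (sw ps G)) F = sw ps (\<lambda>a b. sw (dec V W (G a b)) F)"
proof -
  \<comment> \<open>With the projection inserted the chosen sum is linear on all arrays, so it can
    be pulled into the outer sum by \<open>sw_lin\<close>.\<close>
  let ?f = "\<lambda>t. sw (dec V W (proj (V \<otimes>\<^sub>S W) t)) F"
  have VW: "vspace (V \<otimes>\<^sub>S W)" using assms vspace_tensor_space by blast
  have "lin ?f" using assms VW by (intro lin_sw_dec lin_proj) auto
  from sw_lin [OF this, of ps G]
  have "?f (sw ps G) = sw ps (\<lambda>a b. sw (dec V W (G a b)) F)"
    using sw_cong [OF assms(4), of "\<lambda>a b. ?f (G a b)" "\<lambda>a b. sw (dec V W (G a b)) F"] assms(5) VW
    by simp
  moreover have "sw ps G \<in> V \<otimes>\<^sub>S W"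
    using sw_in [OF vspace_subspace [OF VW]] assms by blast
  ultimately show ?thesis using VW by simp
qed

lemma tensor_in [simp, intro]: "v \<in> V \<Longrightarrow> w \<in> W \<Longrightarrow> v \<otimes> w \<in> V \<otimes>\<^sub>S W"
  unfolding tensor_space_def by (rule arr.span_base) auto

lemma tensor_ext:
  assumes "vspace V" "lin f" "lin g" "\<And>v w. v \<in> V \<Longrightarrow> w \<in> W \<Longrightarrow> f (v \<otimes> w) = g (v \<otimes> w)"
    and t: "t \<in> V \<otimes>\<^sub>S W"
  shows "f t = g t"
proof -
  have "f (sw (dec V W t) (\<otimes>)) = g (sw (dec V W t) (\<otimes>))"
    unfolding sw_lin [OF assms(2)] sw_lin [OF assms(3)]
    by (rule sw_cong [OF dec_tensor(1) [OF assms(1) t]]) (rule assms(4))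
  then show ?thesis using dec_tensor(2) [OF assms(1) t] by simp
qed

section \<open>Associativity and unit laws of tensor spaces\<close>

lemma tensor_subset:
  assumes "vspace V" "vspace X" "\<And>v w. v \<in> V \<Longrightarrow> w \<in> W \<Longrightarrow> v \<otimes> w \<in> X"
  shows "V \<otimes>\<^sub>S W \<subseteq> X"
  unfolding tensor_space_def by (rule arr.span_minimal) (use assms vspace_subspace in auto)

lemma sw_tensor_left: "sw ps F \<otimes> w = sw ps (\<lambda>a b. F a b \<otimes> w)"
  and sw_tensor_right: "w \<otimes> sw ps F = sw ps (\<lambda>a b. w \<otimes> F a b)"
  by (simp_all add: sw_lin [OF lin_tensor_left [OF lin_ident]] sw_lin [OF lin_tensor_right [OF lin_ident]])

text \<open>The outer product of arrays is associative on the nose, so it suffices to expand the one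
  factor that is itself a tensor.\<close>

lemma tensor_space_assoc:
  assumes "vspace U" "vspace V" "vspace W"
  shows "(U \<otimes>\<^sub>S V) \<otimes>\<^sub>S W = U \<otimes>\<^sub>S (V \<otimes>\<^sub>S W)"
proof
  note vs = assms vspace_tensor_space
  show "(U \<otimes>\<^sub>S V) \<otimes>\<^sub>S W \<subseteq> U \<otimes>\<^sub>S (V \<otimes>\<^sub>S W)"
  proof (intro tensor_subset vs)
    fix t w assume t: "t \<in> U \<otimes>\<^sub>S V" and w: "w \<in> W"
    have "sw (dec U V t) (\<otimes>) \<otimes> w \<in> U \<otimes>\<^sub>S (V \<otimes>\<^sub>S W)"
      unfolding sw_tensor_left
      by (rule sw_in [OF vspace_subspace dec_tensor(1) [OF assms(1) t]])
         (use vs w in \<open>auto simp: tensor_assoc\<close>)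
    then show "t \<otimes> w \<in> U \<otimes>\<^sub>S (V \<otimes>\<^sub>S W)" using dec_tensor(2) [OF assms(1) t] by simp
  qed
  show "U \<otimes>\<^sub>S (V \<otimes>\<^sub>S W) \<subseteq> (U \<otimes>\<^sub>S V) \<otimes>\<^sub>S W"
  proof (intro tensor_subset vs)
    fix t u assume t: "t \<in> V \<otimes>\<^sub>S W" and u: "u \<in> U"
    have "u \<otimes> sw (dec V W t) (\<otimes>) \<in> (U \<otimes>\<^sub>S V) \<otimes>\<^sub>S W"
      unfolding sw_tensor_right
      by (rule sw_in [OF vspace_subspace dec_tensor(1) [OF assms(2) t]])
         (use vs u in \<open>auto simp: tensor_assoc [symmetric]\<close>)
    then show "u \<otimes> t \<in> (U \<otimes>\<^sub>S V) \<otimes>\<^sub>S W" using dec_tensor(2) [OF assms(2) t] by simp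
  qed
qed

declare vspace_ground [simp]

lemma unit_arr_in_ground [simp]: "unit_arr \<in> ground"
  unfolding ground_def by (rule range_eqI [where x = 1]) simp

lemma ground_cases: "x \<in> ground \<Longrightarrow> (\<And>c. x = c *\<^sub>k unit_arr \<Longrightarrow> P) \<Longrightarrow> P"
  by (auto simp: ground_def)

lemma tensor_space_ground_left:
  fixes V :: "('k::field, 'x) arr set"
  assumes V: "vspace V"
  shows "ground \<otimes>\<^sub>S V = V"
proof
  show "ground \<otimes>\<^sub>S V \<subseteq> V"
  proof (intro tensor_subset V vspace_ground)
    fix x v :: "('k, 'x) arr" assume "x \<in> ground" "v \<in> V"
    then show "x \<otimes> v \<in> V"
      using arr.subspace_scale [OF vspace_subspace [OF V]]
      by (elim ground_cases) (simp add: tensor_scale_left)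
  qed
  show "V \<subseteq> ground \<otimes>\<^sub>S V"
    using tensor_in [OF unit_arr_in_ground] by (metis subsetI tensor_unit_left)
qed

lemma tensor_space_ground_right:
  fixes V :: "('k::field, 'x) arr set"
  assumes V: "vspace V"
  shows "V \<otimes>\<^sub>S ground = V"
proof
  show "V \<otimes>\<^sub>S ground \<subseteq> V"
  proof (intro tensor_subset V)
    fix x v :: "('k, 'x) arr" assume "x \<in> ground" "v \<in> V"
    then show "v \<otimes> x \<in> V"
      using arr.subspace_scale [OF vspace_subspace [OF V]]
      by (elim ground_cases) (simp add: tensor_scale_right)
  qed
  show "V \<subseteq> V \<otimes>\<^sub>S ground"
    using tensor_in [OF _ unit_arr_in_ground] by (metis subsetI tensor_unit_right)
qed

lemma tensor_ext3:
  assumes "vspace U" "vspace V" "vspace W" "lin f" "lin g"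
    "\<And>u v w. u \<in> U \<Longrightarrow> v \<in> V \<Longrightarrow> w \<in> W \<Longrightarrow> f (u \<otimes> v \<otimes> w) = g (u \<otimes> v \<otimes> w)"
    and t: "t \<in> U \<otimes>\<^sub>S V \<otimes>\<^sub>S W"
  shows "f t = g t"
proof (rule tensor_ext [OF assms(1,4,5) _ t])
  fix u s assume u: "u \<in> U" and s: "s \<in> V \<otimes>\<^sub>S W"
  show "f (u \<otimes> s) = g (u \<otimes> s)"
    by (rule tensor_ext [OF assms(2) _ _ _ s, of "\<lambda>s. f (u \<otimes> s)" "\<lambda>s. g (u \<otimes> s)"])
       (use assms u in \<open>auto intro!: lin_comp [of f] lin_comp [of g] lin_intros\<close>)
qed

lemma tensor_map_in_lin_map:
  assumes "vspace V" "vspace W" "vspace X" "vspace Y" "f \<in> lin_map V X" "g \<in> lin_map W Y"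
  shows "tensor_map V W f g \<in> lin_map (V \<otimes>\<^sub>S W) (X \<otimes>\<^sub>S Y)"
    and "v \<in> V \<Longrightarrow> w \<in> W \<Longrightarrow> tensor_map V W f g (v \<otimes> w) = f v \<otimes> g w"
proof -
  let ?F = "\<lambda>v w. f (proj V v) \<otimes> g (proj W w)"
  have F: "bilin ?F"
    by (intro bilinI lin_tensor_left lin_tensor_right lin_map_proj [OF assms(1,5)] lin_map_proj [OF assms(2,6)])
  have VW: "vspace (V \<otimes>\<^sub>S W)" using assms by (simp add: vspace_tensor_space)
  have eq: "sweedler V W t (\<lambda>v w. f v \<otimes> g w) = sw (dec V W (proj (V \<otimes>\<^sub>S W) t)) ?F"
    if "t \<in> V \<otimes>\<^sub>S W" for t
    unfolding sweedler_sw using that assms VW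
    by (simp, intro sw_cong [OF dec_tensor(1)]) auto
  have "tensor_map V W f g = (\<lambda>t\<in>V \<otimes>\<^sub>S W. sw (dec V W (proj (V \<otimes>\<^sub>S W) t)) ?F)"
    unfolding tensor_map_def using eq by (intro restrict_ext)
  also have "\<dots> \<in> lin_map (V \<otimes>\<^sub>S W) (X \<otimes>\<^sub>S Y)"
    using VW assms F by (intro lin_mapI lin_sw_dec lin_proj sw_in [OF vspace_subspace dec_tensor(1)]
      vspace_tensor_space) (use assms(5,6) [THEN lin_mapD(1)] in auto)
  finally show "tensor_map V W f g \<in> lin_map (V \<otimes>\<^sub>S W) (X \<otimes>\<^sub>S Y)" .
  show "tensor_map V W f g (v \<otimes> w) = f v \<otimes> g w" if "v \<in> V" "w \<in> W"
    using that assms VW F by (simp add: tensor_map_def eq sw_dec_tensor)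
qed

lemma sw_eqI: "(\<And>a b. F a b = G a b) \<Longrightarrow> sw ps F = sw ps G"
  by (simp add: sw_def)

lemma sw_swap2:
  "sw ps (\<lambda>a b. sw (Q a b) (\<lambda>c d. sw rs (\<lambda>e f. F a b c d e f)))
    = sw rs (\<lambda>e f. sw ps (\<lambda>a b. sw (Q a b) (\<lambda>c d. F a b c d e f)))"
  by (rule trans [OF sw_eqI sw_swap]) (rule sw_swap)


section \<open>Ordinary bialgebras and Yetter-Drinfel'd modules\<close>

text \<open>The structure maps ignore everything but the projections of their arguments to
  \<open>H\<close>; hence the laws can be stated for all arrays. The laws about \<open>dH\<close>
  are quantified over multilinear test maps because \<open>dH h\<close> is merely one decomposition
  of the coproduct.\<close>

locale bialg0 =
  fixes H :: "('k::field, 'x) arr set" and m :: "('k, 'x) arr \<Rightarrow> ('k, 'x) arr \<Rightarrow> ('k, 'x) arr"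
    and e :: "('k, 'x) arr" and dH :: "('k, 'x) arr \<Rightarrow> (('k, 'x) arr \<times> ('k, 'x) arr) list"
    and eps :: "('k, 'x) arr \<Rightarrow> 'k"
  assumes vspace_H: "vspace H"
    and bilin_m: "bilin m"
    and m_in [simp]: "m a b \<in> H"
    and m_proj [simp]: "m (proj H a) b = m a b" "m a (proj H b) = m a b"
    and m_assoc: "m (m a b) c = m a (m b c)"
    and e_in [simp]: "e \<in> H"
    and m_e [simp]: "m a e = proj H a" "m e a = proj H a"
    and dH_in: "set (dH h) \<subseteq> H \<times> H"
    and dH_proj [simp]: "dH (proj H h) = dH h"
    and lin_dH: "bilin F \<Longrightarrow> lin (\<lambda>h. sw (dH h) F)"
    and coassoc: "trilin G \<Longrightarrow> sw (dH h) (\<lambda>a b. sw (dH b) (\<lambda>c d. G a c d))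
      = sw (dH h) (\<lambda>a b. sw (dH a) (\<lambda>c d. G c d b))"
    and lin_fn_eps: "lin_fn eps"
    and eps_proj [simp]: "eps (proj H h) = eps h"
    and counit: "lin f \<Longrightarrow> sw (dH h) (\<lambda>a b. eps b *\<^sub>k f a) = f (proj H h)"
      "lin f \<Longrightarrow> sw (dH h) (\<lambda>a b. eps a *\<^sub>k f b) = f (proj H h)"
    and dH_m: "bilin F \<Longrightarrow> sw (dH (m a b)) F
      = sw (dH a) (\<lambda>a1 a2. sw (dH b) (\<lambda>b1 b2. F (m a1 b1) (m a2 b2)))"
    and dH_e: "bilin F \<Longrightarrow> sw (dH e) F = F e e"
    and eps_m: "eps (m a b) = eps a * eps b"
    and eps_e [simp]: "eps e = 1"
begin

lemma lin_dH' [lin_intros]: "lin f \<Longrightarrow> bilin F \<Longrightarrow> lin (\<lambda>x. sw (dH (f x)) F)"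
  by (rule lin_comp [OF lin_dH])

lemmas H_lins [lin_intros] =
  bilin_m bilin_lins [OF bilin_m] lin_fn_scale [OF lin_fn_eps] lin_proj' [OF vspace_H]

lemma m_scale: "m (c *\<^sub>k a) b = c *\<^sub>k m a b" "m a (c *\<^sub>k b) = c *\<^sub>k m a b"
  using bilin_m by (simp_all add: bilin_def lin_def)

lemma m_sw: "m (sw ps F) b = sw ps (\<lambda>x y. m (F x y) b)" "m a (sw ps F) = sw ps (\<lambda>x y. m a (F x y))"
  by (rule sw_lin, intro lin_intros)+

text \<open>In the convolution algebra, S' = S' * (id * S) = (S' * id) * S = S; the middle equality
  is coassociativity together with associativity.\<close>

lemma convolution_inverse_unique:
  assumes "lin S" "lin S'" "\<And>h. S' h \<in> H" "\<And>h. S h \<in> H" "\<And>h. S (proj H h) = S h" "\<And>h. S' (proj H h) = S' h"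
    and R: "\<And>h. sw (dH h) (\<lambda>a b. m a (S b)) = eps h *\<^sub>k e"
    and L: "\<And>h. sw (dH h) (\<lambda>a b. m (S' a) b) = eps h *\<^sub>k e"
  shows "S' h = S h"
proof -
  note lins = lin_intros lin_comp [OF assms(1)] lin_comp [OF assms(2)]
  have "S' h = sw (dH h) (\<lambda>a b. eps b *\<^sub>k S' a)"
    using counit(1) [OF assms(2)] assms(6) by simp
  also have "\<dots> = sw (dH h) (\<lambda>a b. m (S' a) (sw (dH b) (\<lambda>c d. m c (S d))))"
    using assms(3) vspace_H by (simp add: R m_scale)
  also have "\<dots> = sw (dH h) (\<lambda>a b. sw (dH b) (\<lambda>c d. m (S' a) (m c (S d))))"
    by (simp only: m_sw)
  also have "\<dots> = sw (dH h) (\<lambda>a b. sw (dH a) (\<lambda>c d. m (S' c) (m d (S b))))"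
    by (rule coassoc) (intro lins)
  also have "\<dots> = sw (dH h) (\<lambda>a b. m (sw (dH a) (\<lambda>c d. m (S' c) d)) (S b))"
    by (simp only: m_assoc [symmetric] m_sw)
  also have "\<dots> = sw (dH h) (\<lambda>a b. eps a *\<^sub>k S b)"
    using assms(4) vspace_H by (simp add: L m_scale)
  also have "\<dots> = S h"
    using counit(2) [OF assms(1)] assms(5) by simp
  finally show ?thesis .
qed

text \<open>In the convolution algebra of bilinear maps on \<open>H\<close>, the map S(ab) is a left
  inverse of the multiplication and S(b) S(a) is a right inverse, so they agree by the usual
  uniqueness argument.\<close>

lemma antipode_antimultiplicative:
  assumes S: "lin S" "\<And>h. S h \<in> H" "\<And>h. S (proj H h) = S h"
    and R: "\<And>h. sw (dH h) (\<lambda>a b. m a (S b)) = eps h *\<^sub>k e"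
    and L: "\<And>h. sw (dH h) (\<lambda>a b. m (S a) b) = eps h *\<^sub>k e"
  shows "S (m a b) = m (S b) (S a)"
proof -
  note lins = lin_intros lin_comp [OF S(1)]
  define X where "X x y = m (S y) (S x)" for x y
  have X: "bilin X" unfolding X_def by (intro lins)
  have XR: "sw (dH a) (\<lambda>a1 a2. sw (dH b) (\<lambda>b1 b2. m (m a1 b1) (X a2 b2))) = (eps a * eps b) *\<^sub>k e" for a b
  proof -
    have "sw (dH b) (\<lambda>b1 b2. m (m a1 b1) (X a2 b2)) = eps b *\<^sub>k m a1 (S a2)" (is "?l = _") for a1 a2
    proof -
      have "?l = sw (dH b) (\<lambda>b1 b2. m (m a1 (m b1 (S b2))) (S a2))"
        by (simp add: X_def m_assoc)
      also have "\<dots> = m (m a1 (sw (dH b) (\<lambda>b1 b2. m b1 (S b2)))) (S a2)"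
        by (simp only: m_sw)
      also have "\<dots> = eps b *\<^sub>k m a1 (S a2)" by (simp add: R m_scale)
      finally show ?thesis .
    qed
    then show ?thesis by (simp add: sw_scale R mult.commute)
  qed
  have SL: "sw (dH a) (\<lambda>a1 a2. sw (dH b) (\<lambda>b1 b2. m (S (m a1 b1)) (m a2 b2))) = (eps a * eps b) *\<^sub>k e" for a b
    using L [of "m a b"] by (subst (asm) dH_m) (auto intro!: lins simp: eps_m)
  \<comment> \<open>Both counit laws are used to create the factor eps(a2) eps(b2), which
    \<open>XR\<close> then replaces by the product of the multiplication with its right inverse
    \<open>X\<close>.\<close>
  have "S (m a b) = sw (dH a) (\<lambda>a1 a2. eps a2 *\<^sub>k sw (dH b) (\<lambda>b1 b2. eps b2 *\<^sub>k S (m a1 b1)))"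
    by (subst counit(1), intro lins, subst counit(1), intro lins) simp
  also have "\<dots> = sw (dH a) (\<lambda>a1 a2. sw (dH b) (\<lambda>b1 b2. (eps a2 * eps b2) *\<^sub>k S (m a1 b1)))"
    by (simp flip: sw_scale)
  also have "\<dots> = sw (dH a) (\<lambda>a1 a2. sw (dH b) (\<lambda>b1 b2. m (S (m a1 b1))
      (sw (dH a2) (\<lambda>a2 a3. sw (dH b2) (\<lambda>b2 b3. m (m a2 b2) (X a3 b3))))))"
    using vspace_H S(2) by (simp add: XR m_scale)
  also have "\<dots> = sw (dH a) (\<lambda>a1 a2. sw (dH b) (\<lambda>b1 b2. sw (dH a2) (\<lambda>a2 a3. sw (dH b2) (\<lambda>b2 b3.
      m (S (m a1 b1)) (m (m a2 b2) (X a3 b3))))))"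
    by (simp only: m_sw)
  \<comment> \<open>Coassociativity applies only when the two sums belonging to one variable are
    adjacent, hence the swaps before and after it.\<close>
  also have "\<dots> = sw (dH a) (\<lambda>a1 a2. sw (dH a2) (\<lambda>a2 a3. sw (dH b) (\<lambda>b1 b2. sw (dH b2) (\<lambda>b2 b3.
      m (S (m a1 b1)) (m (m a2 b2) (X a3 b3))))))"
    by (rule sw_eqI, rule sw_swap)
  also have "\<dots> = sw (dH a) (\<lambda>a12 a3. sw (dH a12) (\<lambda>a1 a2. sw (dH b) (\<lambda>b1 b2. sw (dH b2) (\<lambda>b2 b3.
      m (S (m a1 b1)) (m (m a2 b2) (X a3 b3))))))"
    by (rule coassoc) (intro lins bilin_lins [OF X])
  also have "\<dots> = sw (dH a) (\<lambda>a12 a3. sw (dH a12) (\<lambda>a1 a2. sw (dH b) (\<lambda>b12 b3. sw (dH b12) (\<lambda>b1 b2.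
      m (m (S (m a1 b1)) (m a2 b2)) (X a3 b3)))))"
    unfolding m_assoc [symmetric] by (rule sw_eqI, rule sw_eqI, rule coassoc) (intro lins bilin_lins [OF X])
  also have "\<dots> = sw (dH a) (\<lambda>a12 a3. sw (dH b) (\<lambda>b12 b3. sw (dH a12) (\<lambda>a1 a2. sw (dH b12) (\<lambda>b1 b2.
      m (m (S (m a1 b1)) (m a2 b2)) (X a3 b3)))))"
    by (rule sw_eqI, rule sw_swap)
  also have "\<dots> = sw (dH a) (\<lambda>a12 a3. sw (dH b) (\<lambda>b12 b3.
      m (sw (dH a12) (\<lambda>a1 a2. sw (dH b12) (\<lambda>b1 b2. m (S (m a1 b1)) (m a2 b2)))) (X a3 b3)))"
    by (simp only: m_sw)
  also have "\<dots> = sw (dH a) (\<lambda>a12 a3. eps a12 *\<^sub>k sw (dH b) (\<lambda>b12 b3. eps b12 *\<^sub>k X a3 b3))"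
    unfolding SL m_scale by (simp add: X_def vspace_H flip: sw_scale)
  also have "\<dots> = X a b"
    by (subst counit(2), intro lins bilin_lins [OF X], subst counit(2), intro lins bilin_lins [OF X])
       (simp add: X_def S(3))
  finally show ?thesis by (simp add: X_def)
qed

text \<open>Since \<open>S\<close> reverses products, it sends b T(a) to a S(b) and T(b) a to S(a)
  b. The sums of these are known, and \<open>S\<close> is injective on \<open>H\<close>.\<close>

lemma antipode_inverse:
  assumes S: "lin S" "\<And>h. S h \<in> H" "\<And>h. S (proj H h) = S h"
    and R: "\<And>h. sw (dH h) (\<lambda>a b. m a (S b)) = eps h *\<^sub>k e"
    and L: "\<And>h. sw (dH h) (\<lambda>a b. m (S a) b) = eps h *\<^sub>k e"
    and T: "\<And>h. h \<in> H \<Longrightarrow> T (S h) = h" "\<And>h. S (T h) = proj H h"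
  shows "sw (dH h) (\<lambda>a b. m b (T a)) = eps h *\<^sub>k e" "sw (dH h) (\<lambda>a b. m (T b) a) = eps h *\<^sub>k e"
proof -
  note lins = lin_intros lin_comp [OF S(1)]
  note anti = antipode_antimultiplicative [OF S R L]
  have in_H: "eps h *\<^sub>k e \<in> H" by (simp add: vspace_H arr.subspace_scale vspace_subspace)
  \<comment> \<open>Evaluating the antipode law at the unit gives S(e) = e, so \<open>S\<close> also
    fixes the right-hand sides of the claims.\<close>
  have "sw (dH e) (\<lambda>a b. m a (S b)) = S e"
    by (subst dH_e, intro lins) (simp add: S vspace_H)
  then have Se: "S e = e" by (simp add: R)
  then have See: "S (eps h *\<^sub>k e) = eps h *\<^sub>k e" by (simp add: lin_scale [OF S(1)])
  have "S (sw (dH h) (\<lambda>a b. m b (T a))) = sw (dH h) (\<lambda>a b. m a (S b))"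
    by (simp add: sw_lin [OF S(1)] anti T)
  then have "S (sw (dH h) (\<lambda>a b. m b (T a))) = S (eps h *\<^sub>k e)" by (simp add: R See)
  moreover have "sw (dH h) (\<lambda>a b. m b (T a)) \<in> H"
    by (rule sw_in [OF vspace_subspace [OF vspace_H] dH_in]) simp
  ultimately show "sw (dH h) (\<lambda>a b. m b (T a)) = eps h *\<^sub>k e" using T(1) in_H by metis
  have "S (sw (dH h) (\<lambda>a b. m (T b) a)) = sw (dH h) (\<lambda>a b. m (S a) b)"
    by (simp add: sw_lin [OF S(1)] anti T)
  then have "S (sw (dH h) (\<lambda>a b. m (T b) a)) = S (eps h *\<^sub>k e)" by (simp add: L See)
  moreover have "sw (dH h) (\<lambda>a b. m (T b) a) \<in> H"
    by (rule sw_in [OF vspace_subspace [OF vspace_H] dH_in]) simp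
  ultimately show "sw (dH h) (\<lambda>a b. m (T b) a) = eps h *\<^sub>k e" using T(1) in_H by metis
qed

end

section \<open>Ordinary Yetter-Drinfel'd modules and their braiding\<close>

text \<open>The compatibility law is the antipode-free form of the classical right-right condition,
  which makes sense over any bialgebra.\<close>

locale yd0 = bialg0 +
  fixes V :: "('k::field, 'x) arr set" and a :: "('k, 'x) arr \<Rightarrow> ('k, 'x) arr \<Rightarrow> ('k, 'x) arr"
    and d :: "('k, 'x) arr \<Rightarrow> (('k, 'x) arr \<times> ('k, 'x) arr) list"
  assumes vspace_V: "vspace V"
    and bilin_a: "bilin a"
    and a_in [simp]: "a v h \<in> V"
    and a_proj [simp]: "a (proj V v) h = a v h" "a v (proj H h) = a v h"
    and a_a: "a (a v h) g = a v (m h g)"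
    and a_e [simp]: "a v e = proj V v"
    and d_in: "set (d v) \<subseteq> V \<times> H"
    and d_proj [simp]: "d (proj V v) = d v"
    and lin_d: "bilin F \<Longrightarrow> lin (\<lambda>v. sw (d v) F)"
    and d_coassoc: "trilin G \<Longrightarrow> sw (d v) (\<lambda>x y. sw (dH y) (\<lambda>z w. G x z w))
      = sw (d v) (\<lambda>x y. sw (d x) (\<lambda>z w. G z w y))"
    and d_counit: "lin f \<Longrightarrow> sw (d v) (\<lambda>x y. eps y *\<^sub>k f x) = f (proj V v)"
    and yd: "bilin F \<Longrightarrow> sw (dH h) (\<lambda>g1 g2. sw (d (a v g2)) (\<lambda>x y. F x (m g1 y)))
      = sw (d v) (\<lambda>x y. sw (dH h) (\<lambda>g1 g2. F (a x g1) (m y g2)))"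
begin

lemma lin_d' [lin_intros]: "lin f \<Longrightarrow> bilin F \<Longrightarrow> lin (\<lambda>x. sw (d (f x)) F)"
  by (rule lin_comp [OF lin_d])

lemmas V_lins [lin_intros] = bilin_a bilin_lins [OF bilin_a] lin_proj' [OF vspace_V]

lemma a_sw: "a (sw ps F) b = sw ps (\<lambda>x y. a (F x y) b)" "a v (sw ps F) = sw ps (\<lambda>x y. a v (F x y))"
  by (rule sw_lin, intro lin_intros)+

lemma a_scale: "a (c *\<^sub>k v) b = c *\<^sub>k a v b" "a v (c *\<^sub>k b) = c *\<^sub>k a v b"
  using bilin_a by (simp_all add: bilin_def lin_def)

end

locale yd0_pair = bialg0 +
  V: yd0 H m e dH eps V aV dV + W: yd0 H m e dH eps W aW dW
  for V :: "('k::field, 'x) arr set" and aV dV and W :: "('k, 'x) arr set" and aW dW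
begin

definition br :: "('k, 'x) arr \<Rightarrow> ('k, 'x) arr \<Rightarrow> ('k, 'x) arr"
  where "br v w = sw (dW w) (\<lambda>w0 w1. w0 \<otimes> aV v w1)"

lemma bilin_br: "bilin br"
  unfolding br_def by (intro lin_intros)

lemma br_in: "br v w \<in> W \<otimes>\<^sub>S V"
  unfolding br_def
  by (rule sw_in [OF vspace_subspace W.d_in])
     (simp_all add: vspace_tensor_space V.vspace_V W.vspace_V tensor_in)

text \<open>The module law merges the two actions on \<open>v\<close> into the action of x w1, which
  produces the left side of the Yetter-Drinfel'd condition for \<open>W\<close>.\<close>

lemma br_linear:
  "sw (dH h) (\<lambda>x y. br (aV v x) (aW w y))
    = sw (dW w) (\<lambda>w0 w1. sw (dH h) (\<lambda>x y. aW w0 x \<otimes> aV (aV v w1) y))" (is "?l = _")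
proof -
  have "?l = sw (dH h) (\<lambda>x y. sw (dW (aW w y)) (\<lambda>w0 w1. w0 \<otimes> aV v (m x w1)))"
    by (simp add: br_def V.a_a)
  also have "\<dots> = sw (dW w) (\<lambda>w0 w1. sw (dH h) (\<lambda>x y. aW w0 x \<otimes> aV v (m w1 y)))"
    by (rule W.yd [where F = "\<lambda>x y. x \<otimes> aV v y"]) (intro lin_intros)
  finally show ?thesis by (simp add: V.a_a)
qed

text \<open>Coassociativity of \<open>W\<close> exhibits the two elements of \<open>H\<close>
  involved as the coproduct of w1. Then the Yetter-Drinfel'd condition for \<open>V\<close> applies,
  and a second use of coassociativity reassembles the braiding.\<close>

lemma br_colinear:
  assumes F: "bilin F"
  shows "sw (dW w) (\<lambda>w0 w1. sw (dW w0) (\<lambda>w00 w01. sw (dV (aV v w1)) (\<lambda>v0 v1.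
      F (w00 \<otimes> v0) (m w01 v1))))
    = sw (dV v) (\<lambda>v0 v1. sw (dW w) (\<lambda>w0 w1. F (br v0 w0) (m v1 w1)))" (is "?l = _")
proof -
  note lins = lin_intros bilin_lins [OF F]
  have "?l = sw (dW w) (\<lambda>w0 w1. sw (dH w1) (\<lambda>p q. sw (dV (aV v q)) (\<lambda>v0 v1. F (w0 \<otimes> v0) (m p v1))))"
    by (rule W.d_coassoc [symmetric]) (intro lins)
  also have "\<dots> = sw (dW w) (\<lambda>w0 w1. sw (dV v) (\<lambda>v0 v1. sw (dH w1) (\<lambda>p q.
      F (w0 \<otimes> aV v0 p) (m v1 q))))"
    by (rule sw_eqI, rule V.yd) (intro lins)
  also have "\<dots> = sw (dV v) (\<lambda>v0 v1. sw (dW w) (\<lambda>w0 w1. sw (dH w1) (\<lambda>p q.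
      F (w0 \<otimes> aV v0 p) (m v1 q))))"
    by (rule sw_swap)
  also have "\<dots> = sw (dV v) (\<lambda>v0 v1. sw (dW w) (\<lambda>w0 w1. sw (dW w0) (\<lambda>p q.
      F (p \<otimes> aV v0 q) (m v1 w1))))"
    by (rule sw_eqI, rule W.d_coassoc) (intro lins)
  also have "\<dots> = sw (dV v) (\<lambda>v0 v1. sw (dW w) (\<lambda>w0 w1. F (br v0 w0) (m v1 w1)))"
    unfolding br_def
    by (rule sw_eqI, rule sw_eqI, rule sw_lin [symmetric, of "\<lambda>x. F x _"], intro lins)
  finally show ?thesis .
qed

definition br_inv :: "(('k, 'x) arr \<Rightarrow> ('k, 'x) arr) \<Rightarrow> ('k, 'x) arr \<Rightarrow> ('k, 'x) arr \<Rightarrow> ('k, 'x) arr"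
  where "br_inv T w v = sw (dW w) (\<lambda>w0 w1. aV v (T w1) \<otimes> w0)"

lemma bilin_br_inv:
  assumes "lin T"
  shows "bilin (br_inv T)"
  unfolding br_inv_def by (intro lin_intros lin_comp [OF assms])

lemma br_inv_in: "br_inv T w v \<in> V \<otimes>\<^sub>S W"
  unfolding br_inv_def
  by (rule sw_in [OF vspace_subspace W.d_in])
     (simp_all add: vspace_tensor_space V.vspace_V W.vspace_V tensor_in)

text \<open>By coassociativity, \<open>v\<close> is acted on by q T(p), where p and q are the parts
  of the coproduct of w1. This collapses to the counit, which the comodule then absorbs.\<close>

lemma br_inv_br:
  assumes T: "lin T" "\<And>h. sw (dH h) (\<lambda>a b. m b (T a)) = eps h *\<^sub>k e"
  shows "sw (dW w) (\<lambda>w0 w1. br_inv T w0 (aV v w1)) = proj V v \<otimes> proj W w" (is "?l = _")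
proof -
  have "?l = sw (dW w) (\<lambda>w0 w1. sw (dW w0) (\<lambda>p q. aV v (m w1 (T q)) \<otimes> p))"
    by (simp add: br_inv_def V.a_a)
  also have "\<dots> = sw (dW w) (\<lambda>w0 w1. sw (dH w1) (\<lambda>p q. aV v (m q (T p)) \<otimes> w0))"
    by (rule W.d_coassoc [symmetric]) (intro lin_intros lin_comp [OF T(1)])
  also have "\<dots> = sw (dW w) (\<lambda>w0 w1. aV v (sw (dH w1) (\<lambda>p q. m q (T p))) \<otimes> w0)"
    by (simp only: V.a_sw sw_tensor_left)
  also have "\<dots> = sw (dW w) (\<lambda>w0 w1. eps w1 *\<^sub>k (proj V v \<otimes> w0))"
    by (simp add: T(2) V.a_scale tensor_scale_left)
  also have "\<dots> = proj V v \<otimes> proj W w"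
    by (rule W.d_counit) (intro lin_intros)
  finally show ?thesis .
qed

text \<open>In this composite \<open>T\<close> is applied first, so the product appears in the order
  T(q) p and the other identity for \<open>T\<close> is required.\<close>

lemma br_br_inv:
  assumes T: "lin T" "\<And>h. sw (dH h) (\<lambda>a b. m (T b) a) = eps h *\<^sub>k e"
  shows "sw (dW w) (\<lambda>w0 w1. br (aV v (T w1)) w0) = proj W w \<otimes> proj V v" (is "?l = _")
proof -
  have "?l = sw (dW w) (\<lambda>w0 w1. sw (dW w0) (\<lambda>p q. p \<otimes> aV v (m (T w1) q)))"
    by (simp add: br_def V.a_a)
  also have "\<dots> = sw (dW w) (\<lambda>w0 w1. sw (dH w1) (\<lambda>p q. w0 \<otimes> aV v (m (T q) p)))"
    by (rule W.d_coassoc [symmetric]) (intro lin_intros lin_comp [OF T(1)])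
  also have "\<dots> = sw (dW w) (\<lambda>w0 w1. w0 \<otimes> aV v (sw (dH w1) (\<lambda>p q. m (T q) p)))"
    by (simp only: V.a_sw sw_tensor_right)
  also have "\<dots> = sw (dW w) (\<lambda>w0 w1. eps w1 *\<^sub>k (w0 \<otimes> proj V v))"
    by (simp add: T(2) V.a_scale tensor_scale_right)
  also have "\<dots> = proj W w \<otimes> proj V v"
    by (rule W.d_counit) (intro lin_intros)
  finally show ?thesis .
qed

end

section \<open>The tensor product of ordinary Yetter-Drinfel'd modules\<close>

text \<open>The action and coaction on V \<otimes> W are prescribed on pure tensors instead of being
  constructed, so that the untwisted structure of \<open>YD_tensor\<close> can be inserted for
  them.\<close>

locale yd0_tensor = yd0_pair H m e dH eps V aV dV W aW dW
  for H :: "('k::field, 'x) arr set" and m e dH eps V aV dV W aW dW +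
  fixes a :: "('k, 'x) arr \<Rightarrow> ('k, 'x) arr \<Rightarrow> ('k, 'x) arr"
    and d :: "('k, 'x) arr \<Rightarrow> (('k, 'x) arr \<times> ('k, 'x) arr) list"
  assumes bilin_a: "bilin a"
    and a_in [simp]: "a t h \<in> V \<otimes>\<^sub>S W"
    and a_proj [simp]: "a (proj (V \<otimes>\<^sub>S W) t) h = a t h" "a t (proj H h) = a t h"
    and d_in: "set (d t) \<subseteq> (V \<otimes>\<^sub>S W) \<times> H"
    and d_proj [simp]: "d (proj (V \<otimes>\<^sub>S W) t) = d t"
    and lin_d: "bilin F \<Longrightarrow> lin (\<lambda>t. sw (d t) F)"
    and a_tensor: "v \<in> V \<Longrightarrow> w \<in> W \<Longrightarrow> a (v \<otimes> w) h = sw (dH h) (\<lambda>x y. aV v x \<otimes> aW w y)"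
    and d_tensor: "v \<in> V \<Longrightarrow> w \<in> W \<Longrightarrow> bilin F \<Longrightarrow>
      sw (d (v \<otimes> w)) F = sw (dV v) (\<lambda>v0 v1. sw (dW w) (\<lambda>w0 w1. F (v0 \<otimes> w0) (m v1 w1)))"
begin

lemma vspace_VW: "vspace (V \<otimes>\<^sub>S W)"
  by (simp add: vspace_tensor_space V.vspace_V W.vspace_V)

lemma lin_d' [lin_intros]: "lin f \<Longrightarrow> bilin F \<Longrightarrow> lin (\<lambda>x. sw (d (f x)) F)"
  by (rule lin_comp [OF lin_d])

lemmas VW_lins [lin_intros] = bilin_a bilin_lins [OF bilin_a] lin_proj' [OF vspace_VW]

lemma ext_proj:
  assumes "lin f" "lin g" "\<And>v w. v \<in> V \<Longrightarrow> w \<in> W \<Longrightarrow> f (v \<otimes> w) = g (v \<otimes> w)"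
    "\<And>t. f (proj (V \<otimes>\<^sub>S W) t) = f t" "\<And>t. g (proj (V \<otimes>\<^sub>S W) t) = g t"
  shows "f t = g t"
  using tensor_ext [OF V.vspace_V assms(1-3), where t = "proj (V \<otimes>\<^sub>S W) t"] assms(4,5) vspace_VW by simp

lemma d_sw_tensor:
  assumes "bilin F" "\<And>x y. G x y \<in> V" "\<And>x y. G' x y \<in> W"
  shows "sw (d (sw ps (\<lambda>x y. G x y \<otimes> G' x y))) F = sw ps (\<lambda>x y.
    sw (dV (G x y)) (\<lambda>v0 v1. sw (dW (G' x y)) (\<lambda>w0 w1. F (v0 \<otimes> w0) (m v1 w1))))"
  using assms by (simp add: sw_lin [OF lin_d] d_tensor)

lemma tensor_yd0: "yd0 H m e dH eps (V \<otimes>\<^sub>S W) a d"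
proof
  show "vspace (V \<otimes>\<^sub>S W)" by (rule vspace_VW)
  show "a (a t h) g = a t (m h g)" for t h g
  proof (rule ext_proj [where f = "\<lambda>t. a (a t h) g" and g = "\<lambda>t. a t (m h g)"])
    fix v w assume "v \<in> V" "w \<in> W"
    have "a (a (v \<otimes> w) h) g = sw (dH h) (\<lambda>x y. a (aV v x \<otimes> aW w y) g)"
      using \<open>v \<in> V\<close> \<open>w \<in> W\<close>
      by (simp only: a_tensor) (intro sw_lin [where f = "\<lambda>t. a t g"] lin_intros)
    also have "\<dots> = sw (dH (m h g)) (\<lambda>x y. aV v x \<otimes> aW w y)"
      by (subst dH_m, intro lin_intros) (simp add: a_tensor V.a_a W.a_a)
    finally show "a (a (v \<otimes> w) h) g = a (v \<otimes> w) (m h g)"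
      using \<open>v \<in> V\<close> \<open>w \<in> W\<close> by (simp add: a_tensor)
  qed (intro lin_intros | simp)+
  show "a t e = proj (V \<otimes>\<^sub>S W) t" for t
  proof (rule ext_proj [where f = "\<lambda>t. a t e" and g = "\<lambda>t. proj (V \<otimes>\<^sub>S W) t"])
    fix v w assume "v \<in> V" "w \<in> W"
    then have "a (v \<otimes> w) e = aV v e \<otimes> aW w e"
      by (simp only: a_tensor) (rule dH_e, intro lin_intros)
    then show "a (v \<otimes> w) e = proj (V \<otimes>\<^sub>S W) (v \<otimes> w)"
      using \<open>v \<in> V\<close> \<open>w \<in> W\<close> by (simp add: V.vspace_V W.vspace_V vspace_VW)
  qed (intro lin_intros | simp add: vspace_VW)+
  \<comment> \<open>Multiplicativity splits the coproduct of v1 w1. Afterwards coassociativity is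
    needed once in \<open>V\<close> and once in \<open>W\<close>, with the sums reordered in
    between.\<close>
  show "sw (d t) (\<lambda>x y. sw (dH y) (\<lambda>z w. F x z w)) = sw (d t) (\<lambda>x y. sw (d x) (\<lambda>z w. F z w y))"
    if F: "trilin F" for F t
  proof (rule ext_proj [where f = "\<lambda>t. sw (d t) (\<lambda>x y. sw (dH y) (\<lambda>z w. F x z w))"
        and g = "\<lambda>t. sw (d t) (\<lambda>x y. sw (d x) (\<lambda>z w. F z w y))"])
    note lins = lin_intros trilin_lins [OF F]
    fix v w assume vw: "v \<in> V" "w \<in> W"
    have "sw (d (v \<otimes> w)) (\<lambda>x y. sw (dH y) (\<lambda>z w. F x z w))
      = sw (dV v) (\<lambda>v0 v1. sw (dW w) (\<lambda>w0 w1. sw (dH (m v1 w1)) (\<lambda>z w. F (v0 \<otimes> w0) z w)))"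
      by (rule d_tensor [OF vw]) (intro lins)
    also have "\<dots> = sw (dV v) (\<lambda>v0 v1. sw (dW w) (\<lambda>w0 w1. sw (dH v1) (\<lambda>p q. sw (dH w1) (\<lambda>r s.
        F (v0 \<otimes> w0) (m p r) (m q s)))))"
      by (rule sw_eqI, rule sw_eqI, rule dH_m) (intro lins)
    also have "\<dots> = sw (dV v) (\<lambda>v0 v1. sw (dH v1) (\<lambda>p q. sw (dW w) (\<lambda>w0 w1. sw (dH w1) (\<lambda>r s.
        F (v0 \<otimes> w0) (m p r) (m q s)))))"
      by (rule sw_eqI, rule sw_swap)
    also have "\<dots> = sw (dV v) (\<lambda>v0 v1. sw (dV v0) (\<lambda>v00 v01. sw (dW w) (\<lambda>w0 w1. sw (dH w1) (\<lambda>r s.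
        F (v00 \<otimes> w0) (m v01 r) (m v1 s)))))"
      by (rule V.d_coassoc) (intro lins)
    also have "\<dots> = sw (dV v) (\<lambda>v0 v1. sw (dV v0) (\<lambda>v00 v01. sw (dW w) (\<lambda>w0 w1. sw (dW w0) (\<lambda>w00 w01.
        F (v00 \<otimes> w00) (m v01 w01) (m v1 w1)))))"
      by (rule sw_eqI, rule sw_eqI, rule W.d_coassoc) (intro lins)
    also have "\<dots> = sw (dV v) (\<lambda>v0 v1. sw (dW w) (\<lambda>w0 w1. sw (dV v0) (\<lambda>v00 v01. sw (dW w0) (\<lambda>w00 w01.
        F (v00 \<otimes> w00) (m v01 w01) (m v1 w1)))))"
      by (rule sw_eqI, rule sw_swap)
    also have "\<dots> = sw (dV v) (\<lambda>v0 v1. sw (dW w) (\<lambda>w0 w1. sw (d (v0 \<otimes> w0)) (\<lambda>x y. F x y (m v1 w1))))"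
      by (intro sw_cong [OF V.d_in] sw_cong [OF W.d_in] d_tensor [symmetric] lins)
    also have "\<dots> = sw (d (v \<otimes> w)) (\<lambda>x y. sw (d x) (\<lambda>z w. F z w y))"
      by (rule d_tensor [OF vw, symmetric]) (intro lins)
    finally show "sw (d (v \<otimes> w)) (\<lambda>x y. sw (dH y) (\<lambda>z w. F x z w))
      = sw (d (v \<otimes> w)) (\<lambda>x y. sw (d x) (\<lambda>z w. F z w y))" .
  qed (intro lin_intros trilin_lins [OF F] | simp)+
  show "sw (d t) (\<lambda>x y. eps y *\<^sub>k f x) = f (proj (V \<otimes>\<^sub>S W) t)" if f: "lin f" for f t
  proof (rule ext_proj [where f = "\<lambda>t. sw (d t) (\<lambda>x y. eps y *\<^sub>k f x)"
        and g = "\<lambda>t. f (proj (V \<otimes>\<^sub>S W) t)"])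
    note lins = lin_intros lin_comp [OF f]
    fix v w assume vw: "v \<in> V" "w \<in> W"
    have "sw (d (v \<otimes> w)) (\<lambda>x y. eps y *\<^sub>k f x)
      = sw (dV v) (\<lambda>v0 v1. sw (dW w) (\<lambda>w0 w1. eps (m v1 w1) *\<^sub>k f (v0 \<otimes> w0)))"
      by (rule d_tensor [OF vw]) (intro lins)
    also have "\<dots> = sw (dV v) (\<lambda>v0 v1. eps v1 *\<^sub>k sw (dW w) (\<lambda>w0 w1. eps w1 *\<^sub>k f (v0 \<otimes> w0)))"
      by (simp add: eps_m flip: sw_scale)
    also have "\<dots> = f (v \<otimes> w)"
      by (subst W.d_counit, intro lins, subst V.d_counit, intro lins)
         (simp add: vw V.vspace_V W.vspace_V)
    finally show "sw (d (v \<otimes> w)) (\<lambda>x y. eps y *\<^sub>k f x) = f (proj (V \<otimes>\<^sub>S W) (v \<otimes> w))"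
      using vw by (simp add: vspace_VW)
  qed (intro lin_intros lin_comp [OF f] | simp add: vspace_VW)+
  \<comment> \<open>The element h is split into three parts. Coassociativity first pairs the left
    two for the condition on \<open>V\<close>, then the right two for the condition on
    \<open>W\<close>, and finally regroups them for the action on the tensor product.\<close>
  show "sw (dH h) (\<lambda>g1 g2. sw (d (a t g2)) (\<lambda>x y. F x (m g1 y)))
      = sw (d t) (\<lambda>x y. sw (dH h) (\<lambda>g1 g2. F (a x g1) (m y g2)))" if F: "bilin F" for F h t
  proof (rule ext_proj [where f = "\<lambda>t. sw (dH h) (\<lambda>g1 g2. sw (d (a t g2)) (\<lambda>x y. F x (m g1 y)))"
        and g = "\<lambda>t. sw (d t) (\<lambda>x y. sw (dH h) (\<lambda>g1 g2. F (a x g1) (m y g2)))"])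
    note lins = lin_intros bilin_lins [OF F]
    fix v w assume vw: "v \<in> V" "w \<in> W"
    have "sw (dH h) (\<lambda>g1 g2. sw (d (a (v \<otimes> w) g2)) (\<lambda>x y. F x (m g1 y)))
      = sw (dH h) (\<lambda>g1 g2. sw (dH g2) (\<lambda>p q. sw (dV (aV v p)) (\<lambda>v0 v1. sw (dW (aW w q)) (\<lambda>w0 w1.
          F (v0 \<otimes> w0) (m g1 (m v1 w1))))))"
      unfolding a_tensor [OF vw] by (rule sw_eqI, rule d_sw_tensor) (intro lins | simp)+
    also have "\<dots> = sw (dH h) (\<lambda>g q. sw (dH g) (\<lambda>g1 p. sw (dV (aV v p)) (\<lambda>v0 v1. sw (dW (aW w q)) (\<lambda>w0 w1.
          F (v0 \<otimes> w0) (m g1 (m v1 w1))))))"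
      by (rule coassoc) (intro lins)
    also have "\<dots> = sw (dH h) (\<lambda>g q. sw (dW (aW w q)) (\<lambda>w0 w1. sw (dH g) (\<lambda>g1 p. sw (dV (aV v p)) (\<lambda>v0 v1.
          F (v0 \<otimes> w0) (m (m g1 v1) w1)))))"
      unfolding m_assoc by (rule sw_eqI, rule sw_swap2)
    also have "\<dots> = sw (dH h) (\<lambda>g q. sw (dW (aW w q)) (\<lambda>w0 w1. sw (dV v) (\<lambda>v0 v1. sw (dH g) (\<lambda>g1 p.
          F (aV v0 g1 \<otimes> w0) (m (m v1 p) w1)))))"
      by (rule sw_eqI, rule sw_eqI, rule V.yd [where F = "\<lambda>x y. F (x \<otimes> _) (m y _)"]) (intro lins)
    also have "\<dots> = sw (dV v) (\<lambda>v0 v1. sw (dH h) (\<lambda>g q. sw (dW (aW w q)) (\<lambda>w0 w1. sw (dH g) (\<lambda>g1 p.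
          F (aV v0 g1 \<otimes> w0) (m v1 (m p w1))))))"
      unfolding m_assoc by (rule sw_swap2)
    also have "\<dots> = sw (dV v) (\<lambda>v0 v1. sw (dH h) (\<lambda>g q. sw (dH g) (\<lambda>g1 p. sw (dW (aW w q)) (\<lambda>w0 w1.
          F (aV v0 g1 \<otimes> w0) (m v1 (m p w1))))))"
      by (rule sw_eqI, rule sw_eqI, rule sw_swap)
    also have "\<dots> = sw (dV v) (\<lambda>v0 v1. sw (dH h) (\<lambda>g1 g. sw (dH g) (\<lambda>p q. sw (dW (aW w q)) (\<lambda>w0 w1.
          F (aV v0 g1 \<otimes> w0) (m v1 (m p w1))))))"
      by (rule sw_eqI, rule coassoc [symmetric]) (intro lins)
    also have "\<dots> = sw (dV v) (\<lambda>v0 v1. sw (dH h) (\<lambda>g1 g. sw (dW w) (\<lambda>w0 w1. sw (dH g) (\<lambda>p q.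
          F (aV v0 g1 \<otimes> aW w0 p) (m v1 (m w1 q))))))"
      by (rule sw_eqI, rule sw_eqI, rule W.yd [where F = "\<lambda>x y. F (_ \<otimes> x) (m _ y)"]) (intro lins)
    also have "\<dots> = sw (dV v) (\<lambda>v0 v1. sw (dW w) (\<lambda>w0 w1. sw (dH h) (\<lambda>g1 g. sw (dH g) (\<lambda>p q.
          F (aV v0 g1 \<otimes> aW w0 p) (m v1 (m w1 q))))))"
      by (rule sw_eqI, rule sw_swap)
    also have "\<dots> = sw (dV v) (\<lambda>v0 v1. sw (dW w) (\<lambda>w0 w1. sw (dH h) (\<lambda>g q. sw (dH g) (\<lambda>g1 p.
          F (aV v0 g1 \<otimes> aW w0 p) (m v1 (m w1 q))))))"
      by (rule sw_eqI, rule sw_eqI, rule coassoc) (intro lins)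
    also have "\<dots> = sw (dV v) (\<lambda>v0 v1. sw (dW w) (\<lambda>w0 w1. sw (dH h) (\<lambda>g q.
          F (a (v0 \<otimes> w0) g) (m (m v1 w1) q))))"
      by (intro sw_cong [OF V.d_in] sw_cong [OF W.d_in] sw_cong [OF dH_in])
         (simp only: a_tensor m_assoc, rule sw_lin [symmetric, of "\<lambda>x. F x _"], intro lins)
    also have "\<dots> = sw (d (v \<otimes> w)) (\<lambda>x y. sw (dH h) (\<lambda>g1 g2. F (a x g1) (m y g2)))"
      by (rule d_tensor [OF vw, symmetric]) (intro lins)
    finally show "sw (dH h) (\<lambda>g1 g2. sw (d (a (v \<otimes> w) g2)) (\<lambda>x y. F x (m g1 y)))
      = sw (d (v \<otimes> w)) (\<lambda>x y. sw (dH h) (\<lambda>g1 g2. F (a x g1) (m y g2)))" .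
  qed (intro lin_intros bilin_lins [OF F] | simp)+
qed (simp_all add: bilin_a d_in lin_d)

end

section \<open>Untwisting\<close>

subsection \<open>Powers of the structure automorphisms\<close>

text \<open>Powers of the automorphisms are controlled only on the carrier; projecting first makes
  them linear on all arrays, so that they may occur freely inside test maps.\<close>

definition twt :: "('k::field, 'x, 'z) space_rec_scheme \<Rightarrow> int \<Rightarrow> int \<Rightarrow> int \<Rightarrow> int
    \<Rightarrow> ('k, 'x) arr \<Rightarrow> ('k, 'x) arr"
  where "twt V a b c d x = twp V a b c d (proj (car V) x)"

context twisted_space
begin

declare vspace_car [simp]

lemma tw_lin_map: "tw V \<theta> \<in> lin_map (car V) (car V)"
  using tw_aut by (simp add: lin_aut_def)

lemma tw_bij: "bij_betw (tw V \<theta>) (car V) (car V)"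
  using tw_aut by (simp add: lin_aut_def)

lemma tw_in: "x \<in> car V \<Longrightarrow> tw V \<theta> x \<in> car V"
  using lin_mapD(1) [OF tw_lin_map] .

lemma tw_inj: "x \<in> car V \<Longrightarrow> y \<in> car V \<Longrightarrow> tw V \<theta> x = tw V \<theta> y \<longleftrightarrow> x = y"
  using tw_bij [of \<theta>] by (auto simp: bij_betw_def inj_on_eq_iff)

lemma inv_tw: "x \<in> car V \<Longrightarrow> inv_into (car V) (tw V \<theta>) x \<in> car V"
  "x \<in> car V \<Longrightarrow> tw V \<theta> (inv_into (car V) (tw V \<theta>) x) = x"
  using tw_bij [of \<theta>] inv_into_into [of x "tw V \<theta>" "car V"] f_inv_into_f [of x "tw V \<theta>" "car V"]
  by (auto simp: bij_betw_def)

lemma pw_0 [simp]: "pw V \<theta> 0 x = x"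
  by (simp add: pw_def)

lemma pw_in: "x \<in> car V \<Longrightarrow> pw V \<theta> k x \<in> car V"
proof -
  assume x: "x \<in> car V"
  have "(tw V \<theta> ^^ j) x \<in> car V" "(inv_into (car V) (tw V \<theta>) ^^ j) x \<in> car V" for j
    by (induction j) (simp_all add: x tw_in inv_tw)
  then show ?thesis by (simp add: pw_def)
qed

lemma pw_Suc:
  assumes "x \<in> car V"
  shows "tw V \<theta> (pw V \<theta> k x) = pw V \<theta> (k + 1) x"
proof (cases "0 \<le> k")
  case True
  then show ?thesis by (simp add: pw_def nat_add_distrib)
next
  case False
  \<comment> \<open>For negative k one application of the automorphism cancels one of the -k
    inverses; j counts those that remain.\<close>
  define j where "j = nat (- k) - 1"
  have j: "nat (- k) = Suc j" "nat (- (k + 1)) = j" "k + 1 = - int j" using False by (auto simp: j_def)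
  have "(inv_into (car V) (tw V \<theta>) ^^ j) x \<in> car V"
    by (induction j) (simp_all add: assms inv_tw)
  then have "tw V \<theta> (pw V \<theta> k x) = (inv_into (car V) (tw V \<theta>) ^^ j) x"
    using False j by (simp add: pw_def inv_tw)
  \<comment> \<open>The case j = 0 is special: then k + 1 = 0, which falls into the nonnegative
    branch of \<open>pw\<close>.\<close>
  also have "\<dots> = pw V \<theta> (k + 1) x" by (cases j) (simp_all add: pw_def j nat_add_distrib)
  finally show ?thesis .
qed

text \<open>A power is determined by its recursion, also for negative exponents; so every compatibility of
  the automorphisms with a structure map passes to their integral powers.\<close>

lemma pw_unique:
  assumes "\<And>k. g k \<in> car V" "\<And>k. tw V \<theta> (g k) = g (k + 1)"
  shows "pw V \<theta> k (g 0) = g k"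
proof (induction k rule: int_induct [where k = 0])
  case (step1 i)
  then show ?case using assms by (simp flip: pw_Suc)
next
  case (step2 i)
  have "tw V \<theta> (pw V \<theta> (i - 1) (g 0)) = tw V \<theta> (g (i - 1))"
    using step2 assms by (simp add: pw_Suc)
  then show ?case using tw_inj [of "pw V \<theta> (i - 1) (g 0)" "g (i - 1)" \<theta>] assms(1) by (simp add: pw_in)
qed (simp add: assms)

lemma pw_tw: "x \<in> car V \<Longrightarrow> pw V \<theta> k (tw V \<theta>' x) = tw V \<theta>' (pw V \<theta> k x)"
  using pw_unique [of "\<lambda>k. tw V \<theta>' (pw V \<theta> k x)" \<theta> k]
  by (simp add: tw_in pw_in pw_Suc tw_commute [of _ \<theta> \<theta>'])

lemma pw_commute: "x \<in> car V \<Longrightarrow> pw V \<theta> k (pw V \<theta>' l x) = pw V \<theta>' l (pw V \<theta> k x)"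
  using pw_unique [of "\<lambda>l. pw V \<theta> k (pw V \<theta>' l x)" \<theta>' l]
  by (simp add: pw_in pw_Suc flip: pw_tw)

lemma pw_pw: "x \<in> car V \<Longrightarrow> pw V \<theta> k (pw V \<theta> l x) = pw V \<theta> (k + l) x"
  using pw_unique [of "\<lambda>k. pw V \<theta> (k + l) x" \<theta> k] by (simp add: pw_in pw_Suc algebra_simps)

lemma pw_1: "x \<in> car V \<Longrightarrow> pw V \<theta> 1 x = tw V \<theta> x"
  using pw_Suc [of x \<theta> 0] by simp

lemma twp_in: "x \<in> car V \<Longrightarrow> twp V a b c d x \<in> car V"
  by (simp add: twp_def pw_in)

lemma twt_in [simp]: "twt V a b c d x \<in> car V"
  by (simp add: twt_def twp_in)

lemma twp_twt: "x \<in> car V \<Longrightarrow> twp V a b c d x = twt V a b c d x"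
  by (simp add: twt_def)

lemma pw_twt:
  "x \<in> car V \<Longrightarrow> pw V Alpha k x = twt V k 0 0 0 x" "x \<in> car V \<Longrightarrow> pw V Beta k x = twt V 0 k 0 0 x"
  "x \<in> car V \<Longrightarrow> pw V Omega k x = twt V 0 0 k 0 x" "x \<in> car V \<Longrightarrow> pw V Psi k x = twt V 0 0 0 k x"
  by (simp_all add: twt_def twp_def)

lemma tw_twt:
  "x \<in> car V \<Longrightarrow> tw V Alpha x = twt V 1 0 0 0 x" "x \<in> car V \<Longrightarrow> tw V Beta x = twt V 0 1 0 0 x"
  "x \<in> car V \<Longrightarrow> tw V Omega x = twt V 0 0 1 0 x" "x \<in> car V \<Longrightarrow> tw V Psi x = twt V 0 0 0 1 x"
  by (simp_all add: pw_1 flip: pw_twt)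

text \<open>The four automorphisms commute, so exponents add. As a rewrite rule this reduces every
  comparison of twisted expressions to integer arithmetic.\<close>

lemma twt_twt [simp]:
  "twt V a b c d (twt V a' b' c' d' x) = twt V (a + a') (b + b') (c + c') (d + d') x"
  unfolding twt_def twp_def using vspace_car
  by (simp add: pw_in pw_pw pw_commute [of _ Alpha _ Beta] pw_commute [of _ Alpha _ Omega]
      pw_commute [of _ Alpha _ Psi] pw_commute [of _ Beta _ Omega] pw_commute [of _ Beta _ Psi]
      pw_commute [of _ Omega _ Psi] flip: pw_pw)

lemma twt_0 [simp]: "twt V 0 0 0 0 x = proj (car V) x"
  by (simp add: twt_def twp_def)

lemma twt_proj [simp]: "twt V a b c d (proj (car V) x) = twt V a b c d x"
  "proj (car V) (twt V a b c d x) = twt V a b c d x"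
  using vspace_car by (simp_all add: twt_def twp_in)

lemma pw_add_scale:
  assumes "x \<in> car V"
  shows "y \<in> car V \<Longrightarrow> pw V \<theta> k (x + y) = pw V \<theta> k x + pw V \<theta> k y"
    and "pw V \<theta> k (c *\<^sub>k x) = c *\<^sub>k pw V \<theta> k x"
proof -
  note sub = arr.subspace_add [OF vspace_subspace [OF vspace_car]]
    arr.subspace_scale [OF vspace_subspace [OF vspace_car]]
  note tw = lin_mapD(2,3) [OF tw_lin_map [of \<theta>]]
  show "pw V \<theta> k (x + y) = pw V \<theta> k x + pw V \<theta> k y" if "y \<in> car V"
    using pw_unique [of "\<lambda>k. pw V \<theta> k x + pw V \<theta> k y" \<theta> k] assms that
    by (simp add: pw_in pw_Suc sub tw)
  show "pw V \<theta> k (c *\<^sub>k x) = c *\<^sub>k pw V \<theta> k x"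
    using pw_unique [of "\<lambda>k. c *\<^sub>k pw V \<theta> k x" \<theta> k] assms
    by (simp add: pw_in pw_Suc sub tw)
qed

lemma lin_twt: "lin (twt V a b c d)"
  unfolding lin_def twt_def twp_def
  by (simp add: lin_add [OF lin_proj] lin_scale [OF lin_proj] pw_add_scale pw_in)

lemma lin_twt' [lin_intros]: "lin f \<Longrightarrow> lin (\<lambda>x. twt V a b c d (f x))"
  by (rule lin_comp [OF lin_twt])

text \<open>Indicator exponents allow one computation for an unspecified \<theta>, without
  distinguishing the four automorphisms.\<close>

lemma tw_eq_twt: "x \<in> car V \<Longrightarrow> tw V \<theta> x = twt V (of_bool (\<theta> = Alpha)) (of_bool (\<theta> = Beta))
    (of_bool (\<theta> = Omega)) (of_bool (\<theta> = Psi)) x"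
  by (cases \<theta>) (simp_all add: tw_twt)

lemma twt_scale: "twt V a b c d (r *\<^sub>k x) = r *\<^sub>k twt V a b c d x"
  by (rule lin_scale [OF lin_twt])

end

lemma pw_transfer:
  assumes "twisted_space V" "twisted_space W"
    and "\<And>x. x \<in> car V \<Longrightarrow> f x \<in> car W" "\<And>x. x \<in> car V \<Longrightarrow> f (tw V \<theta> x) = tw W \<theta> (f x)" "x \<in> car V"
  shows "f (pw V \<theta> k x) = pw W \<theta> k (f x)"
  using twisted_space.pw_unique [OF assms(2), of "\<lambda>k. f (pw V \<theta> k x)" \<theta> k] assms(3-5)
  by (simp add: twisted_space.pw_in [OF assms(1)] twisted_space.pw_Suc [OF assms(1)]
      twisted_space.pw_0 [OF assms(1)] flip: assms(4))

lemma twt_transfer: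
  assumes "twisted_space V" "twisted_space W"
    and "\<And>x. x \<in> car V \<Longrightarrow> f x \<in> car W" "\<And>\<theta> x. x \<in> car V \<Longrightarrow> f (tw V \<theta> x) = tw W \<theta> (f x)" "x \<in> car V"
  shows "f (twt V a b c d x) = twt W a b c d (f x)"
proof -
  interpret V: twisted_space V by fact
  interpret W: twisted_space W by fact
  note t = pw_transfer [OF assms(1,2), of f]
  show ?thesis
    using assms(3-5) by (simp add: twt_def twp_def t V.pw_in W.pw_in)
qed

lemma twt_bilin:
  assumes "twisted_space V" "twisted_space H" "twisted_space W"
    and "\<And>v h. v \<in> car V \<Longrightarrow> h \<in> car H \<Longrightarrow> f v h \<in> car W"
    and "\<And>\<theta> v h. v \<in> car V \<Longrightarrow> h \<in> car H \<Longrightarrow> tw W \<theta> (f v h) = f (tw V \<theta> v) (tw H \<theta> h)"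
    and "v \<in> car V" "h \<in> car H"
  shows "twt W a b c d (f v h) = f (twt V a b c d v) (twt H a b c d h)"
proof -
  interpret V: twisted_space V by fact
  interpret H: twisted_space H by fact
  interpret W: twisted_space W by fact
  have pw: "pw W \<theta> k (f v h) = f (pw V \<theta> k v) (pw H \<theta> k h)" if "v \<in> car V" "h \<in> car H" for \<theta> k v h
    using W.pw_unique [of "\<lambda>k. f (pw V \<theta> k v) (pw H \<theta> k h)" \<theta> k] that assms(4,5)
    by (simp add: V.pw_in H.pw_in V.pw_Suc H.pw_Suc)
  show ?thesis
    using assms(4,6,7)
    by (simp add: twt_def twp_def pw V.pw_in H.pw_in)
qed


subsection \<open>Tensor products of twisted spaces\<close>

text \<open>Only the carrier and the automorphisms of \<open>X\<close> are fixed. Thus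
  \<open>X\<close> can be the tensor product of two modules, but also the bare space V \<otimes> H
  in which coactions take their values.\<close>

locale tensor_twisted = V: twisted_space V + W: twisted_space W
  for V :: "('k::field, 'x, 'v) space_rec_scheme" and W :: "('k, 'x, 'w) space_rec_scheme"
    and X :: "('k, 'x, 'z) space_rec_scheme" +
  assumes car_X: "car X = car V \<otimes>\<^sub>S car W"
    and tw_X: "tw X \<theta> = tensor_map (car V) (car W) (tw V \<theta>) (tw W \<theta>)"
begin

lemma vspace_X: "vspace (car X)"
  by (simp add: car_X vspace_tensor_space)

lemma tw_X_lin_map: "tw X \<theta> \<in> lin_map (car X) (car X)"
  unfolding tw_X car_X by (intro tensor_map_in_lin_map V.vspace_car W.vspace_car V.tw_lin_map W.tw_lin_map)

lemma tw_tensor: "v \<in> car V \<Longrightarrow> w \<in> car W \<Longrightarrow> tw X \<theta> (v \<otimes> w) = tw V \<theta> v \<otimes> tw W \<theta> w"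
  unfolding tw_X
  by (rule tensor_map_in_lin_map(2) [OF V.vspace_car W.vspace_car V.vspace_car W.vspace_car V.tw_lin_map W.tw_lin_map])

lemma ext_X:
  assumes "lin f" "lin g" "t \<in> car X" "\<And>v w. v \<in> car V \<Longrightarrow> w \<in> car W \<Longrightarrow> f (v \<otimes> w) = g (v \<otimes> w)"
  shows "f t = g t"
  using tensor_ext [OF V.vspace_car assms(1,2,4)] assms(3) car_X by simp

lemma lin_twX: "lin (\<lambda>t. tw X \<theta> (proj (car X) t))"
  by (rule lin_map_proj [OF vspace_X tw_X_lin_map])

lemma twisted_X: "twisted_space X"
proof
  show "vspace (car X)" by (rule vspace_X)
  note lins = lin_ident lin_comp [OF lin_twX] lin_proj [OF vspace_X]
  note in_X = lin_mapD(1) [OF tw_X_lin_map] car_X [THEN equalityD2, THEN subsetD]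
  show "tw X \<theta> (tw X \<theta>' x) = tw X \<theta>' (tw X \<theta> x)" if "x \<in> car X" for \<theta> \<theta>' x
  proof -
    have "tw X \<theta> (proj (car X) (tw X \<theta>' (proj (car X) x)))
      = tw X \<theta>' (proj (car X) (tw X \<theta> (proj (car X) x)))"
      by (rule ext_X [OF _ _ that], intro lins, intro lins)
         (simp add: vspace_X in_X tw_tensor V.tw_in W.tw_in V.tw_commute [of _ \<theta>] W.tw_commute [of _ \<theta>])
    then show ?thesis using that by (simp add: vspace_X in_X)
  qed
  show "tw X \<theta> \<in> lin_aut (car X)" for \<theta>
  proof -
    \<comment> \<open>The witness for bijectivity is the tensor product of the inverse
      automorphisms, expressed by negated indicator exponents.\<close>
    define g where "g = (\<lambda>t. sw (dec (car V) (car W) (proj (car X) t)) (\<lambda>v w.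
      twt V (- of_bool (\<theta> = Alpha)) (- of_bool (\<theta> = Beta)) (- of_bool (\<theta> = Omega)) (- of_bool (\<theta> = Psi)) v
      \<otimes> twt W (- of_bool (\<theta> = Alpha)) (- of_bool (\<theta> = Beta)) (- of_bool (\<theta> = Omega)) (- of_bool (\<theta> = Psi)) w))"
      (is "g = (\<lambda>t. sw _ ?G)")
    have G: "bilin ?G" by (intro lin_intros V.lin_twt' W.lin_twt')
    have lin_g: "lin g"
      unfolding g_def car_X
      by (intro lin_sw_dec V.vspace_car W.vspace_car G lin_proj vspace_tensor_space proj_in)
    have g_tensor: "g (v \<otimes> w) = ?G v w" if "v \<in> car V" "w \<in> car W" for v w
      unfolding g_def using that sw_dec_tensor [OF V.vspace_car W.vspace_car G]
      by (simp add: in_X vspace_X)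
    have g_in: "g t \<in> car X" for t
      unfolding g_def car_X
      by (rule sw_in [OF vspace_subspace dec_tensor(1)])
         (simp_all add: vspace_tensor_space)
    have 1: "tw X \<theta> (proj (car X) (g t)) = t" if "t \<in> car X" for t
      by (rule ext_X [OF _ _ that, where g = "\<lambda>x. x"], intro lin_comp [OF lin_twX] lin_g lin_ident, rule lin_ident)
         (simp add: g_tensor in_X vspace_X tw_tensor V.tw_eq_twt W.tw_eq_twt)
    have 2: "g (tw X \<theta> (proj (car X) t)) = t" if "t \<in> car X" for t
      by (rule ext_X [OF _ _ that, where g = "\<lambda>x. x"], intro lin_comp [OF lin_g] lin_twX, rule lin_ident)
         (simp add: g_tensor in_X vspace_X tw_tensor V.tw_eq_twt W.tw_eq_twt)
    have "bij_betw (tw X \<theta>) (car X) (car X)"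
      by (rule bij_betw_byWitness [where f' = g])
         (use 1 2 g_in in_X(1) in \<open>auto simp: vspace_X\<close>)
    then show ?thesis using tw_X_lin_map by (simp add: lin_aut_def)
  qed
qed

sublocale X: twisted_space X
  by (rule twisted_X)

lemma twt_tensor:
  "v \<in> car V \<Longrightarrow> w \<in> car W \<Longrightarrow> twt X a b c d (v \<otimes> w) = twt V a b c d v \<otimes> twt W a b c d w"
  by (rule twt_bilin [OF V.twisted_space_axioms W.twisted_space_axioms X.twisted_space_axioms])
     (simp_all add: tw_tensor car_X)

lemma sw_dec_twt:
  assumes F: "bilin F" and "t \<in> car X"
  shows "sw (dec (car V) (car W) (twt X a b c d t)) F
    = sw (dec (car V) (car W) t) (\<lambda>v w. F (twt V a b c d v) (twt W a b c d w))"
proof -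
  have G: "bilin (\<lambda>v w. F (twt V a b c d v) (twt W a b c d w))"
    by (intro bilinI bilin_lins [OF F] V.lin_twt W.lin_twt)
  have "sw (dec (car V) (car W) (proj (car X) (twt X a b c d t))) F
    = sw (dec (car V) (car W) (proj (car X) t)) (\<lambda>v w. F (twt V a b c d v) (twt W a b c d w))"
  proof (rule ext_X [OF _ _ \<open>t \<in> car X\<close>])
    show "lin (\<lambda>t. sw (dec (car V) (car W) (proj (car X) (twt X a b c d t))) F)"
      using X.lin_twt' lin_ident F unfolding car_X
      by (intro lin_sw_dec V.vspace_car W.vspace_car lin_proj' vspace_tensor_space proj_in) auto
    show "lin (\<lambda>t. sw (dec (car V) (car W) (proj (car X) t))
        (\<lambda>v w. F (twt V a b c d v) (twt W a b c d w)))"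
      unfolding car_X
      by (intro lin_sw_dec G V.vspace_car W.vspace_car lin_proj vspace_tensor_space proj_in)
    show "sw (dec (car V) (car W) (proj (car X) (twt X a b c d (v \<otimes> w)))) F
      = sw (dec (car V) (car W) (proj (car X) (v \<otimes> w))) (\<lambda>v w. F (twt V a b c d v) (twt W a b c d w))"
      if "v \<in> car V" "w \<in> car W" for v w
    proof -
      have "v \<otimes> w \<in> car X" "twt V a b c d v \<otimes> twt W a b c d w \<in> car X"
        using that by (simp_all add: car_X)
      then show ?thesis
        using that sw_dec_tensor [OF V.vspace_car W.vspace_car] F G by (simp add: twt_tensor)
    qed
  qed
  then show ?thesis using assms(2) by (simp)
qed

end

subsection \<open>Structure maps as total multilinear maps\<close>

lemma sw_proj:
  "vspace V \<Longrightarrow> vspace W \<Longrightarrow> set ps \<subseteq> V \<times> W \<Longrightarrow> sw ps (\<lambda>a b. F (proj V a) (proj W b)) = sw ps F"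
  by (rule sw_cong, assumption) simp

text \<open>Two elements of a threefold tensor product are equal if and only if all trilinear maps
  agree on them: in one direction \<open>G\<close> induces a linear map, in the other the threefold
  tensor itself serves as \<open>G\<close>.\<close>

lemma coassoc_iff:
  fixes V H :: "('k::field, 'x) arr set"
  assumes V: "vspace V" and H: "vspace H" and t: "t \<in> V \<otimes>\<^sub>S H"
    and f: "\<And>x. x \<in> V \<Longrightarrow> f x \<in> V" and g: "\<And>y. y \<in> H \<Longrightarrow> g y \<in> H"
    and \<Delta>: "\<And>y. y \<in> H \<Longrightarrow> \<Delta> y \<in> H \<otimes>\<^sub>S H" and \<rho>: "\<And>x. x \<in> V \<Longrightarrow> \<rho> x \<in> V \<otimes>\<^sub>S H"
  shows "sw (dec V H t) (\<lambda>x y. f x \<otimes> \<Delta> y) = sw (dec V H t) (\<lambda>x y. \<rho> x \<otimes> g y) \<longleftrightarrow>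
    (\<forall>G. trilin G \<longrightarrow> sw (dec V H t) (\<lambda>x y. sw (dec H H (\<Delta> y)) (\<lambda>z w. G (f x) z w))
      = sw (dec V H t) (\<lambda>x y. sw (dec V H (\<rho> x)) (\<lambda>z w. G z w (g y))))" (is "?l = ?r \<longleftrightarrow> (\<forall>G. _ \<longrightarrow> ?L G = ?R G)")
proof safe
  note in_VH = dec_tensor(1) [OF V t]
  have HH: "vspace (H \<otimes>\<^sub>S H)" by (rule vspace_tensor_space [OF H H])
  fix G :: "('k, 'x) arr \<Rightarrow> ('k, 'x) arr \<Rightarrow> ('k, 'x) arr \<Rightarrow> ('k, 'x) arr"
  assume eq: "?l = ?r" and G: "trilin G"
  \<comment> \<open>\<open>K\<close> extends \<open>G\<close> over the tensor product of its last
    two arguments, and \<open>L\<close> then extends \<open>K\<close> over the first; so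
    \<open>L\<close> is the linear map on the threefold tensor product induced by
    \<open>G\<close>.\<close>
  define K where "K a s = sw (dec H H (proj (H \<otimes>\<^sub>S H) s)) (G a)" for a s
  define L where "L s = sw (dec V (H \<otimes>\<^sub>S H) (proj (V \<otimes>\<^sub>S H \<otimes>\<^sub>S H) s)) K" for s
  have G': "bilin (G a)" for a
    by (intro bilinI trilin_lins [OF G] lin_ident)
  have K: "bilin K"
    unfolding K_def
  proof (rule bilinI)
    show "lin (\<lambda>a. sw (dec H H (proj (H \<otimes>\<^sub>S H) b)) (G a))" for b
      by (intro lin_sw trilin_lins [OF G] lin_ident)
    show "lin (\<lambda>b. sw (dec H H (proj (H \<otimes>\<^sub>S H) b)) (G a))" for a
      by (intro lin_sw_dec H G' lin_proj HH proj_in)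
  qed
  have L: "lin L"
    unfolding L_def by (intro lin_sw_dec V HH K lin_proj vspace_tensor_space proj_in)
  have L_tensor: "L (a \<otimes> s) = sw (dec H H s) (G a)" if "a \<in> V" "s \<in> H \<otimes>\<^sub>S H" for a s
    using that V HH by (simp add: L_def vspace_tensor_space sw_dec_tensor [OF V HH K] K_def)
  \<comment> \<open>\<open>L\<close> was built for the bracketing to the right. For a tensor
    bracketed to the left, the factor s is expanded and the brackets are moved on pure
    tensors.\<close>
  have L_tensor': "L (s \<otimes> b) = sw (dec V H s) (\<lambda>z w. G z w b)" if "b \<in> H" "s \<in> V \<otimes>\<^sub>S H" for b s
  proof -
    have "L (sw (dec V H s) (\<otimes>) \<otimes> b) = sw (dec V H s) (\<lambda>z w. L (z \<otimes> w \<otimes> b))"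
      by (simp only: sw_tensor_left tensor_assoc sw_lin [OF L])
    also have "\<dots> = sw (dec V H s) (\<lambda>z w. G z w b)"
      by (rule sw_cong [OF dec_tensor(1) [OF V that(2)]])
         (simp add: that L_tensor sw_dec_tensor [OF H H G'])
    finally show ?thesis using dec_tensor(2) [OF V that(2)] by simp
  qed
  have "L ?l = ?L G"
    unfolding sw_lin [OF L] by (rule sw_cong [OF in_VH]) (simp add: L_tensor f \<Delta>)
  moreover have "L ?r = ?R G"
    unfolding sw_lin [OF L] by (rule sw_cong [OF in_VH]) (simp add: L_tensor' g \<rho>)
  ultimately show "?L G = ?R G" using eq by simp
next
  note in_VH = dec_tensor(1) [OF V t]
  assume "\<forall>G. trilin G \<longrightarrow> ?L G = ?R G"
  moreover have "trilin (\<lambda>x y z. x \<otimes> y \<otimes> z)" by (intro lin_intros)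
  ultimately have "?L (\<lambda>x y z. x \<otimes> y \<otimes> z) = ?R (\<lambda>x y z. x \<otimes> y \<otimes> z)" by blast
  moreover have "?L (\<lambda>x y z. x \<otimes> y \<otimes> z) = ?l"
    by (rule sw_cong [OF in_VH]) (simp add: dec_tensor(2) [OF H \<Delta>] flip: sw_tensor_right)
  moreover have "?R (\<lambda>x y z. x \<otimes> y \<otimes> z) = ?r"
    by (rule sw_cong [OF in_VH]) (simp add: dec_tensor(2) [OF V \<rho>] flip: sw_tensor_left tensor_assoc)
  ultimately show "?l = ?r" by simp
qed

section \<open>Actions and coactions as total maps compatible with the twists\<close>

definition tact :: "('k::field, 'x, 'v) space_rec_scheme \<Rightarrow> ('k, 'x, 'h) space_rec_scheme
    \<Rightarrow> (('k, 'x) arr \<Rightarrow> ('k, 'x) arr \<Rightarrow> ('k, 'x) arr) \<Rightarrow> ('k, 'x) arr \<Rightarrow> ('k, 'x) arr \<Rightarrow> ('k, 'x) arr"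
  where "tact V H f v h = f (proj (car V) v) (proj (car H) h)"

text \<open>Taking V = H covers the multiplication of \<open>H\<close>, so products and actions
  share one calculus.\<close>

locale twisted_action = V: twisted_space V + H: twisted_space H
  for V :: "('k::field, 'x, 'v) space_rec_scheme" and H :: "('k, 'x, 'h) space_rec_scheme"
    and f :: "('k, 'x) arr \<Rightarrow> ('k, 'x) arr \<Rightarrow> ('k, 'x) arr" +
  assumes bilin_map: "f \<in> bilin_map (car V) (car H) (car V)"
    and equivariant: "\<lbrakk>v \<in> car V; h \<in> car H\<rbrakk> \<Longrightarrow> tw V \<theta> (f v h) = f (tw V \<theta> v) (tw H \<theta> h)"
begin

lemma act_in: "v \<in> car V \<Longrightarrow> h \<in> car H \<Longrightarrow> f v h \<in> car V"
  using bilin_map unfolding bilin_map_iff [OF V.vspace_car H.vspace_car] by blast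

lemma bilin_tact: "bilin (tact V H f)"
  using bilin_map unfolding bilin_map_iff [OF V.vspace_car H.vspace_car] tact_def by blast

lemmas tact_lins [lin_intros] = bilin_tact bilin_lins [OF bilin_tact]

lemma tact_in [simp]: "tact V H f v h \<in> car V"
  by (simp add: tact_def act_in)

lemma tact_proj [simp]:
  "tact V H f (proj (car V) v) h = tact V H f v h" "tact V H f v (proj (car H) h) = tact V H f v h"
  "proj (car V) (tact V H f v h) = tact V H f v h"
  by (simp_all add: tact_def act_in)

lemma tact_act: "v \<in> car V \<Longrightarrow> h \<in> car H \<Longrightarrow> f v h = tact V H f v h"
  by (simp add: tact_def)

lemma twt_tact [simp]: "twt V a b c d (tact V H f v h) = tact V H f (twt V a b c d v) (twt H a b c d h)"
proof -
  have "twt V a b c d (f (proj (car V) v) (proj (car H) h))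
    = f (twt V a b c d (proj (car V) v)) (twt H a b c d (proj (car H) h))"
    by (rule twt_bilin [OF V.twisted_space_axioms H.twisted_space_axioms V.twisted_space_axioms])
       (simp_all add: act_in equivariant)
  then show ?thesis by (simp add: tact_def)
qed

end

definition cdec :: "('k::field, 'x, 'v) space_rec_scheme \<Rightarrow> ('k, 'x, 'h) space_rec_scheme
    \<Rightarrow> (('k, 'x) arr \<Rightarrow> ('k, 'x) arr) \<Rightarrow> ('k, 'x) arr \<Rightarrow> (('k, 'x) arr \<times> ('k, 'x) arr) list"
  where "cdec V H \<rho> v = dec (car V) (car H) (\<rho> (proj (car V) v))"

text \<open>Likewise the coproduct is the case V = H of a coaction.\<close>

locale twisted_coaction = V: twisted_space V + H: twisted_space H
  for V :: "('k::field, 'x, 'v) space_rec_scheme" and H :: "('k, 'x, 'h) space_rec_scheme"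
    and \<rho> :: "('k, 'x) arr \<Rightarrow> ('k, 'x) arr" +
  assumes lin_map: "\<rho> \<in> lin_map (car V) (car V \<otimes>\<^sub>S car H)"
    and equivariant: "v \<in> car V \<Longrightarrow> \<rho> (tw V \<theta> v)
      = sweedler (car V) (car H) (\<rho> v) (\<lambda>x y. tw V \<theta> x \<otimes> tw H \<theta> y)"
begin

lemma coact_in: "v \<in> car V \<Longrightarrow> \<rho> v \<in> car V \<otimes>\<^sub>S car H"
  using lin_mapD(1) [OF lin_map] .

lemma cdec_in: "set (cdec V H \<rho> v) \<subseteq> car V \<times> car H"
  unfolding cdec_def by (rule dec_tensor(1)) (simp_all add: coact_in)

lemma cdec_proj [simp]: "cdec V H \<rho> (proj (car V) v) = cdec V H \<rho> v"
  by (simp add: cdec_def)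

lemma sweedler_cdec: "v \<in> car V \<Longrightarrow> sweedler (car V) (car H) (\<rho> v) F = sw (cdec V H \<rho> v) F"
  by (simp add: cdec_def sweedler_sw)

lemma dec_cdec: "v \<in> car V \<Longrightarrow> dec (car V) (car H) (\<rho> v) = cdec V H \<rho> v"
  by (simp add: cdec_def)

lemma cdec_tensor: "sw (cdec V H \<rho> v) (\<otimes>) = \<rho> (proj (car V) v)"
  unfolding cdec_def by (rule dec_tensor(2)) (simp_all add: coact_in)

lemma lin_cdec [lin_intros]: "lin f \<Longrightarrow> bilin F \<Longrightarrow> lin (\<lambda>x. sw (cdec V H \<rho> (f x)) F)"
  unfolding cdec_def
  by (intro lin_sw_dec V.vspace_car H.vspace_car lin_comp [OF lin_map_proj [OF V.vspace_car lin_map]]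
      coact_in proj_in)

lemma sw_cdec_proj: "sw (cdec V H \<rho> v) (\<lambda>x y. F (proj (car V) x) (proj (car H) y)) = sw (cdec V H \<rho> v) F"
  by (rule sw_proj [OF V.vspace_car H.vspace_car cdec_in])

lemma cdec_twt:
  assumes F: "bilin F"
  shows "sw (cdec V H \<rho> (twt V a b c d v)) F
    = sw (cdec V H \<rho> v) (\<lambda>x y. F (twt V a b c d x) (twt H a b c d y))"
proof -
  \<comment> \<open>Once V \<otimes> H carries its own automorphisms, equivariance says that \<rho>
    commutes with them, and commutation passes to all integral powers.\<close>
  define X where "X = \<lparr>car = car V \<otimes>\<^sub>S car H, tw = \<lambda>\<theta>. tensor_map (car V) (car H) (tw V \<theta>) (tw H \<theta>)\<rparr>"
  interpret X: tensor_twisted V H X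
    by unfold_locales (simp_all add: X_def)
  have "\<rho> (twt V a b c d (proj (car V) v)) = twt X a b c d (\<rho> (proj (car V) v))"
    by (rule twt_transfer [OF V.twisted_space_axioms X.X.twisted_space_axioms])
       (simp_all add: coact_in equivariant X_def tensor_map_def)
  then show ?thesis
    unfolding cdec_def using X.sw_dec_twt [OF F, of "\<rho> (proj (car V) v)" a b c d]
    by (simp add: coact_in X_def)
qed

end

locale twisted_comodule = twisted_coaction V H \<rho> + cop: twisted_coaction H H \<Delta>
  for V :: "('k::field, 'x, 'v) space_rec_scheme" and H :: "('k, 'x, 'h) space_rec_scheme" and \<rho> \<Delta>
begin

lemma twisted_coassoc_iff:
  assumes v: "v \<in> car V"
  shows "sweedler (car V) (car H) (\<rho> v) (\<lambda>x y. tw V Omega x \<otimes> \<Delta> y)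
      = sweedler (car V) (car H) (\<rho> v) (\<lambda>x y. \<rho> x \<otimes> tw H Psi y) \<longleftrightarrow>
    (\<forall>G. trilin G \<longrightarrow>
      sw (cdec V H \<rho> v) (\<lambda>x y. sw (cdec H H \<Delta> y) (\<lambda>z w. G (twt V 0 0 1 0 x) z w))
      = sw (cdec V H \<rho> v) (\<lambda>x y. sw (cdec V H \<rho> x) (\<lambda>z w. G z w (twt H 0 0 0 1 y))))"
proof -
  have "sw (cdec V H \<rho> v) (\<lambda>x y. sw (dec (car H) (car H) (\<Delta> y)) (\<lambda>z w. G (tw V Omega x) z w))
      = sw (cdec V H \<rho> v) (\<lambda>x y. sw (cdec H H \<Delta> y) (\<lambda>z w. G (twt V 0 0 1 0 x) z w))"
    "sw (cdec V H \<rho> v) (\<lambda>x y. sw (dec (car V) (car H) (\<rho> x)) (\<lambda>z w. G z w (tw H Psi y)))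
      = sw (cdec V H \<rho> v) (\<lambda>x y. sw (cdec V H \<rho> x) (\<lambda>z w. G z w (twt H 0 0 0 1 y)))" for G
    by (rule sw_cong [OF cdec_in], simp add: dec_cdec cop.dec_cdec V.tw_twt H.tw_twt)+
  then show ?thesis
    unfolding sweedler_cdec [OF v]
    using coassoc_iff [OF V.vspace_car H.vspace_car coact_in [OF v] V.tw_in H.tw_in cop.coact_in coact_in]
    unfolding dec_cdec [OF v] by simp
qed

end


subsection \<open>The untwisted Hopf algebra\<close>

text \<open>The suffix \<open>0\<close> marks untwisted structure maps.\<close>

definition m0 :: "('k::field, 'x, 'y) bialg_rec_scheme \<Rightarrow> ('k, 'x) arr \<Rightarrow> ('k, 'x) arr \<Rightarrow> ('k, 'x) arr"
  where "m0 H a b = tact H H (mul H) (twt H (-1) 0 0 0 a) (twt H 0 (-1) 0 0 b)"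

definition dH0 :: "('k::field, 'x, 'y) bialg_rec_scheme \<Rightarrow> ('k, 'x) arr \<Rightarrow> (('k, 'x) arr \<times> ('k, 'x) arr) list"
  where "dH0 H h = map (\<lambda>(x, y). (twt H 0 0 (-1) 0 x, twt H 0 0 0 (-1) y)) (cdec H H (cop H) h)"

definition eps0 :: "('k::field, 'x, 'y) bialg_rec_scheme \<Rightarrow> ('k, 'x) arr \<Rightarrow> 'k"
  where "eps0 H h = cou H (proj (car H) h)"

lemma sw_dH0: "sw (dH0 H h) F = sw (cdec H H (cop H) h) (\<lambda>x y. F (twt H 0 0 (-1) 0 x) (twt H 0 0 0 (-1) y))"
  unfolding dH0_def by (rule sw_map)

lemma twist_cases_pairs: "\<theta> \<in> {Alpha, Beta} \<or> \<theta> \<in> {Omega, Psi}"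
  by (cases \<theta>) auto

context bihom_bialgebra
begin

sublocale mul: twisted_action H H "mul H"
  using mul_bilin tw_mul tw_mul' twist_cases_pairs by unfold_locales blast+

sublocale cop: twisted_coaction H H "cop H"
  using cop_lin cop_tw cop_tw' twist_cases_pairs by unfold_locales blast+

lemma tw_one_all: "tw H \<theta> (one H) = one H"
  using tw_one tw_one' twist_cases_pairs by blast

lemma twt_one [simp]: "twt H a b c d (one H) = one H"
proof -
  have "pw H \<theta> k (one H) = one H" for \<theta> k
    using pw_unique [of "\<lambda>_. one H" \<theta> k] one_in tw_one_all by simp
  then show ?thesis by (simp add: twt_def twp_def one_in)
qed

lemma cou_twt [simp]: "cou H (twt H a b c d h) = eps0 H h"
proof -
  have tw: "cou H (tw H \<theta> x) = cou H x" if "x \<in> car H" for \<theta> x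
    using cou_tw cou_tw' twist_cases_pairs that by blast
  \<comment> \<open>The values are scalars and not elements of a carrier, so
    \<open>pw_unique\<close> cannot be used; the induction runs in both directions from 0.\<close>
  have pw: "cou H (pw H \<theta> k x) = cou H x" if x: "x \<in> car H" for \<theta> k x
  proof (induction k rule: int_induct [where k = 0])
    case (step1 i)
    then show ?case using tw [OF pw_in [OF x, of \<theta> i], of \<theta>] by (simp add: pw_Suc x)
  next
    case (step2 i)
    then show ?case using tw [OF pw_in [OF x, of \<theta> "i - 1"], of \<theta>] by (simp add: pw_Suc x)
  qed simp
  show ?thesis by (simp add: eps0_def twt_def twp_def pw pw_in)
qed

lemma eps0_cou: "h \<in> car H \<Longrightarrow> eps0 H h = cou H h"
  by (simp add: eps0_def)

lemma eps0_twt [simp]: "eps0 H (twt H a b c d h) = eps0 H h"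
  by (simp add: eps0_cou)

text \<open>The BiHom associativity law at \<beta>^(-1)(c), oriented as a rewrite rule that brackets
  products to the right.\<close>

lemma tmul_assoc:
  "tact H H (mul H) (tact H H (mul H) a b) c
    = tact H H (mul H) (twt H 1 0 0 0 a) (tact H H (mul H) b (twt H 0 (-1) 0 0 c))"
  using mul_assoc [of "proj (car H) a" "proj (car H) b" "twt H 0 (-1) 0 0 c"]
  by (simp add: mul.tact_act mul.act_in tw_twt del: mul.twt_tact)

lemma cop_coassoc':
  assumes G: "trilin G"
  shows "sw (cdec H H (cop H) h) (\<lambda>x y. sw (cdec H H (cop H) y) (\<lambda>z w. G (twt H 0 0 1 0 x) z w))
    = sw (cdec H H (cop H) h) (\<lambda>x y. sw (cdec H H (cop H) x) (\<lambda>z w. G z w (twt H 0 0 0 1 y)))"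
proof -
  interpret C: twisted_comodule H H "cop H" "cop H" ..
  have h: "proj (car H) h \<in> car H" by simp
  show ?thesis
    using C.twisted_coassoc_iff [OF h] cop_coassoc [OF h] G by simp
qed

text \<open>The axiom gives the coproduct of a product as a double sum of pure tensors. Its chosen
  decomposition is replaced by this explicit one, one sum at a time.\<close>

lemma cop_mul':
  assumes F: "bilin F"
  shows "sw (cdec H H (cop H) (tact H H (mul H) a b)) F
    = sw (cdec H H (cop H) a) (\<lambda>a1 a2. sw (cdec H H (cop H) b) (\<lambda>b1 b2.
        F (tact H H (mul H) a1 b1) (tact H H (mul H) a2 b2)))"
proof -
  let ?t = "tact H H (mul H)" and ?c = "cdec H H (cop H)"
  have in1: "mul H a1 b1 \<otimes> mul H a2 b2 \<in> car H \<otimes>\<^sub>S car H"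
    if "a1 \<in> car H" "a2 \<in> car H" "b1 \<in> car H" "b2 \<in> car H" for a1 a2 b1 b2
    using that by (simp add: mul.act_in)
  have in2: "sw (?c b) (\<lambda>b1 b2. mul H a1 b1 \<otimes> mul H a2 b2) \<in> car H \<otimes>\<^sub>S car H"
    if "a1 \<in> car H" "a2 \<in> car H" for a1 a2 b
    by (rule sw_in [OF vspace_subspace cop.cdec_in]) (simp_all add: in1 that vspace_tensor_space)
  have "cop H (?t a b) = sw (?c a) (\<lambda>a1 a2. sw (?c b) (\<lambda>b1 b2. mul H a1 b1 \<otimes> mul H a2 b2))"
    using cop_mul [of "proj (car H) a" "proj (car H) b"]
    by (simp add: cop.sweedler_cdec tact_def)
  then have "sw (?c (?t a b)) F
    = sw (dec (car H) (car H) (sw (?c a) (\<lambda>a1 a2. sw (?c b) (\<lambda>b1 b2. mul H a1 b1 \<otimes> mul H a2 b2)))) F"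
    by (simp add: cdec_def)
  also have "\<dots> = sw (?c a) (\<lambda>a1 a2. sw (dec (car H) (car H) (sw (?c b) (\<lambda>b1 b2. mul H a1 b1 \<otimes> mul H a2 b2))) F)"
    by (rule sw_dec_sw [OF vspace_car vspace_car F cop.cdec_in in2])
  also have "\<dots> = sw (?c a) (\<lambda>a1 a2. sw (?c b) (\<lambda>b1 b2. F (mul H a1 b1) (mul H a2 b2)))"
  proof (rule sw_cong [OF cop.cdec_in])
    fix a1 a2 assume a: "a1 \<in> car H" "a2 \<in> car H"
    have "sw (dec (car H) (car H) (sw (?c b) (\<lambda>b1 b2. mul H a1 b1 \<otimes> mul H a2 b2))) F
      = sw (?c b) (\<lambda>b1 b2. sw (dec (car H) (car H) (mul H a1 b1 \<otimes> mul H a2 b2)) F)"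
      by (rule sw_dec_sw [OF vspace_car vspace_car F cop.cdec_in in1]) (simp_all add: a)
    also have "\<dots> = sw (?c b) (\<lambda>b1 b2. F (mul H a1 b1) (mul H a2 b2))"
      by (rule sw_cong [OF cop.cdec_in]) (simp add: a mul.act_in sw_dec_tensor [OF vspace_car vspace_car F])
    finally show "sw (dec (car H) (car H) (sw (?c b) (\<lambda>b1 b2. mul H a1 b1 \<otimes> mul H a2 b2))) F
      = sw (?c b) (\<lambda>b1 b2. F (mul H a1 b1) (mul H a2 b2))" .
  qed
  also have "\<dots> = sw (?c a) (\<lambda>a1 a2. sw (?c b) (\<lambda>b1 b2. F (?t a1 b1) (?t a2 b2)))"
    by (intro sw_cong [OF cop.cdec_in]) (simp add: mul.tact_act)
  finally show ?thesis .
qed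

lemma counit':
  assumes f: "lin f"
  shows "sw (cdec H H (cop H) h) (\<lambda>x y. eps0 H y *\<^sub>k f x) = f (twt H 0 0 1 0 h)"
    "sw (cdec H H (cop H) h) (\<lambda>x y. eps0 H x *\<^sub>k f y) = f (twt H 0 0 0 1 h)"
proof -
  have h: "proj (car H) h \<in> car H" by simp
  have "sw (cdec H H (cop H) h) (\<lambda>x y. eps0 H y *\<^sub>k f x)
    = f (sw (cdec H H (cop H) h) (\<lambda>x y. cou H y *\<^sub>k x))"
    unfolding sw_lin [OF f] lin_scale [OF f] by (rule sw_cong [OF cop.cdec_in]) (simp add: eps0_cou)
  then show "sw (cdec H H (cop H) h) (\<lambda>x y. eps0 H y *\<^sub>k f x) = f (twt H 0 0 1 0 h)"
    using cou_right [OF h] by (simp add: cop.sweedler_cdec h tw_twt)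
  have "sw (cdec H H (cop H) h) (\<lambda>x y. eps0 H x *\<^sub>k f y)
    = f (sw (cdec H H (cop H) h) (\<lambda>x y. cou H x *\<^sub>k y))"
    unfolding sw_lin [OF f] lin_scale [OF f] by (rule sw_cong [OF cop.cdec_in]) (simp add: eps0_cou)
  then show "sw (cdec H H (cop H) h) (\<lambda>x y. eps0 H x *\<^sub>k f y) = f (twt H 0 0 0 1 h)"
    using cou_left [OF h] by (simp add: cop.sweedler_cdec h tw_twt)
qed

lemma lin_fn_eps0: "lin_fn (eps0 H)"
  using cou_lin vspace_car
  by (simp add: lin_fn_def eps0_def lin_form_def lin_add [OF lin_proj] lin_scale [OF lin_proj])

lemma bialg0: "bialg0 (car H) (m0 H) (one H) (dH0 H) (eps0 H)"
proof
  show "bilin (m0 H)" unfolding m0_def by (intro lin_intros)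
  show "m0 H (m0 H a b) c = m0 H a (m0 H b c)" for a b c
    by (simp add: m0_def tmul_assoc)
  show "m0 H a (one H) = proj (car H) a" "m0 H (one H) a = proj (car H) a" for a
    by (simp_all add: m0_def tact_def one_in mul_one one_mul tw_twt)
  show "set (dH0 H h) \<subseteq> car H \<times> car H" for h
    by (auto simp: dH0_def)
  show "lin (\<lambda>h. sw (dH0 H h) F)" if "bilin F" for F
    unfolding sw_dH0 by (intro lin_intros bilin_lins [OF that])
  show "sw (dH0 H h) (\<lambda>a b. sw (dH0 H b) (\<lambda>c d. G a c d)) = sw (dH0 H h) (\<lambda>a b. sw (dH0 H a) (\<lambda>c d. G c d b))" (is "?l = _")
    if G: "trilin G" for G h
  proof -
    note lins = lin_intros trilin_lins [OF G]
    let ?c = "cdec H H (cop H)" and ?t = "twt H"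
    have "?l = sw (?c h) (\<lambda>a b. sw (?c b) (\<lambda>z w. G (?t 0 0 (-1) 0 a) (?t 0 0 (-1) (-1) z) (?t 0 0 0 (-2) w)))"
      unfolding sw_dH0 by (rule sw_eqI, subst cop.cdec_twt, intro lins) simp
    also have "\<dots> = sw (?c h) (\<lambda>a b. sw (?c a) (\<lambda>z w. G (?t 0 0 (-2) 0 z) (?t 0 0 (-1) (-1) w) (?t 0 0 0 (-1) b)))"
    proof -
      \<comment> \<open>The exponent -2 of \<omega> on the first leg becomes -1 through the \<omega>
        in \<open>cop_coassoc'\<close>; symmetrically, the \<psi> there acts on the last
        leg.\<close>
      have "trilin (\<lambda>x z w. G (?t 0 0 (-2) 0 x) (?t 0 0 (-1) (-1) z) (?t 0 0 0 (-2) w))"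
        by (intro lins)
      from cop_coassoc' [OF this, of h] show ?thesis by simp
    qed
    also have "\<dots> = sw (dH0 H h) (\<lambda>a b. sw (dH0 H a) (\<lambda>c d. G c d b))"
      unfolding sw_dH0 by (rule sw_eqI, subst cop.cdec_twt, intro lins) simp
    finally show ?thesis .
  qed
  show "sw (dH0 H h) (\<lambda>a b. eps0 H b *\<^sub>k f a) = f (proj (car H) h)"
    "sw (dH0 H h) (\<lambda>a b. eps0 H a *\<^sub>k f b) = f (proj (car H) h)" if f: "lin f" for f h
    unfolding sw_dH0 using counit'(1) [of "\<lambda>x. f (twt H 0 0 (-1) 0 x)" h] counit'(2) [of "\<lambda>x. f (twt H 0 0 0 (-1) x)" h]
    by (simp_all add: lin_comp [OF f] lin_twt)
  show "sw (dH0 H (m0 H a b)) F = sw (dH0 H a) (\<lambda>a1 a2. sw (dH0 H b) (\<lambda>b1 b2. F (m0 H a1 b1) (m0 H a2 b2)))"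
    if F: "bilin F" for F a b
  proof -
    note lins = lin_intros bilin_lins [OF F]
    let ?c = "cdec H H (cop H)" and ?t = "twt H" and ?m = "tact H H (mul H)"
    have "sw (dH0 H (m0 H a b)) F = sw (?c (?t (-1) 0 0 0 a)) (\<lambda>a1 a2. sw (?c (?t 0 (-1) 0 0 b)) (\<lambda>b1 b2.
        F (?t 0 0 (-1) 0 (?m a1 b1)) (?t 0 0 0 (-1) (?m a2 b2))))"
      unfolding sw_dH0 m0_def by (rule cop_mul') (intro lins)
    also have "\<dots> = sw (?c a) (\<lambda>a1 a2. sw (?c (?t 0 (-1) 0 0 b)) (\<lambda>b1 b2.
        F (?t 0 0 (-1) 0 (?m (?t (-1) 0 0 0 a1) b1)) (?t 0 0 0 (-1) (?m (?t (-1) 0 0 0 a2) b2))))"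
      by (rule cop.cdec_twt) (intro lins)
    also have "\<dots> = sw (?c a) (\<lambda>a1 a2. sw (?c b) (\<lambda>b1 b2.
        F (?t 0 0 (-1) 0 (?m (?t (-1) 0 0 0 a1) (?t 0 (-1) 0 0 b1))) (?t 0 0 0 (-1) (?m (?t (-1) 0 0 0 a2) (?t 0 (-1) 0 0 b2)))))"
      by (rule sw_eqI, rule cop.cdec_twt) (intro lins)
    finally show ?thesis by (simp add: sw_dH0 m0_def)
  qed
  show "sw (dH0 H (one H)) F = F (one H) (one H)" if F: "bilin F" for F
  proof -
    have "bilin (\<lambda>x y. F (twt H 0 0 (-1) 0 x) (twt H 0 0 0 (-1) y))"
      by (intro lin_intros bilin_lins [OF F])
    then show ?thesis
      by (simp add: sw_dH0 cdec_def one_in cop_one sw_dec_tensor)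
  qed
  show "eps0 H (m0 H a b) = eps0 H a * eps0 H b" for a b
    by (simp add: m0_def eps0_cou) (simp add: tact_def cou_mul eps0_cou)
qed (simp_all add: one_in m0_def dH0_def lin_fn_eps0 eps0_def cou_one)

end

sublocale bihom_bialgebra \<subseteq> U: bialg0 "car H" "m0 H" "one H" "dH0 H" "eps0 H"
  by (rule bialg0)

text \<open>The inverse of \<alpha> \<beta>^(-1) \<omega> \<psi>^(-1) S, which is the left one of
  the two forms of the untwisted antipode.\<close>

definition T0 :: "('k::field, 'x, 'y) hopf_rec_scheme \<Rightarrow> ('k, 'x) arr \<Rightarrow> ('k, 'x) arr"
  where "T0 H h = inv_into (car H) (antip H) (twt H (-1) 1 (-1) 1 h)"

context bihom_hopf_algebra
begin

lemma antip_in: "h \<in> car H \<Longrightarrow> antip H h \<in> car H"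
  using lin_mapD(1) [OF antip_lin] .

lemma twt_antip: "h \<in> car H \<Longrightarrow> antip H (twt H a b c d h) = twt H a b c d (antip H h)"
  by (rule twt_transfer [OF twisted_space_axioms twisted_space_axioms])
     (simp_all add: antip_in antip_tw)

text \<open>The exponents are chosen so that both factors of the product carry the same
  automorphism: \<alpha>^(-1) \<omega>^(-1) in the first identity and \<beta>^(-1) \<psi>^(-1) in
  the second. It can then be taken out of the product, where the original antipode law applies, and
  it fixes the unit.\<close>

lemma antipode_untwisted:
  defines "S \<equiv> \<lambda>a b c d h. twt H a b c d (antip H (proj (car H) h))"
  shows "sw (dH0 H h) (\<lambda>a b. m0 H a (S (-1) 1 (-1) 1 b)) = eps0 H h *\<^sub>k one H"
    and "sw (dH0 H h) (\<lambda>a b. m0 H (S 1 (-1) 1 (-1) a) b) = eps0 H h *\<^sub>k one H"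
    and "lin (S a b c d)"
proof -
  have h: "proj (car H) h \<in> car H" by simp
  show lin: "lin (S a b c d)" for a b c d
    unfolding S_def using lin_map_proj [OF vspace_car antip_lin] by (intro lin_intros)
  let ?m = "tact H H (mul H)"
  have "sw (dH0 H h) (\<lambda>a b. m0 H a (S (-1) 1 (-1) 1 b))
    = sw (cdec H H (cop H) h) (\<lambda>a b. twt H (-1) 0 (-1) 0 (mul H a (antip H b)))"
    unfolding sw_dH0
    by (rule sw_cong [OF cop.cdec_in])
       (simp add: S_def m0_def twt_antip antip_in mul.tact_act)
  also have "\<dots> = twt H (-1) 0 (-1) 0 (eps0 H h *\<^sub>k one H)"
    using antip_right [OF h] by (simp add: cop.sweedler_cdec h eps0_def flip: sw_lin [OF lin_twt])
  finally show "sw (dH0 H h) (\<lambda>a b. m0 H a (S (-1) 1 (-1) 1 b)) = eps0 H h *\<^sub>k one H"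
    by (simp add: twt_scale)
  have "sw (dH0 H h) (\<lambda>a b. m0 H (S 1 (-1) 1 (-1) a) b)
    = sw (cdec H H (cop H) h) (\<lambda>a b. twt H 0 (-1) 0 (-1) (mul H (antip H a) b))"
    unfolding sw_dH0
    by (rule sw_cong [OF cop.cdec_in])
       (simp add: S_def m0_def twt_antip antip_in mul.tact_act)
  also have "\<dots> = twt H 0 (-1) 0 (-1) (eps0 H h *\<^sub>k one H)"
    using antip_left [OF h] by (simp add: cop.sweedler_cdec h eps0_def flip: sw_lin [OF lin_twt])
  finally show "sw (dH0 H h) (\<lambda>a b. m0 H (S 1 (-1) 1 (-1) a) b) = eps0 H h *\<^sub>k one H"
    by (simp add: twt_scale)
qed

lemma T0:
  assumes bij: "bij_betw (antip H) (car H) (car H)"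
  shows "sw (dH0 H h) (\<lambda>a b. m0 H b (T0 H a)) = eps0 H h *\<^sub>k one H"
    and "sw (dH0 H h) (\<lambda>a b. m0 H (T0 H b) a) = eps0 H h *\<^sub>k one H"
    and "lin (T0 H)" and "T0 H h \<in> car H"
    and "h \<in> car H \<Longrightarrow> inv_into (car H) (antip H) (twt H a b c d h) = T0 H (twt H (a + 1) (b - 1) (c + 1) (d - 1) h)"
    and "h \<in> car H \<Longrightarrow> twt H a b c d (T0 H h) = T0 H (twt H a b c d h)"
proof -
  define S S' where "S = (\<lambda>h. twt H (-1) 1 (-1) 1 (antip H (proj (car H) h)))"
    and "S' = (\<lambda>h. twt H 1 (-1) 1 (-1) (antip H (proj (car H) h)))"
  let ?I = "inv_into (car H) (antip H)"
  have I: "?I x \<in> car H" "antip H (?I x) = x" if "x \<in> car H" for x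
    using that bij inv_into_into [of x "antip H" "car H"] f_inv_into_f [of x "antip H" "car H"]
    by (auto simp: bij_betw_def)
  have I': "?I (antip H x) = x" if "x \<in> car H" for x
    using that bij by (simp add: bij_betw_def inv_into_f_f)
  have SS: "S' h = S h" for h
    by (rule U.convolution_inverse_unique [where S = S and S' = S'])
       (use antipode_untwisted in \<open>simp_all add: S_def S'_def\<close>)
  have "S = S'" using SS by auto
  have S': "lin S'" "S' h \<in> car H" "S' (proj (car H) h) = S' h" for h
    using antipode_untwisted(3) by (simp_all add: S'_def)
  have R: "sw (dH0 H h) (\<lambda>a b. m0 H a (S' b)) = eps0 H h *\<^sub>k one H" for h
    unfolding \<open>S = S'\<close> [symmetric] S_def by (rule antipode_untwisted)
  have L: "sw (dH0 H h) (\<lambda>a b. m0 H (S' a) b) = eps0 H h *\<^sub>k one H" for h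
    unfolding S'_def by (rule antipode_untwisted)
  have inverse: "h \<in> car H \<Longrightarrow> T0 H (S' h) = h" "S' (T0 H h) = proj (car H) h" for h
    by (simp_all add: S'_def T0_def I I' antip_in)
  show "sw (dH0 H h) (\<lambda>a b. m0 H b (T0 H a)) = eps0 H h *\<^sub>k one H"
    by (rule U.antipode_inverse(1) [OF S' R L inverse])
  show "sw (dH0 H h) (\<lambda>a b. m0 H (T0 H b) a) = eps0 H h *\<^sub>k one H"
    by (rule U.antipode_inverse(2) [OF S' R L inverse])
  \<comment> \<open>Linearity of the inverse, and its commutation with the automorphisms, are
    verified after applying the injective antipode.\<close>
  have inj: "x = y" if "antip H x = antip H y" "x \<in> car H" "y \<in> car H" for x y
    using bij that by (auto simp: bij_betw_def inj_on_def)
  note sub = arr.subspace_add [OF vspace_subspace [OF vspace_car]]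
    arr.subspace_scale [OF vspace_subspace [OF vspace_car]]
  show T_in: "T0 H h \<in> car H" for h by (simp add: T0_def I)
  show "lin (T0 H)"
    unfolding lin_def
  proof (intro conjI allI)
    show "T0 H (x + y) = T0 H x + T0 H y" for x y
      by (rule inj) (simp_all add: T_in sub lin_mapD(2) [OF antip_lin], simp add: T0_def I lin_add [OF lin_twt] sub)
    show "T0 H (r *\<^sub>k x) = r *\<^sub>k T0 H x" for r x
      by (rule inj) (simp_all add: T_in sub lin_mapD(3) [OF antip_lin], simp add: T0_def I twt_scale sub)
  qed
  show "?I (twt H a b c d h) = T0 H (twt H (a + 1) (b - 1) (c + 1) (d - 1) h)"
    by (simp add: T0_def)
  show "twt H a b c d (T0 H h) = T0 H (twt H a b c d h)" if "h \<in> car H"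
    by (rule inj) (simp_all add: T_in twt_antip, simp add: T0_def I algebra_simps)
qed

end

subsection \<open>The untwisted Yetter-Drinfel'd modules\<close>

definition a0 :: "('k::field, 'x, 'y) bialg_rec_scheme \<Rightarrow> ('k, 'x, 'z) yd_rec_scheme
    \<Rightarrow> ('k, 'x) arr \<Rightarrow> ('k, 'x) arr \<Rightarrow> ('k, 'x) arr"
  where "a0 H V v h = tact V H (act V) (twt V (-1) 0 0 0 v) (twt H 0 (-1) 0 0 h)"

text \<open>Twisting the coaction by \<open>\<alpha>\<^bsup>1-m\<^esup> \<beta>\<^bsup>1-n\<^esup> \<omega>\<^bsup>1-p\<^esup> \<psi>\<^bsup>-q\<^esup>\<close> makes the compatibility condition
  independent of \<open>m\<close>, \<open>n\<close>, \<open>p\<close>, \<open>q\<close>.\<close>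

definition d0 :: "('k::field, 'x, 'y) bialg_rec_scheme \<Rightarrow> int \<Rightarrow> int \<Rightarrow> int \<Rightarrow> int
    \<Rightarrow> ('k, 'x, 'z) yd_rec_scheme \<Rightarrow> ('k, 'x) arr \<Rightarrow> (('k, 'x) arr \<times> ('k, 'x) arr) list"
  where "d0 H m n p q V v =
    map (\<lambda>(x, y). (twt V 0 0 (-1) 0 x, twt H (1 - m) (1 - n) (1 - p) (- q) y)) (cdec V H (coact V) v)"

lemma sw_d0: "sw (d0 H m n p q V v) F
    = sw (cdec V H (coact V) v) (\<lambda>x y. F (twt V 0 0 (-1) 0 x) (twt H (1 - m) (1 - n) (1 - p) (- q) y))"
  unfolding d0_def by (rule sw_map)

text \<open>The summands are required to lie in \<open>V\<close> and \<open>W\<close> for all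
  arguments, not just for the legs of a decomposition. No bounds on \<open>ps\<close> and
  \<open>Q\<close> are then required; where necessary, the summands contain projections to ensure
  this.\<close>

lemma sw_dec_sw2:
  assumes "vspace V" "vspace W" "bilin F" "\<And>a b c d. f a b c d \<in> V" "\<And>a b c d. g a b c d \<in> W"
  shows "sw ps (\<lambda>a b. sw (Q a b) (\<lambda>c d. f a b c d \<otimes> g a b c d)) \<in> V \<otimes>\<^sub>S W"
    and "sw (dec V W (sw ps (\<lambda>a b. sw (Q a b) (\<lambda>c d. f a b c d \<otimes> g a b c d)))) F
      = sw ps (\<lambda>a b. sw (Q a b) (\<lambda>c d. F (f a b c d) (g a b c d)))"
proof -
  have VW: "arr.subspace (V \<otimes>\<^sub>S W)"
    by (intro vspace_subspace vspace_tensor_space assms)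
  have in1: "sw (Q a b) (\<lambda>c d. f a b c d \<otimes> g a b c d) \<in> V \<otimes>\<^sub>S W" for a b
    by (rule sw_in [OF VW, where V = UNIV and W = UNIV]) (simp_all add: assms)
  show "sw ps (\<lambda>a b. sw (Q a b) (\<lambda>c d. f a b c d \<otimes> g a b c d)) \<in> V \<otimes>\<^sub>S W"
    by (rule sw_in [OF VW, where V = UNIV and W = UNIV]) (simp_all add: in1)
  have 1: "sw (dec V W (sw (Q a b) (\<lambda>c d. f a b c d \<otimes> g a b c d))) F = sw (Q a b) (\<lambda>c d. F (f a b c d) (g a b c d))" for a b
    using sw_dec_sw [OF assms(1-3), of "Q a b" UNIV UNIV "\<lambda>c d. f a b c d \<otimes> g a b c d"] assms
    by (simp add: sw_dec_tensor)
  show "sw (dec V W (sw ps (\<lambda>a b. sw (Q a b) (\<lambda>c d. f a b c d \<otimes> g a b c d)))) F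
      = sw ps (\<lambda>a b. sw (Q a b) (\<lambda>c d. F (f a b c d) (g a b c d)))"
    using sw_dec_sw [OF assms(1-3), of ps UNIV UNIV "\<lambda>a b. sw (Q a b) (\<lambda>c d. f a b c d \<otimes> g a b c d)"] in1
    by (simp add: 1)
qed

section \<open>Translation of the module, comodule and compatibility laws\<close>

text \<open>Linearity and equivariance suffice to form the untwisted action and coaction. The
  remaining laws are left out so that each can be shown equivalent to its untwisted form.\<close>

locale yd_data = H: bihom_bialgebra H + V: twisted_space V
  for H :: "('k::field, 'x, 'y) bialg_rec_scheme" and V :: "('k, 'x, 'z) yd_rec_scheme" +
  assumes act_bilin: "act V \<in> bilin_map (car V) (car H) (car V)"
    and act_tw: "\<lbrakk>v \<in> car V; h \<in> car H\<rbrakk> \<Longrightarrow> tw V \<theta> (act V v h) = act V (tw V \<theta> v) (tw H \<theta> h)"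
    and coact_lin: "coact V \<in> lin_map (car V) (car V \<otimes>\<^sub>S car H)"
    and coact_tw: "v \<in> car V \<Longrightarrow> coact V (tw V \<theta> v)
      = sweedler (car V) (car H) (coact V v) (\<lambda>v0 v1. tw V \<theta> v0 \<otimes> tw H \<theta> v1)"
begin

sublocale act: twisted_action V H "act V"
  by unfold_locales (simp_all add: act_bilin act_tw)

sublocale co: twisted_comodule V H "coact V" "cop H"
  by unfold_locales (simp_all add: coact_lin coact_tw)

abbreviation "cV \<equiv> cdec V H (coact V)"
abbreviation "cH \<equiv> cdec H H (cop H)"
abbreviation "tV \<equiv> tact V H (act V)"
abbreviation "tH \<equiv> tact H H (mul H)"

lemma bilin_a0: "bilin (a0 H V)"
  unfolding a0_def by (intro lin_intros)

lemma twt_a0: "twt V a b c d (a0 H V v h) = a0 H V (twt V a b c d v) (twt H a b c d h)"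
  by (simp add: a0_def algebra_simps)

lemma d0_in: "set (d0 H m n p q V v) \<subseteq> car V \<times> car H"
  by (auto simp: d0_def)

lemma lin_d0:
  assumes "bilin F"
  shows "lin (\<lambda>v. sw (d0 H m n p q V v) F)"
  unfolding sw_d0 by (intro lin_intros bilin_lins [OF assms])

lemma d0_twt:
  assumes "bilin F"
  shows "sw (d0 H m n p q V (twt V a b c d v)) F
    = sw (d0 H m n p q V v) (\<lambda>x y. F (twt V a b c d x) (twt H a b c d y))"
  unfolding sw_d0
  by (subst co.cdec_twt, intro lin_intros bilin_lins [OF assms]) (simp add: algebra_simps)

lemma act_mul_iff:
  "(\<forall>v\<in>car V. \<forall>h\<in>car H. \<forall>g\<in>car H. act V (act V v h) (tw H Beta g) = act V (tw V Alpha v) (mul H h g))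
    \<longleftrightarrow> (\<forall>v h g. a0 H V (a0 H V v h) g = a0 H V v (m0 H h g))" (is "?l \<longleftrightarrow> ?r")
proof
  note simps = a0_def m0_def act.tact_act act.act_in H.mul.tact_act H.mul.act_in V.tw_twt H.tw_twt V.vspace_car H.vspace_car
  show ?r if l: ?l
  proof (intro allI)
    fix v h g
    show "a0 H V (a0 H V v h) g = a0 H V v (m0 H h g)"
      \<comment> \<open>These are the twists that two nested occurrences of \<open>a0\<close> put on
        v, h and g; g receives a further \<beta>^(-1), because the law itself applies \<beta> to
        it.\<close>
      using l [rule_format, of "twt V (-2) 0 0 0 v" "twt H (-1) (-1) 0 0 h" "twt H 0 (-2) 0 0 g"]
      by (simp add: simps)
  qed
  show ?l if r: ?r
  proof (intro ballI)
    fix v h g assume "v \<in> car V" "h \<in> car H" "g \<in> car H"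
    then show "act V (act V v h) (tw H Beta g) = act V (tw V Alpha v) (mul H h g)"
      using r [rule_format, of "twt V 2 0 0 0 v" "twt H 1 1 0 0 h" "twt H 0 2 0 0 g"]
      by (simp add: simps)
  qed
qed

lemma act_one_iff:
  "(\<forall>v\<in>car V. act V v (one H) = tw V Alpha v) \<longleftrightarrow> (\<forall>v. a0 H V v (one H) = proj (car V) v)" (is "?l \<longleftrightarrow> ?r")
proof
  note simps = a0_def act.tact_act V.tw_twt V.vspace_car H.one_in
  show ?r if l: ?l
  proof
    show "a0 H V v (one H) = proj (car V) v" for v
      using l [rule_format, of "twt V (-1) 0 0 0 v"] by (simp add: simps)
  qed
  show ?l if r: ?r
  proof
    show "act V v (one H) = tw V Alpha v" if "v \<in> car V" for v
      using r [rule_format, of "twt V 1 0 0 0 v"] that by (simp add: simps)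
  qed
qed

lemma d0_dH0:
  assumes G: "trilin G"
  shows "sw (d0 H m n p q V v) (\<lambda>x y. sw (dH0 H y) (\<lambda>z w. G x z w))
    = sw (cV v) (\<lambda>x y. sw (cH y) (\<lambda>z w. G (twt V 0 0 (-1) 0 x)
        (twt H (1 - m) (1 - n) (- p) (- q) z) (twt H (1 - m) (1 - n) (1 - p) (- 1 - q) w)))"
  and "sw (d0 H m n p q V v) (\<lambda>x y. sw (d0 H m n p q V x) (\<lambda>z w. G z w y))
    = sw (cV v) (\<lambda>x y. sw (cV x) (\<lambda>z w. G (twt V 0 0 (-2) 0 z)
        (twt H (1 - m) (1 - n) (- p) (- q) w) (twt H (1 - m) (1 - n) (1 - p) (- q) y)))"
  unfolding sw_d0 sw_dH0
  by (rule sw_eqI, subst H.cop.cdec_twt, intro lin_intros trilin_lins [OF G], simp)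
     (rule sw_eqI, subst co.cdec_twt, intro lin_intros trilin_lins [OF G], simp)

text \<open>The two laws differ only by automorphisms inserted into the trilinear test map, and
  these can be undone. No condition on the twist of the second leg arises.\<close>

lemma coact_coassoc_iff:
  "(\<forall>v\<in>car V. sweedler (car V) (car H) (coact V v) (\<lambda>v0 v1. tw V Omega v0 \<otimes> cop H v1)
        = sweedler (car V) (car H) (coact V v) (\<lambda>v0 v1. coact V v0 \<otimes> tw H Psi v1))
    \<longleftrightarrow> (\<forall>v G. trilin G \<longrightarrow> sw (d0 H m n p q V v) (\<lambda>x y. sw (dH0 H y) (\<lambda>z w. G x z w))
      = sw (d0 H m n p q V v) (\<lambda>x y. sw (d0 H m n p q V x) (\<lambda>z w. G z w y)))" (is "?l \<longleftrightarrow> ?r")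
proof -
  define A where "A v G \<longleftrightarrow> sw (cV v) (\<lambda>x y. sw (cH y) (\<lambda>z w. G (twt V 0 0 1 0 x) z w))
      = sw (cV v) (\<lambda>x y. sw (cV x) (\<lambda>z w. G z w (twt H 0 0 0 1 y)))"
    for v and G :: "('k, 'x) arr \<Rightarrow> ('k, 'x) arr \<Rightarrow> ('k, 'x) arr \<Rightarrow> ('k, 'x) arr"
  have l: "?l \<longleftrightarrow> (\<forall>v\<in>car V. \<forall>G. trilin G \<longrightarrow> A v G)"
    using co.twisted_coassoc_iff by (simp add: A_def)
  have AB: "A v (\<lambda>x z w. G (twt V 0 0 (-2) 0 x) (twt H (1 - m) (1 - n) (- p) (- q) z) (twt H (1 - m) (1 - n) (1 - p) (- 1 - q) w))
    \<longleftrightarrow> sw (d0 H m n p q V v) (\<lambda>x y. sw (dH0 H y) (\<lambda>z w. G x z w))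
      = sw (d0 H m n p q V v) (\<lambda>x y. sw (d0 H m n p q V x) (\<lambda>z w. G z w y))" if "trilin G" for v G
    unfolding d0_dH0 [OF that] A_def by simp
  show ?thesis
  proof
    assume ?l
    show ?r
    proof (intro allI impI)
      fix v G assume G: "trilin (G :: ('k, 'x) arr \<Rightarrow> ('k, 'x) arr \<Rightarrow> ('k, 'x) arr \<Rightarrow> ('k, 'x) arr)"
      have "trilin (\<lambda>x z w. G (twt V 0 0 (-2) 0 x) (twt H (1 - m) (1 - n) (- p) (- q) z) (twt H (1 - m) (1 - n) (1 - p) (- 1 - q) w))"
        by (intro lin_intros trilin_lins [OF G])
      then have "A (proj (car V) v) (\<lambda>x z w. G (twt V 0 0 (-2) 0 x) (twt H (1 - m) (1 - n) (- p) (- q) z) (twt H (1 - m) (1 - n) (1 - p) (- 1 - q) w))"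
        using \<open>?l\<close> unfolding l by simp
      then show "sw (d0 H m n p q V v) (\<lambda>x y. sw (dH0 H y) (\<lambda>z w. G x z w))
        = sw (d0 H m n p q V v) (\<lambda>x y. sw (d0 H m n p q V x) (\<lambda>z w. G z w y))"
        unfolding AB [OF G, symmetric] by (simp add: A_def)
    qed
  next
    assume r: ?r
    show ?l
      unfolding l
    proof (intro ballI allI impI)
      fix v G assume G: "trilin (G :: ('k, 'x) arr \<Rightarrow> ('k, 'x) arr \<Rightarrow> ('k, 'x) arr \<Rightarrow> ('k, 'x) arr)"
      \<comment> \<open>The exponents are the negatives of those in \<open>AB\<close>, so that only
        projections are left around the arguments of \<open>G\<close>.\<close>
      define G' where "G' = (\<lambda>x z w. G (twt V 0 0 2 0 x) (twt H (m - 1) (n - 1) p q z) (twt H (m - 1) (n - 1) (p - 1) (q + 1) w))"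
      have "trilin G'"
        unfolding G'_def by (intro lin_intros trilin_lins [OF G])
      from AB [OF this, of v] r this
      have "A v (\<lambda>x z w. G (proj (car V) x) (proj (car H) z) (proj (car H) w))"
        by (simp add: G'_def)
      moreover have "sw (cV v) (\<lambda>x y. sw (cH y) (\<lambda>z w. G (twt V 0 0 1 0 x) (proj (car H) z) (proj (car H) w)))
        = sw (cV v) (\<lambda>x y. sw (cH y) (\<lambda>z w. G (twt V 0 0 1 0 x) z w))"
        by (rule sw_eqI, rule H.cop.sw_cdec_proj)
      moreover have "sw (cV v) (\<lambda>x y. sw (cV x) (\<lambda>z w. G (proj (car V) z) (proj (car H) w) (twt H 0 0 0 1 y)))
        = sw (cV v) (\<lambda>x y. sw (cV x) (\<lambda>z w. G z w (twt H 0 0 0 1 y)))"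
        by (rule sw_eqI, rule co.sw_cdec_proj)
      ultimately show "A v G" by (simp add: A_def)
    qed
  qed
qed

lemma coact_cou_iff:
  "(\<forall>v\<in>car V. sweedler (car V) (car H) (coact V v) (\<lambda>v0 v1. cou H v1 *\<^sub>k v0) = tw V Omega v)
    \<longleftrightarrow> (\<forall>v f. lin f \<longrightarrow> sw (d0 H m n p q V v) (\<lambda>x y. eps0 H y *\<^sub>k f x) = f (proj (car V) v))" (is "?l \<longleftrightarrow> ?r")
proof -
  have eq: "sweedler (car V) (car H) (coact V v) (\<lambda>v0 v1. cou H v1 *\<^sub>k v0)
    = sw (cV v) (\<lambda>x y. eps0 H y *\<^sub>k x)" if "v \<in> car V" for v
    unfolding co.sweedler_cdec [OF that]
    by (rule sw_cong [OF co.cdec_in]) (simp add: H.eps0_cou)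
  show ?thesis
  proof
    assume l: ?l
    show ?r
    proof (intro allI impI)
      fix v f assume f: "lin (f :: ('k, 'x) arr \<Rightarrow> ('k, 'x) arr)"
      note f' = lin_comp [OF f V.lin_twt]
      have "sw (cV (proj (car V) v)) (\<lambda>x y. eps0 H y *\<^sub>k x) = twt V 0 0 1 0 v"
        using l [rule_format, of "proj (car V) v"] eq [of "proj (car V) v"]
        by (simp add: V.tw_twt)
      then have "f (twt V 0 0 (-1) 0 (sw (cV v) (\<lambda>x y. eps0 H y *\<^sub>k x))) = f (proj (car V) v)"
        by simp
      then show "sw (d0 H m n p q V v) (\<lambda>x y. eps0 H y *\<^sub>k f x) = f (proj (car V) v)"
        unfolding sw_lin [OF f'] lin_scale [OF f'] by (simp add: sw_d0)
    qed
  next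
    assume r: ?r
    show ?l
    proof
      fix v assume v: "v \<in> car V"
      have "sw (cV v) (\<lambda>x y. eps0 H y *\<^sub>k proj (car V) x) = twt V 0 0 1 0 v"
        using r [rule_format, OF V.lin_twt [of 0 0 1 0], of v] by (simp add: sw_d0)
      moreover have "sw (cV v) (\<lambda>x y. eps0 H y *\<^sub>k proj (car V) x) = sw (cV v) (\<lambda>x y. eps0 H y *\<^sub>k x)"
        by (rule sw_cong [OF co.cdec_in]) simp
      ultimately show "sweedler (car V) (car H) (coact V v) (\<lambda>v0 v1. cou H v1 *\<^sub>k v0) = tw V Omega v"
        using eq v by (simp add: V.tw_twt)
    qed
  qed
qed

text \<open>Testing both sides with bilinear maps makes the twists movable: those in the second
  tensor factor go into the test map, the others are absorbed by substitutions in h and v.\<close>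

lemma yd_iff:
  "(\<forall>h\<in>car H. \<forall>v\<in>car V. sweedler (car H) (car H) (cop H h) (\<lambda>h1 h2.
          sweedler (car V) (car H) (coact V (act V v h2)) (\<lambda>x0 x1.
            x0 \<otimes> mul H (twp H (m - 2) (n + 1) (p - 2) (q + 1) h1) x1))
      = sweedler (car V) (car H) (coact V v) (\<lambda>v0 v1.
          sweedler (car H) (car H) (cop H h) (\<lambda>h1 h2.
            act V v0 (tw H Psi h1) \<otimes> mul H (tw H Beta v1) (twp H (m - 1) n (p - 1) q h2))))
    \<longleftrightarrow> (\<forall>h v F. bilin F \<longrightarrow>
      sw (dH0 H h) (\<lambda>g1 g2. sw (d0 H m n p q V (a0 H V v g2)) (\<lambda>x y. F x (m0 H g1 y)))
      = sw (d0 H m n p q V v) (\<lambda>x y. sw (dH0 H h) (\<lambda>g1 g2. F (a0 H V x g1) (m0 H y g2))))"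
  (is "(\<forall>h\<in>_. \<forall>v\<in>_. ?L h v = ?R h v) \<longleftrightarrow> (\<forall>h v F. _ \<longrightarrow> ?Lo h v F = ?Ro h v F)")
proof -
  \<comment> \<open>\<open>L\<close> and \<open>R\<close> are the two sides of the original
    condition with the outer tensor replaced by a test map \<open>F\<close>; choosing
    \<open>\<otimes>\<close> for \<open>F\<close> gives back the sides themselves.\<close>
  define L where "L h v F = sw (cH h) (\<lambda>h1 h2. sw (cV (tV v h2)) (\<lambda>x0 x1.
      F (proj (car V) x0) (tH (twt H (m - 2) (n + 1) (p - 2) (q + 1) h1) x1)))"
    for h v and F :: "('k, 'x) arr \<Rightarrow> ('k, 'x) arr \<Rightarrow> ('k, 'x) arr"
  define R where "R h v F = sw (cV v) (\<lambda>v0 v1. sw (cH h) (\<lambda>h1 h2.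
      F (tV v0 (twt H 0 0 0 1 h1)) (tH (twt H 0 1 0 0 v1) (twt H (m - 1) n (p - 1) q h2))))"
    for h v and F :: "('k, 'x) arr \<Rightarrow> ('k, 'x) arr \<Rightarrow> ('k, 'x) arr"
  note simps = V.vspace_car H.vspace_car
  have L: "?L h v = L h v (\<otimes>)" and R: "?R h v = R h v (\<otimes>)" if "h \<in> car H" "v \<in> car V" for h v
    unfolding L_def R_def H.cop.sweedler_cdec [OF that(1)] co.sweedler_cdec [OF that(2)]
    by (intro sw_cong [OF H.cop.cdec_in] sw_cong [OF co.cdec_in],
        simp add: that co.sweedler_cdec act.act_in act.tact_act,
        intro sw_cong [OF co.cdec_in], simp add: simps H.twp_twt H.mul.tact_act,
        intro sw_cong [OF H.cop.cdec_in] sw_cong [OF co.cdec_in],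
        simp add: H.twp_twt H.mul.tact_act act.tact_act H.tw_twt)
  have dec_L: "sw (dec (car V) (car H) (L h v (\<otimes>))) F = L h v F"
    and dec_R: "sw (dec (car V) (car H) (R h v (\<otimes>))) F = R h v F" if "bilin F" for h v F
    unfolding L_def R_def by (rule sw_dec_sw2(2) [OF _ _ that]; simp add: simps)+
  have LR: "?L h v = ?R h v \<longleftrightarrow> (\<forall>F. bilin F \<longrightarrow> L h v F = R h v F)" if "h \<in> car H" "v \<in> car V" for h v
    using L [OF that] R [OF that] dec_L dec_R bilin_tensor by metis
  \<comment> \<open>The argument h loses \<beta> \<psi> and v loses \<alpha>. In the test map,
    \<omega>^(-1) is the twist of the first leg of \<open>d0\<close>, and the second twist is that
    of the second leg of \<open>d0\<close> followed by the \<beta>^(-1) that \<open>m0\<close> puts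
    on its right factor.\<close>
  have L0: "?Lo h v F = L (twt H 0 (-1) 0 (-1) h) (twt V (-1) 0 0 0 v)
      (\<lambda>x y. F (twt V 0 0 (-1) 0 x) (twt H (1 - m) (- n) (1 - p) (- q) y))"
    and R0: "?Ro h v F = R (twt H 0 (-1) 0 (-1) h) (twt V (-1) 0 0 0 v)
      (\<lambda>x y. F (twt V 0 0 (-1) 0 x) (twt H (1 - m) (- n) (1 - p) (- q) y))"
    if F: "bilin F" for h v F
  proof -
    note lins = lin_intros bilin_lins [OF F] V.vspace_car H.vspace_car
    show "?Lo h v F = L (twt H 0 (-1) 0 (-1) h) (twt V (-1) 0 0 0 v)
      (\<lambda>x y. F (twt V 0 0 (-1) 0 x) (twt H (1 - m) (- n) (1 - p) (- q) y))"
      unfolding L_def sw_dH0 sw_d0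
      by (subst H.cop.cdec_twt, intro lins) (simp add: a0_def m0_def)
    have "R (twt H 0 (-1) 0 (-1) h) (twt V (-1) 0 0 0 v)
      (\<lambda>x y. F (twt V 0 0 (-1) 0 x) (twt H (1 - m) (- n) (1 - p) (- q) y))
      = sw (cV v) (\<lambda>v0 v1. sw (cH (twt H 0 (-1) 0 (-1) h)) (\<lambda>h1 h2.
        F (tV (twt V (-1) 0 (-1) 0 v0) (twt H 0 0 (-1) 1 h1))
          (tH (twt H (- m) (1 - n) (1 - p) (- q) v1) (twt H 0 0 0 0 h2))))"
      unfolding R_def by (subst co.cdec_twt, intro lins) simp
    also have "\<dots> = ?Ro h v F"
      unfolding sw_dH0 sw_d0
      by (rule sw_eqI, subst H.cop.cdec_twt, intro lins) (simp add: a0_def m0_def)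
    finally show "?Ro h v F = R (twt H 0 (-1) 0 (-1) h) (twt V (-1) 0 0 0 v)
      (\<lambda>x y. F (twt V 0 0 (-1) 0 x) (twt H (1 - m) (- n) (1 - p) (- q) y))" ..
  qed
  show ?thesis
  proof
    assume l: "\<forall>h\<in>car H. \<forall>v\<in>car V. ?L h v = ?R h v"
    show "\<forall>h v F. bilin F \<longrightarrow> ?Lo h v F = ?Ro h v F"
    proof (intro allI impI)
      fix h v F assume F: "bilin (F :: ('k, 'x) arr \<Rightarrow> ('k, 'x) arr \<Rightarrow> ('k, 'x) arr)"
      have "bilin (\<lambda>x y. F (twt V 0 0 (-1) 0 x) (twt H (1 - m) (- n) (1 - p) (- q) y))"
        by (intro lin_intros bilin_lins [OF F])
      then show "?Lo h v F = ?Ro h v F"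
        unfolding L0 [OF F] R0 [OF F] using l LR by simp
    qed
  next
    assume r: "\<forall>h v F. bilin F \<longrightarrow> ?Lo h v F = ?Ro h v F"
    show "\<forall>h\<in>car H. \<forall>v\<in>car V. ?L h v = ?R h v"
    proof (intro ballI)
      fix h v assume hv: "h \<in> car H" "v \<in> car V"
      \<comment> \<open>The twists are inverse to those that \<open>L0\<close> and \<open>R0\<close>
        put into the test map, so just the tensor of two projections remains.\<close>
      define F where "F = (\<lambda>x y. twt V 0 0 1 0 x \<otimes> twt H (m - 1) n (p - 1) q y)"
      have F: "bilin F" unfolding F_def by (intro lin_intros)
      have "?Lo (twt H 0 1 0 1 h) (twt V 1 0 0 0 v) F = ?Ro (twt H 0 1 0 1 h) (twt V 1 0 0 0 v) F"
        using r F by blast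
      then have "L h v (\<lambda>x y. proj (car V) x \<otimes> proj (car H) y) = R h v (\<lambda>x y. proj (car V) x \<otimes> proj (car H) y)"
        unfolding L0 [OF F] R0 [OF F] by (simp add: F_def hv simps)
      then show "?L h v = ?R h v"
        unfolding L [OF hv] R [OF hv] by (simp add: L_def R_def simps)
    qed
  qed
qed

text \<open>The forward direction gives access to the classical computations; the backward direction
  brings the tensor product and the unit object back to the original axioms.\<close>

lemma yetter_drinfeld_iff:
  "yetter_drinfeld H V m n p q
    \<longleftrightarrow> yd0 (car H) (m0 H) (one H) (dH0 H) (eps0 H) (car V) (a0 H V) (d0 H m n p q V)" (is "?l \<longleftrightarrow> ?r")
proof
  assume ?l
  then interpret Y: yetter_drinfeld H V m n p q .
  show ?r
  proof
    show "a0 H V (a0 H V v h) g = a0 H V v (m0 H h g)" for v h g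
      using act_mul_iff Y.act_mul by blast
    show "a0 H V v (one H) = proj (car V) v" for v
      using act_one_iff Y.act_one by blast
    show "sw (d0 H m n p q V v) (\<lambda>x y. sw (dH0 H y) (\<lambda>z w. G x z w))
      = sw (d0 H m n p q V v) (\<lambda>x y. sw (d0 H m n p q V x) (\<lambda>z w. G z w y))" if "trilin G" for G v
      using coact_coassoc_iff Y.coact_coassoc that by blast
    show "sw (d0 H m n p q V v) (\<lambda>x y. eps0 H y *\<^sub>k f x) = f (proj (car V) v)" if "lin f" for f v
      using coact_cou_iff Y.coact_cou that by blast
    show "sw (dH0 H h) (\<lambda>g1 g2. sw (d0 H m n p q V (a0 H V v g2)) (\<lambda>x y. F x (m0 H g1 y)))
      = sw (d0 H m n p q V v) (\<lambda>x y. sw (dH0 H h) (\<lambda>g1 g2. F (a0 H V x g1) (m0 H y g2)))"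
      if "bilin F" for F h v
      using yd_iff Y.yd that by blast
  qed (simp_all add: bilin_a0 d0_in lin_d0, simp_all add: a0_def d0_def)
next
  assume ?r
  then interpret Y: yd0 "car H" "m0 H" "one H" "dH0 H" "eps0 H" "car V" "a0 H V" "d0 H m n p q V" .
  show ?l
  proof
    show "act V (act V v h) (tw H Beta g) = act V (tw V Alpha v) (mul H h g)"
      if "v \<in> car V" "h \<in> car H" "g \<in> car H" for v h g
      using act_mul_iff Y.a_a that by blast
    show "act V v (one H) = tw V Alpha v" if "v \<in> car V" for v
      using act_one_iff Y.a_e that by blast
    show "sweedler (car V) (car H) (coact V v) (\<lambda>v0 v1. tw V Omega v0 \<otimes> cop H v1)
        = sweedler (car V) (car H) (coact V v) (\<lambda>v0 v1. coact V v0 \<otimes> tw H Psi v1)" if "v \<in> car V" for v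
      using coact_coassoc_iff [of m n p q] Y.d_coassoc that by blast
    show "sweedler (car V) (car H) (coact V v) (\<lambda>v0 v1. cou H v1 *\<^sub>k v0) = tw V Omega v" if "v \<in> car V" for v
      using coact_cou_iff [of m n p q] Y.d_counit that by blast
    show "sweedler (car H) (car H) (cop H h) (\<lambda>h1 h2.
          sweedler (car V) (car H) (coact V (act V v h2)) (\<lambda>x0 x1.
            x0 \<otimes> mul H (twp H (m - 2) (n + 1) (p - 2) (q + 1) h1) x1))
      = sweedler (car V) (car H) (coact V v) (\<lambda>v0 v1.
          sweedler (car H) (car H) (cop H h) (\<lambda>h1 h2.
            act V v0 (tw H Psi h1) \<otimes> mul H (tw H Beta v1) (twp H (m - 1) n (p - 1) q h2)))"
      if "h \<in> car H" "v \<in> car V" for h v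
      using yd_iff [of m n p q] Y.yd that by blast
  qed (simp_all add: act_bilin act_tw coact_lin coact_tw)
qed

end

section \<open>Tensor products of Yetter-Drinfel'd modules\<close>

locale yd_mod = yd_data H V
  for H :: "('k::field, 'x, 'y) bialg_rec_scheme" and V :: "('k, 'x) yd_rec" and m n p q :: int +
  assumes yetter_drinfeld: "yetter_drinfeld H V m n p q"

sublocale yd_mod \<subseteq> U: yd0 "car H" "m0 H" "one H" "dH0 H" "eps0 H" "car V" "a0 H V" "d0 H m n p q V"
  using yetter_drinfeld yetter_drinfeld_iff by blast

abbreviation (in yd_mod) "d \<equiv> d0 H m n p q V"

lemma (in bihom_bialgebra) YD_iff: "V \<in> YD H m n p q \<longleftrightarrow> yd_mod H V m n p q"
proof
  assume "V \<in> YD H m n p q"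
  then interpret Y: yetter_drinfeld H V m n p q by (simp add: YD_def)
  show "yd_mod H V m n p q"
    by unfold_locales (simp_all add: Y.act_bilin Y.act_tw Y.coact_lin Y.coact_tw)
qed (simp add: YD_def yd_mod.yetter_drinfeld)

locale yd_pair = V: yd_mod H V m n p q + W: yd_mod H W m n p q
  for H :: "('k::field, 'x, 'y) bialg_rec_scheme" and V W m n p q
begin

abbreviation "X \<equiv> YD_tensor H V W"
abbreviation "dX \<equiv> d0 H m n p q X"

sublocale T: tensor_twisted V W X
  by unfold_locales (simp_all add: YD_tensor_def)

sublocale P: yd0_pair "car H" "m0 H" "one H" "dH0 H" "eps0 H"
    "car V" "a0 H V" "V.d" "car W" "a0 H W" "W.d"
  by unfold_locales

text \<open>The argument h comes first so that \<open>tensor_act h\<close> is itself a bilinear test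
  map.\<close>

definition tensor_act :: "('k, 'x) arr \<Rightarrow> ('k, 'x) arr \<Rightarrow> ('k, 'x) arr \<Rightarrow> ('k, 'x) arr"
  where "tensor_act h v w = sw (V.cH h) (\<lambda>x y. V.tV v (twt H 0 0 (-1) 0 x) \<otimes> W.tV w (twt H 0 0 0 (-1) y))"

definition tensor_coact :: "('k, 'x) arr \<Rightarrow> ('k, 'x) arr \<Rightarrow> ('k, 'x) arr"
  where "tensor_coact v w = sw (V.cV v) (\<lambda>v0 v1. sw (W.cV w) (\<lambda>w0 w1.
    (proj (car V) v0 \<otimes> proj (car W) w0) \<otimes> V.tH (twt H (-1) 0 0 0 v1) (twt H 0 (-1) 0 0 w1)))"

lemma trilin_tensor_act: "trilin tensor_act"
  unfolding tensor_act_def by (intro lin_intros)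

lemma bilin_tensor_coact: "bilin tensor_coact"
  unfolding tensor_coact_def by (intro lin_intros V.V.vspace_car W.V.vspace_car)

lemma tensor_in_X: "v \<in> car V \<Longrightarrow> w \<in> car W \<Longrightarrow> v \<otimes> w \<in> car X"
  by (simp add: T.car_X)

lemma tensor_act_in: "tensor_act h v w \<in> car X"
  unfolding tensor_act_def by (rule sw_in [OF vspace_subspace [OF T.vspace_X], where V = UNIV and W = UNIV])
    (simp_all add: tensor_in_X)

lemma tensor_coact_in: "tensor_coact v w \<in> car X \<otimes>\<^sub>S car H"
  unfolding tensor_coact_def T.car_X
  by (intro sw_dec_sw2(1) [where F = "(\<otimes>)"] vspace_tensor_space lin_intros)
     (simp_all)

lemma act_X: "t \<in> car X \<Longrightarrow> h \<in> car H \<Longrightarrow> act X t h = sw (dec (car V) (car W) t) (tensor_act h)"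
proof -
  assume t: "t \<in> car X" and h: "h \<in> car H"
  have "act X t h = sw (dec (car V) (car W) t) (\<lambda>v w. sw (V.cH h) (\<lambda>h1 h2.
      act V v (pw H Omega (-1) h1) \<otimes> act W w (pw H Psi (-1) h2)))"
    using t h by (simp add: YD_tensor_def sweedler_sw V.H.cop.dec_cdec)
  also have "\<dots> = sw (dec (car V) (car W) t) (tensor_act h)"
    unfolding tensor_act_def
    by (intro sw_cong [OF dec_tensor(1) [OF V.V.vspace_car t [unfolded T.car_X]]] sw_cong [OF V.H.cop.cdec_in])
       (simp add: V.H.pw_twt V.act.tact_act W.act.tact_act)
  finally show ?thesis .
qed

lemma coact_X: "t \<in> car X \<Longrightarrow> coact X t = sw (dec (car V) (car W) t) tensor_coact"
proof -
  assume t: "t \<in> car X"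
  note in1 = dec_tensor(1) [OF V.V.vspace_car t [unfolded T.car_X]]
  have "coact X t = sw (dec (car V) (car W) t) (\<lambda>v w. sw (V.cV v) (\<lambda>v0 v1. sw (W.cV w) (\<lambda>w0 w1.
      v0 \<otimes> w0 \<otimes> mul H (pw H Alpha (-1) v1) (pw H Beta (-1) w1))))"
    using t by (simp add: YD_tensor_def sweedler_sw, intro sw_cong [OF in1])
      (simp add: V.co.dec_cdec W.co.dec_cdec)
  also have "\<dots> = sw (dec (car V) (car W) t) tensor_coact"
    unfolding tensor_coact_def
    by (intro sw_cong [OF in1] sw_cong [OF V.co.cdec_in] sw_cong [OF W.co.cdec_in])
       (simp add: V.H.pw_twt V.H.mul.tact_act tensor_assoc)
  finally show ?thesis .
qed

lemma bilin_tensor_act: "bilin (tensor_act h)"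
  by (intro bilinI trilin_lins [OF trilin_tensor_act] lin_ident)

lemma act_X_tensor: "v \<in> car V \<Longrightarrow> w \<in> car W \<Longrightarrow> h \<in> car H \<Longrightarrow> act X (v \<otimes> w) h = tensor_act h v w"
  by (simp add: act_X tensor_in_X sw_dec_tensor bilin_tensor_act)

lemma coact_X_tensor: "v \<in> car V \<Longrightarrow> w \<in> car W \<Longrightarrow> coact X (v \<otimes> w) = tensor_coact v w"
  by (simp add: coact_X tensor_in_X sw_dec_tensor bilin_tensor_coact)

lemma tensor_act_proj: "tensor_act (proj (car H) h) = tensor_act h"
  by (simp add: tensor_act_def fun_eq_iff)

lemma X_act_bilin: "act X \<in> bilin_map (car X) (car H) (car X)"
  unfolding bilin_map_iff [OF T.vspace_X V.H.vspace_car]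
proof (intro conjI ballI)
  show "act X \<in> extensional (car X)"
    by (simp add: YD_tensor_def)
  show "act X t \<in> extensional (car H)" if "t \<in> car X" for t
    using that by (simp add: YD_tensor_def)
  show "act X t h \<in> car X" if "t \<in> car X" "h \<in> car H" for t h
    unfolding act_X [OF that]
    by (rule sw_in [OF vspace_subspace [OF T.vspace_X], where V = UNIV and W = UNIV]) (simp_all add: tensor_act_in)
  have "bilin (\<lambda>t h. sw (dec (car V) (car W) (proj (car X) t)) (tensor_act h))"
  proof (rule bilinI)
    show "lin (\<lambda>t. sw (dec (car V) (car W) (proj (car X) t)) (tensor_act h))" for h
      unfolding T.car_X
      by (intro lin_sw_dec bilin_tensor_act V.V.vspace_car W.V.vspace_car lin_proj vspace_tensor_space proj_in)
    show "lin (\<lambda>h. sw (dec (car V) (car W) (proj (car X) t)) (tensor_act h))" for t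
      by (intro lin_sw trilin_lins [OF trilin_tensor_act] lin_ident)
  qed
  then show "bilin (\<lambda>t h. act X (proj (car X) t) (proj (car H) h))"
    by (simp add: act_X tensor_act_proj)
qed

lemma X_coact_lin: "coact X \<in> lin_map (car X) (car X \<otimes>\<^sub>S car H)"
  unfolding lin_map_iff [OF T.vspace_X]
proof (intro conjI funcsetI)
  show "coact X \<in> extensional (car X)"
    by (simp add: YD_tensor_def)
  show "coact X t \<in> car X \<otimes>\<^sub>S car H" if "t \<in> car X" for t
    unfolding coact_X [OF that]
    by (rule sw_in [OF vspace_subspace, where V = UNIV and W = UNIV])
       (simp_all add: tensor_coact_in vspace_tensor_space)
  have "lin (\<lambda>t. sw (dec (car V) (car W) (proj (car X) t)) tensor_coact)"
    unfolding T.car_X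
    by (intro lin_sw_dec bilin_tensor_coact V.V.vspace_car W.V.vspace_car lin_proj vspace_tensor_space proj_in)
  then show "lin (\<lambda>t. coact X (proj (car X) t))"
    by (simp add: coact_X)
qed

lemma twt_tensor_act: "twt X a b c d (tensor_act h v w) = tensor_act (twt H a b c d h) (twt V a b c d v) (twt W a b c d w)"
proof -
  have "tensor_act (twt H a b c d h) (twt V a b c d v) (twt W a b c d w)
    = sw (V.cH h) (\<lambda>x y. V.tV (twt V a b c d v) (twt H 0 0 (-1) 0 (twt H a b c d x))
      \<otimes> W.tV (twt W a b c d w) (twt H 0 0 0 (-1) (twt H a b c d y)))"
    unfolding tensor_act_def by (rule V.H.cop.cdec_twt) (intro lin_intros)
  then show ?thesis
    unfolding tensor_act_def sw_lin [OF T.X.lin_twt] by (simp add: T.twt_tensor add.commute)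
qed

lemma sw_dec_tensor_coact:
  assumes F: "bilin F"
  shows "sw (dec (car X) (car H) (tensor_coact v w)) F = sw (V.cV v) (\<lambda>v0 v1. sw (W.cV w) (\<lambda>w0 w1.
    F (proj (car V) v0 \<otimes> proj (car W) w0) (V.tH (twt H (-1) 0 0 0 v1) (twt H 0 (-1) 0 0 w1))))"
  unfolding tensor_coact_def by (rule sw_dec_sw2(2) [OF T.vspace_X V.H.vspace_car F])
    (simp_all add: T.car_X)

lemma tensor_coact_twt: "tensor_coact (twt V a b c d v) (twt W a b c d w)
  = sw (dec (car X) (car H) (tensor_coact v w)) (\<lambda>x y. twt X a b c d x \<otimes> twt H a b c d y)" (is "?l = _")
proof -
  have "?l = sw (V.cV v) (\<lambda>v0 v1. sw (W.cV (twt W a b c d w)) (\<lambda>w0 w1.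
    (twt V a b c d v0 \<otimes> proj (car W) w0) \<otimes> V.tH (twt H (a - 1) b c d v1) (twt H 0 (-1) 0 0 w1)))"
    unfolding tensor_coact_def
    by (subst V.co.cdec_twt, intro lin_intros V.V.vspace_car W.V.vspace_car) simp
  also have "\<dots> = sw (V.cV v) (\<lambda>v0 v1. sw (W.cV w) (\<lambda>w0 w1.
    (twt V a b c d v0 \<otimes> twt W a b c d w0) \<otimes> V.tH (twt H (a - 1) b c d v1) (twt H a (b - 1) c d w1)))"
    by (rule sw_eqI, subst W.co.cdec_twt, intro lin_intros V.V.vspace_car W.V.vspace_car) simp
  also have "\<dots> = sw (dec (car X) (car H) (tensor_coact v w)) (\<lambda>x y. twt X a b c d x \<otimes> twt H a b c d y)"
    by (subst sw_dec_tensor_coact, intro lin_intros T.X.lin_twt)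
       (simp add: T.twt_tensor)
  finally show ?thesis .
qed

lemma lin_act_X: "lin (\<lambda>t. act X (proj (car X) t) (proj (car H) h))"
  using X_act_bilin unfolding bilin_map_iff [OF T.vspace_X V.H.vspace_car] bilin_def by blast

lemma act_X_in: "t \<in> car X \<Longrightarrow> h \<in> car H \<Longrightarrow> act X t h \<in> car X"
  using X_act_bilin unfolding bilin_map_iff [OF T.vspace_X V.H.vspace_car] by blast

lemma coact_X_in: "t \<in> car X \<Longrightarrow> coact X t \<in> car X \<otimes>\<^sub>S car H"
  using lin_mapD(1) [OF X_coact_lin] .

lemma X_yd_data: "yd_data H X"
proof
  show "act X \<in> bilin_map (car X) (car H) (car X)" by (rule X_act_bilin)
  show "coact X \<in> lin_map (car X) (car X \<otimes>\<^sub>S car H)" by (rule X_coact_lin)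
  show "tw X \<theta> (act X t h) = act X (tw X \<theta> t) (tw H \<theta> h)" if t: "t \<in> car X" and h: "h \<in> car H" for \<theta> t h
  proof -
    have th: "proj (car H) (tw H \<theta> h) = tw H \<theta> h" "proj (car H) h = h"
      using h by (simp_all add: V.H.tw_in)
    have "tw X \<theta> (proj (car X) (act X (proj (car X) t) (proj (car H) h)))
      = act X (proj (car X) (tw X \<theta> (proj (car X) t))) (proj (car H) (tw H \<theta> h))"
    proof (rule T.ext_X [OF lin_comp [OF T.lin_twX lin_act_X] lin_comp [OF lin_act_X T.lin_twX] t])
      fix v w assume vw: "v \<in> car V" "w \<in> car W"
      then show "tw X \<theta> (proj (car X) (act X (proj (car X) (v \<otimes> w)) (proj (car H) h)))
        = act X (proj (car X) (tw X \<theta> (proj (car X) (v \<otimes> w)))) (proj (car H) (tw H \<theta> h))"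
        using h unfolding th
        by (simp add: tensor_in_X act_X_tensor tensor_act_in T.tw_tensor V.V.tw_in W.V.tw_in V.H.tw_in)
           (simp add: T.X.tw_eq_twt V.V.tw_eq_twt W.V.tw_eq_twt V.H.tw_eq_twt tensor_act_in twt_tensor_act)
    qed
    then show ?thesis
      using t unfolding th by (simp add: act_X_in h T.X.tw_in)
  qed
  show "coact X (tw X \<theta> t) = sweedler (car X) (car H) (coact X t) (\<lambda>x y. tw X \<theta> x \<otimes> tw H \<theta> y)"
    if t: "t \<in> car X" for \<theta> t
  proof -
    let ?a = "of_bool (\<theta> = Alpha)" and ?b = "of_bool (\<theta> = Beta)"
      and ?c = "of_bool (\<theta> = Omega)" and ?d = "of_bool (\<theta> = Psi)"
    have bl: "bilin (\<lambda>x y. twt X ?a ?b ?c ?d x \<otimes> twt H ?a ?b ?c ?d y)"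
      by (intro bilinI lin_tensor_left lin_tensor_right T.X.lin_twt V.H.lin_twt)
    note lin = lin_map_proj [OF T.vspace_X X_coact_lin]
    have "coact X (proj (car X) (tw X \<theta> (proj (car X) t)))
      = sw (dec (car X) (car H) (coact X (proj (car X) t))) (\<lambda>x y. twt X ?a ?b ?c ?d x \<otimes> twt H ?a ?b ?c ?d y)"
    proof (rule T.ext_X [OF lin_comp [OF lin T.lin_twX] _ t])
      show "lin (\<lambda>t. sw (dec (car X) (car H) (coact X (proj (car X) t)))
          (\<lambda>x y. twt X ?a ?b ?c ?d x \<otimes> twt H ?a ?b ?c ?d y))"
        by (intro lin_sw_dec T.vspace_X V.H.vspace_car bl lin coact_X_in proj_in)
      fix v w assume vw: "v \<in> car V" "w \<in> car W"
      have "coact X (proj (car X) (tw X \<theta> (proj (car X) (v \<otimes> w)))) = tensor_coact (tw V \<theta> v) (tw W \<theta> w)"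
        using vw by (simp add: tensor_in_X coact_X_tensor T.tw_tensor V.V.tw_in W.V.tw_in)
      also have "\<dots> = tensor_coact (twt V ?a ?b ?c ?d v) (twt W ?a ?b ?c ?d w)"
        using vw by (simp only: V.V.tw_eq_twt W.V.tw_eq_twt)
      also have "\<dots> = sw (dec (car X) (car H) (tensor_coact v w)) (\<lambda>x y. twt X ?a ?b ?c ?d x \<otimes> twt H ?a ?b ?c ?d y)"
        by (rule tensor_coact_twt)
      finally show "coact X (proj (car X) (tw X \<theta> (proj (car X) (v \<otimes> w))))
        = sw (dec (car X) (car H) (coact X (proj (car X) (v \<otimes> w))))
          (\<lambda>x y. twt X ?a ?b ?c ?d x \<otimes> twt H ?a ?b ?c ?d y)"
        using vw by (simp add: tensor_in_X coact_X_tensor)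
    qed
    also have "\<dots> = sw (dec (car X) (car H) (coact X (proj (car X) t))) (\<lambda>x y. tw X \<theta> x \<otimes> tw H \<theta> y)"
      by (rule sw_cong [OF dec_tensor(1) [OF T.vspace_X coact_X_in]])
         (simp_all add: T.X.tw_eq_twt V.H.tw_eq_twt)
    finally show ?thesis
      using t by (simp add: sweedler_sw T.X.tw_in)
  qed
qed

sublocale X: yd_data H X
  by (rule X_yd_data)

text \<open>The \<omega>^(-1) and \<psi>^(-1) in the action on V \<otimes> W are exactly those of
  the untwisted coproduct, so the ordinary diagonal action remains.\<close>

lemma a0_tensor:
  assumes "v \<in> car V" "w \<in> car W"
  shows "a0 H X (v \<otimes> w) h = sw (dH0 H h) (\<lambda>x y. a0 H V v x \<otimes> a0 H W w y)"
proof -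
  have "a0 H X (v \<otimes> w) h = tensor_act (twt H 0 (-1) 0 0 h) (twt V (-1) 0 0 0 v) (twt W (-1) 0 0 0 w)"
    using assms by (simp add: a0_def tact_def T.twt_tensor tensor_in_X act_X_tensor)
  also have "\<dots> = sw (V.cH h) (\<lambda>x y. V.tV (twt V (-1) 0 0 0 v) (twt H 0 (-1) (-1) 0 x)
      \<otimes> W.tV (twt W (-1) 0 0 0 w) (twt H 0 (-1) 0 (-1) y))"
    unfolding tensor_act_def by (subst V.H.cop.cdec_twt, intro lin_intros) simp
  finally show ?thesis by (simp add: sw_dH0 a0_def)
qed

text \<open>The \<alpha>^(-1) and \<beta>^(-1) in the coaction are those of \<open>m0\<close>, and
  the twist of the second leg passes to both factors because the automorphisms are
  multiplicative.\<close>

lemma d0_tensor: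
  assumes "v \<in> car V" "w \<in> car W" and F: "bilin F"
  shows "sw (dX (v \<otimes> w)) F = sw (V.d v) (\<lambda>v0 v1. sw (W.d w)
    (\<lambda>w0 w1. F (v0 \<otimes> w0) (m0 H v1 w1)))"
proof -
  have "cdec X H (coact X) (v \<otimes> w) = dec (car X) (car H) (tensor_coact v w)"
    using assms by (simp add: cdec_def tensor_in_X coact_X_tensor)
  then have "sw (dX (v \<otimes> w)) F = sw (dec (car X) (car H) (tensor_coact v w))
      (\<lambda>x y. F (twt X 0 0 (-1) 0 x) (twt H (1 - m) (1 - n) (1 - p) (- q) y))"
    by (simp add: sw_d0)
  also have "\<dots> = sw (V.cV v) (\<lambda>v0 v1. sw (W.cV w) (\<lambda>w0 w1.
    F (twt X 0 0 (-1) 0 (proj (car V) v0 \<otimes> proj (car W) w0)) (twt H (1 - m) (1 - n) (1 - p) (- q)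
      (V.tH (twt H (-1) 0 0 0 v1) (twt H 0 (-1) 0 0 w1)))))"
    by (rule sw_dec_tensor_coact) (intro lin_intros bilin_lins [OF F] T.X.lin_twt)
  finally show ?thesis
    by (simp add: sw_d0 m0_def T.twt_tensor)
qed

lemma yd_mod_tensor: "yd_mod H X m n p q"
proof -
  interpret Q: yd0_tensor "car H" "m0 H" "one H" "dH0 H" "eps0 H"
    "car V" "a0 H V" "V.d" "car W" "a0 H W" "W.d" "a0 H X" "dX"
    using X.d0_in [of m n p q]
    by unfold_locales (simp_all add: X.bilin_a0 X.lin_d0 a0_tensor d0_tensor flip: T.car_X,
      simp_all add: a0_def d0_def)
  have "yetter_drinfeld H X m n p q"
    unfolding X.yetter_drinfeld_iff using Q.tensor_yd0 by (simp add: T.car_X)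
  then show ?thesis by (intro yd_mod.intro X_yd_data yd_mod_axioms.intro)
qed

end

section \<open>Equality of modules and strict associativity\<close>

lemma twt_cong:
  assumes "car V = car V'" "tw V = tw V'"
  shows "twt V = twt V'"
proof -
  have "pw V = pw V'" by (intro ext) (simp add: pw_def assms)
  then show ?thesis by (intro ext) (simp add: twt_def twp_def assms)
qed

text \<open>Untwisting is reversible: the action is recovered at shifted arguments, and the coaction
  by testing with the bilinear map whose twists are inverse to those of \<open>d0\<close>.
  Extensionality turns agreement on carriers into equality of records.\<close>

lemma yd_mod_eqI:
  assumes "yd_mod H V m n p q" "yd_mod H V' m n p q"
    and car: "car V = car V'" and tw: "\<And>\<theta> v. v \<in> car V \<Longrightarrow> tw V \<theta> v = tw V' \<theta> v"
    and a0: "\<And>v h. v \<in> car V \<Longrightarrow> a0 H V v h = a0 H V' v h"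
    and d0: "\<And>v F. v \<in> car V \<Longrightarrow> bilin F \<Longrightarrow> sw (d0 H m n p q V v) F = sw (d0 H m n p q V' v) F"
  shows "V = V'"
proof -
  interpret V: yd_mod H V m n p q by fact
  interpret V': yd_mod H V' m n p q by fact
  have tw': "tw V = tw V'"
  proof
    show "tw V \<theta> = tw V' \<theta>" for \<theta>
      by (rule extensionalityI [OF lin_mapD(5) [OF V.V.tw_lin_map]])
         (use lin_mapD(5) [OF V'.V.tw_lin_map] tw car in auto)
  qed
  note twt = twt_cong [OF car tw']
  have "act V v h = act V' v h" if "v \<in> car V" "h \<in> car H" for v h
    using a0 [of "twt V 1 0 0 0 v" "twt H 0 1 0 0 h"] that car
    by (simp add: a0_def V.act.tact_act V'.act.tact_act) (simp add: twt tact_def)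
  moreover have "act V \<in> extensional (car V)" "act V' \<in> extensional (car V)"
    "\<And>v. v \<in> car V \<Longrightarrow> act V v \<in> extensional (car H)" "\<And>v. v \<in> car V \<Longrightarrow> act V' v \<in> extensional (car H)"
    using V.act_bilin V'.act_bilin car
    unfolding bilin_map_iff [OF V.V.vspace_car V.H.vspace_car] bilin_map_iff [OF V'.V.vspace_car V.H.vspace_car]
    by auto
  ultimately have act: "act V = act V'"
    by (metis (no_types, lifting) extensionalityI)
  have "coact V v = coact V' v" if v: "v \<in> car V" for v
  proof -
    have "bilin (\<lambda>x y. twt V 0 0 1 0 x \<otimes> twt H (m - 1) (n - 1) (p - 1) q y)"
      by (intro lin_intros)
    from d0 [OF v this]
    have "sw (V.cV v) (\<lambda>x y. proj (car V) x \<otimes> proj (car H) y) = sw (V'.cV v) (\<lambda>x y. proj (car V') x \<otimes> proj (car H) y)"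
      by (simp add: sw_d0) (simp add: twt)
    then show ?thesis
      using v car V.co.sw_cdec_proj [of v "(\<otimes>)"] V'.co.sw_cdec_proj [of v "(\<otimes>)"]
      by (simp add: V.co.cdec_tensor V'.co.cdec_tensor)
  qed
  then have "coact V = coact V'"
    by (intro extensionalityI [OF lin_mapD(5) [OF V.coact_lin]])
       (use lin_mapD(5) [OF V'.coact_lin] car in auto)
  then show ?thesis using car tw' act by (cases V, cases V') simp
qed

lemma tensor_ext3':
  assumes "vspace U" "vspace V" "vspace W" "lin f" "lin g"
    "\<And>u v w. u \<in> U \<Longrightarrow> v \<in> V \<Longrightarrow> w \<in> W \<Longrightarrow> f (u \<otimes> v \<otimes> w) = g (u \<otimes> v \<otimes> w)"
    and t: "t \<in> (U \<otimes>\<^sub>S V) \<otimes>\<^sub>S W"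
  shows "f t = g t"
  by (rule tensor_ext3 [OF assms(1-6)]) (use t in \<open>simp_all add: tensor_space_assoc [OF assms(1-3)]\<close>)

text \<open>The actions agree by coassociativity of the untwisted coproduct, the coactions by
  associativity of the untwisted product, and the automorphisms by associativity of the outer
  product.\<close>

lemma YD_tensor_assoc:
  assumes "yd_mod H U m n p q" "yd_mod H V m n p q" "yd_mod H W m n p q"
  shows "YD_tensor H (YD_tensor H U V) W = YD_tensor H U (YD_tensor H V W)"
proof -
  interpret U: yd_mod H U m n p q by fact
  interpret V: yd_mod H V m n p q by fact
  interpret W: yd_mod H W m n p q by fact
  interpret UV: yd_pair H U V m n p q ..
  interpret VW: yd_pair H V W m n p q ..
  interpret A: yd_mod H "YD_tensor H U V" m n p q by (rule UV.yd_mod_tensor)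
  interpret B: yd_mod H "YD_tensor H V W" m n p q by (rule VW.yd_mod_tensor)
  interpret AW: yd_pair H "YD_tensor H U V" W m n p q ..
  interpret UB: yd_pair H U "YD_tensor H V W" m n p q ..
  note vs = U.V.vspace_car V.V.vspace_car W.V.vspace_car
  have car: "car AW.X = car UB.X"
    by (simp add: AW.T.car_X UB.T.car_X UV.T.car_X VW.T.car_X tensor_space_assoc)
  note ext = tensor_ext3' [OF vs, folded UV.T.car_X, folded AW.T.car_X]
  show ?thesis
  proof (rule yd_mod_eqI [OF AW.yd_mod_tensor UB.yd_mod_tensor car])
    show "tw AW.X \<theta> t = tw UB.X \<theta> t" if t: "t \<in> car AW.X" for \<theta> t
    proof -
      have "tw AW.X \<theta> (proj (car AW.X) t)
        = tw UB.X \<theta> (proj (car UB.X) t)"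
      proof (rule ext [OF AW.T.lin_twX UB.T.lin_twX _ t])
        fix u v w assume uvw: "u \<in> car U" "v \<in> car V" "w \<in> car W"
        note in_X = UV.tensor_in_X [OF uvw(1,2)] VW.tensor_in_X [OF uvw(2,3)]
        note in_X' = AW.tensor_in_X [OF in_X(1) uvw(3), unfolded tensor_assoc] UB.tensor_in_X [OF uvw(1) in_X(2)]
        show "tw AW.X \<theta> (proj (car AW.X) (u \<otimes> v \<otimes> w))
          = tw UB.X \<theta> (proj (car UB.X) (u \<otimes> v \<otimes> w))"
          using AW.T.tw_tensor [OF in_X(1) uvw(3)] UB.T.tw_tensor [OF uvw(1) in_X(2)]
            UV.T.tw_tensor [OF uvw(1,2)] VW.T.tw_tensor [OF uvw(2,3)]
          by (simp add: in_X' tensor_assoc)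
      qed
      then show ?thesis using t car by simp
    qed
    show "a0 H AW.X t h = a0 H UB.X t h" if t: "t \<in> car AW.X" for t h
    proof (rule ext [OF _ _ _ t])
      show "lin (\<lambda>t. a0 H AW.X t h)" "lin (\<lambda>t. a0 H UB.X t h)"
        by (intro lin_ident bilin_lins [OF AW.X.bilin_a0] bilin_lins [OF UB.X.bilin_a0])+
      fix u v w assume uvw: "u \<in> car U" "v \<in> car V" "w \<in> car W"
      note in_X = UV.tensor_in_X [OF uvw(1,2)] VW.tensor_in_X [OF uvw(2,3)]
      have "a0 H AW.X ((u \<otimes> v) \<otimes> w) h
        = sw (dH0 H h) (\<lambda>x y. sw (dH0 H x) (\<lambda>x1 x2. a0 H U u x1 \<otimes> a0 H V v x2 \<otimes> a0 H W w y))"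
        unfolding AW.a0_tensor [OF in_X(1) uvw(3)] UV.a0_tensor [OF uvw(1,2)]
        by (simp only: sw_tensor_left tensor_assoc)
      also have "\<dots> = sw (dH0 H h) (\<lambda>x y. sw (dH0 H y) (\<lambda>y1 y2. a0 H U u x \<otimes> a0 H V v y1 \<otimes> a0 H W w y2))"
        by (rule U.H.U.coassoc [symmetric]) (intro lin_intros)
      also have "\<dots> = a0 H UB.X (u \<otimes> v \<otimes> w) h"
        by (simp add: UB.a0_tensor in_X uvw VW.a0_tensor sw_tensor_right)
      finally show "a0 H AW.X (u \<otimes> v \<otimes> w) h = a0 H UB.X (u \<otimes> v \<otimes> w) h"
        by (simp add: tensor_assoc)
    qed
    show "sw (AW.dX t) F = sw (UB.dX t) F"
      if t: "t \<in> car AW.X" and F: "bilin F" for t F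
    proof (rule ext [OF AW.X.lin_d0 [OF F] UB.X.lin_d0 [OF F] _ t])
      note lins = lin_intros bilin_lins [OF F]
      fix u v w assume uvw: "u \<in> car U" "v \<in> car V" "w \<in> car W"
      note in_X = UV.tensor_in_X [OF uvw(1,2)] VW.tensor_in_X [OF uvw(2,3)]
      have "sw (AW.dX ((u \<otimes> v) \<otimes> w)) F
        = sw (UV.dX (u \<otimes> v)) (\<lambda>x y. sw (W.d w) (\<lambda>w0 w1. F (x \<otimes> w0) (m0 H y w1)))"
        by (rule AW.d0_tensor [OF in_X(1) uvw(3) F])
      also have "\<dots> = sw (U.d u) (\<lambda>u0 u1. sw (V.d v) (\<lambda>v0 v1.
          sw (W.d w) (\<lambda>w0 w1. F ((u0 \<otimes> v0) \<otimes> w0) (m0 H (m0 H u1 v1) w1))))"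
        by (rule UV.d0_tensor [OF uvw(1,2)]) (intro lins)
      also have "\<dots> = sw (U.d u) (\<lambda>u0 u1. sw (VW.dX (v \<otimes> w)) (\<lambda>x y.
          F (u0 \<otimes> x) (m0 H u1 y)))"
        unfolding tensor_assoc U.H.U.m_assoc
        by (rule sw_eqI, rule VW.d0_tensor [OF uvw(2,3), symmetric]) (intro lins)
      also have "\<dots> = sw (UB.dX (u \<otimes> v \<otimes> w)) F"
        by (rule UB.d0_tensor [OF uvw(1) in_X(2) F, symmetric])
      finally show "sw (AW.dX (u \<otimes> v \<otimes> w)) F
        = sw (UB.dX (u \<otimes> v \<otimes> w)) F"
        by (simp add: tensor_assoc)
    qed
  qed
qed

section \<open>The unit object\<close>

context bihom_bialgebra
begin

abbreviation "I \<equiv> YD_unit H"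

lemma twisted_space_unit: "twisted_space I"
proof
  show "vspace (car I)" by (simp add: YD_unit_def)
  have "(\<lambda>x\<in>ground. x) \<in> lin_map ground ground"
    by (intro lin_mapI vspace_ground lin_ident)
  then show "tw I \<theta> \<in> lin_aut (car I)" for \<theta>
    by (simp add: YD_unit_def lin_aut_def bij_betw_def inj_on_def)
qed (simp add: YD_unit_def)

lemma twt_unit: "twt I a b c d x = proj ground x"
proof -
  have "pw I \<theta> k x = x" if "x \<in> ground" for \<theta> k x
    using twisted_space.pw_unique [OF twisted_space_unit, of "\<lambda>_. x" \<theta> k] that by (simp add: YD_unit_def)
  then show ?thesis
    by (simp add: twt_def twp_def) (simp add: YD_unit_def)
qed

lemma scale_in_ground: "x \<in> ground \<Longrightarrow> c *\<^sub>k x \<in> ground"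
  using arr.subspace_scale [OF vspace_subspace [OF vspace_ground]] .

lemma yd_data_unit: "yd_data H I"
proof (intro yd_data.intro bihom_bialgebra_axioms twisted_space_unit yd_data_axioms.intro)
  show "act I \<in> bilin_map (car I) (car H) (car I)"
    unfolding bilin_map_iff [OF twisted_space.vspace_car [OF twisted_space_unit] vspace_car]
  proof (intro conjI)
    have "bilin (\<lambda>u v. eps0 H v *\<^sub>k proj ground u)"
      by (intro lin_intros vspace_ground)
    then show "bilin (\<lambda>u v. act I (proj (car I) u) (proj (car H) v))"
      by (simp add: YD_unit_def eps0_def)
  qed (simp_all add: YD_unit_def scale_in_ground)
  show "tw I \<theta> (act I v h) = act I (tw I \<theta> v) (tw H \<theta> h)" if "v \<in> car I" "h \<in> car H" for v h \<theta>
    using that by (simp add: YD_unit_def tw_in scale_in_ground) (simp add: tw_eq_twt eps0_cou)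
  show "coact I \<in> lin_map (car I) (car I \<otimes>\<^sub>S car H)"
    unfolding YD_unit_def by (simp, intro lin_mapI vspace_ground lin_intros tensor_in one_in)
  show "coact I (tw I \<theta> v) = sweedler (car I) (car H) (coact I v) (\<lambda>v0 v1. tw I \<theta> v0 \<otimes> tw H \<theta> v1)"
    if "v \<in> car I" for v \<theta>
  proof -
    let ?F = "\<lambda>x y. x \<otimes> twt H (of_bool (\<theta> = Alpha)) (of_bool (\<theta> = Beta)) (of_bool (\<theta> = Omega)) (of_bool (\<theta> = Psi)) y"
    have v: "v \<in> ground" using that by (simp add: YD_unit_def)
    have "sw (dec ground (car H) (v \<otimes> one H)) (\<lambda>x y. tw I \<theta> x \<otimes> tw H \<theta> y) = sw (dec ground (car H) (v \<otimes> one H)) ?F"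
      by (rule sw_cong [OF dec_tensor(1)]) (simp_all add: v one_in YD_unit_def tw_eq_twt)
    also have "\<dots> = v \<otimes> one H"
      by (subst sw_dec_tensor, intro vspace_ground, rule vspace_car, intro lin_intros) (simp_all add: v one_in)
    finally show ?thesis
      using v by (simp add: sweedler_sw) (simp add: YD_unit_def)
  qed
qed

lemma a0_unit: "a0 H I x h = eps0 H h *\<^sub>k proj ground x"
  by (simp add: a0_def tact_def twt_unit) (simp add: YD_unit_def)

text \<open>The twists of the coaction vanish here, since every automorphism fixes the unit of
  \<open>H\<close> and those of the ground field are identities.\<close>

lemma d0_unit:
  assumes F: "bilin F"
  shows "sw (d0 H m n p q I x) F = F (proj ground x) (one H)"
proof -
  have pure: "sw (cdec I H (coact I) x) F = F (proj ground x) (one H)" if "bilin F" for F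
    unfolding cdec_def using that
    by (simp add: YD_unit_def sw_dec_tensor one_in)
  then show ?thesis
    unfolding sw_d0 twt_unit
    by (subst pure) (auto intro!: lin_intros vspace_ground bilin_lins [OF F] simp: vspace_ground)
qed

lemma yd_mod_unit: "yd_mod H I m n p q"
proof (intro yd_mod.intro yd_mod_axioms.intro yd_data_unit)
  interpret Y: yd_data H I by (rule yd_data_unit)
  have [simp]: "car I = ground" by (simp add: YD_unit_def)
  have [simp]: "Y.cV (proj ground v) = Y.cV v" for v
    using Y.co.cdec_proj [of v] by simp
  note lins = lin_intros vspace_ground
  let ?d = "d0 H m n p q I"
  show "yetter_drinfeld H I m n p q"
    unfolding Y.yetter_drinfeld_iff
  proof
    show "sw (?d v) (\<lambda>x y. sw (dH0 H y) (\<lambda>z w. G x z w))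
      = sw (?d v) (\<lambda>x y. sw (?d x) (\<lambda>z w. G z w y))" (is "?l = _") if G: "trilin G" for G v
    proof -
      note lins = lins trilin_lins [OF G]
      have "?l = sw (dH0 H (one H)) (\<lambda>z w. G (proj ground v) z w)"
        by (rule d0_unit) (intro lins)
      also have "\<dots> = G (proj ground v) (one H) (one H)"
        by (rule U.dH_e) (intro lins)
      also have "\<dots> = sw (?d v) (\<lambda>x y. sw (?d x) (\<lambda>z w. G z w y))"
        by (subst d0_unit, intro lins Y.lin_d0 [THEN lin_comp], subst d0_unit, intro lins) simp
      finally show ?thesis .
    qed
    show "sw (?d v) (\<lambda>x y. eps0 H y *\<^sub>k f x) = f (proj (car I) v)" if f: "lin f" for f v
      by (subst d0_unit, intro lins lin_comp [OF f]) simp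
    \<comment> \<open>One side is a sum of h1 eps(h2), the other of eps(h1) h2; the two counit laws
      send both to h.\<close>
    show "sw (dH0 H h) (\<lambda>g1 g2. sw (?d (a0 H I v g2)) (\<lambda>x y. F x (m0 H g1 y)))
      = sw (?d v) (\<lambda>x y. sw (dH0 H h) (\<lambda>g1 g2. F (a0 H I x g1) (m0 H y g2)))"
      if F: "bilin F" for F h v
    proof -
      note lins = lins bilin_lins [OF F]
      have L: "lin (\<lambda>x. F (proj ground v) (proj (car H) x))" by (intro lins)
      have "sw (?d (a0 H I v g2)) (\<lambda>x y. F x (m0 H g1 y))
          = eps0 H g2 *\<^sub>k F (proj ground v) (proj (car H) g1)" for g1 g2
        by (subst d0_unit, intro lins)
           (simp add: a0_unit lin_scale [OF lin_proj] lin_scale [of "\<lambda>x. F x _", OF bilin_left [OF F lin_ident]])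
      then have "sw (dH0 H h) (\<lambda>g1 g2. sw (?d (a0 H I v g2)) (\<lambda>x y. F x (m0 H g1 y)))
        = F (proj ground v) (proj (car H) (proj (car H) h))"
        by (simp add: U.counit(1) [OF L])
      moreover have "sw (?d v) (\<lambda>x y. sw (dH0 H h) (\<lambda>g1 g2. F (a0 H I x g1) (m0 H y g2)))
        = sw (dH0 H h) (\<lambda>g1 g2. F (a0 H I (proj ground v) g1) (m0 H (one H) g2))"
        by (rule d0_unit) (intro lins bilin_lins [OF Y.bilin_a0])
      moreover have "\<dots> = sw (dH0 H h) (\<lambda>g1 g2. eps0 H g1 *\<^sub>k F (proj ground v) (proj (car H) g2))"
        by (simp add: a0_unit lin_scale [of "\<lambda>x. F x _", OF bilin_left [OF F lin_ident]])
      moreover have "\<dots> = F (proj ground v) (proj (car H) (proj (car H) h))"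
        by (rule U.counit(2) [OF L])
      ultimately show ?thesis by simp
    qed
  qed (use Y.d0_in [of m n p q] in \<open>simp_all add: Y.bilin_a0 Y.lin_d0\<close>,
      simp_all add: a0_unit d0_def U.eps_m scale_in_ground lin_scale [OF lin_proj] mult.commute)
qed

lemma YD_tensor_unit_left:
  assumes "yd_mod H V m n p q"
  shows "YD_tensor H I V = V"
proof -
  interpret V: yd_mod H V m n p q by fact
  interpret I: yd_mod H I m n p q by (rule yd_mod_unit)
  interpret IV: yd_pair H I V m n p q ..
  have [simp]: "car I = ground" by (simp add: YD_unit_def)
  have car: "car IV.X = car V"
    by (simp add: IV.T.car_X tensor_space_ground_left)
  show ?thesis
  proof (rule yd_mod_eqI [OF IV.yd_mod_tensor assms car], unfold car)
    show "tw IV.X \<theta> v = tw V \<theta> v" if "v \<in> car V" for \<theta> v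
      using IV.T.tw_tensor [of unit_arr v \<theta>] that by simp (simp add: YD_unit_def)
    show "a0 H IV.X v h = a0 H V v h" if "v \<in> car V" for v h
    proof -
      have "a0 H IV.X v h = sw (dH0 H h) (\<lambda>x y. eps0 H x *\<^sub>k a0 H V v y)"
        using IV.a0_tensor [of unit_arr v h] that
        by (simp add: a0_unit tensor_scale_left)
      also have "\<dots> = a0 H V v (proj (car H) h)" by (rule U.counit(2)) (intro lin_intros)
      finally show ?thesis by simp
    qed
    show "sw (IV.dX v) F = sw (V.d v) F" if v: "v \<in> car V" and F: "bilin F" for v F
    proof -
      have "sw (IV.dX v) F
        = sw (I.d unit_arr) (\<lambda>x y. sw (V.d v) (\<lambda>v0 v1. F (x \<otimes> v0) (m0 H y v1)))"
        using IV.d0_tensor [OF _ v F, of unit_arr] by simp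
      also have "\<dots> = sw (V.d v) (\<lambda>v0 v1. F (proj ground unit_arr \<otimes> v0) (m0 H (one H) v1))"
        by (rule d0_unit) (intro lin_intros bilin_lins [OF F])
      also have "\<dots> = sw (V.d v) F"
        by (rule sw_cong [OF V.d0_in]) simp
      finally show ?thesis .
    qed
  qed
qed

lemma YD_tensor_unit_right:
  assumes "yd_mod H V m n p q"
  shows "YD_tensor H V I = V"
proof -
  interpret V: yd_mod H V m n p q by fact
  interpret I: yd_mod H I m n p q by (rule yd_mod_unit)
  interpret VI: yd_pair H V I m n p q ..
  have [simp]: "car I = ground" by (simp add: YD_unit_def)
  have car: "car VI.X = car V"
    by (simp add: VI.T.car_X tensor_space_ground_right)
  show ?thesis
  proof (rule yd_mod_eqI [OF VI.yd_mod_tensor assms car], unfold car)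
    show "tw VI.X \<theta> v = tw V \<theta> v" if "v \<in> car V" for \<theta> v
      using VI.T.tw_tensor [of v unit_arr \<theta>] that by simp (simp add: YD_unit_def)
    show "a0 H VI.X v h = a0 H V v h" if "v \<in> car V" for v h
    proof -
      have "a0 H VI.X v h = sw (dH0 H h) (\<lambda>x y. eps0 H y *\<^sub>k a0 H V v x)"
        using VI.a0_tensor [of v unit_arr h] that
        by (simp add: a0_unit tensor_scale_right)
      also have "\<dots> = a0 H V v (proj (car H) h)" by (rule U.counit(1)) (intro lin_intros)
      finally show ?thesis by simp
    qed
    show "sw (VI.dX v) F = sw (V.d v) F" if v: "v \<in> car V" and F: "bilin F" for v F
    proof -
      have "sw (VI.dX v) F
        = sw (V.d v) (\<lambda>v0 v1. sw (I.d unit_arr) (\<lambda>x y. F (v0 \<otimes> x) (m0 H v1 y)))"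
        using VI.d0_tensor [OF v _ F, of unit_arr] by simp
      also have "\<dots> = sw (V.d v) (\<lambda>v0 v1. F (v0 \<otimes> proj ground unit_arr) (m0 H v1 (one H)))"
        by (rule sw_eqI, rule d0_unit) (intro lin_intros bilin_lins [OF F])
      also have "\<dots> = sw (V.d v) F"
        by (rule sw_cong [OF V.d0_in]) simp
      finally show ?thesis .
    qed
  qed
qed

end


section \<open>Morphisms\<close>

text \<open>The map \<open>f\<close> is \<open>undefined\<close> outside its carrier. With the
  projection inside, the right-hand side of colinearity is again a Sweedler sum of a bilinear test
  map.\<close>

definition yd_mor :: "('k::field, 'x, 'y) bialg_rec_scheme \<Rightarrow> int \<Rightarrow> int \<Rightarrow> int \<Rightarrow> int
    \<Rightarrow> ('k, 'x) yd_rec \<Rightarrow> ('k, 'x) yd_rec \<Rightarrow> (('k, 'x) arr \<Rightarrow> ('k, 'x) arr) \<Rightarrow> bool"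
  where "yd_mor H m n p q V W f \<longleftrightarrow> f \<in> lin_map (car V) (car W)
    \<and> (\<forall>\<theta>. \<forall>v\<in>car V. f (tw V \<theta> v) = tw W \<theta> (f v))
    \<and> (\<forall>v\<in>car V. \<forall>h. f (a0 H V v h) = a0 H W (f v) h)
    \<and> (\<forall>v\<in>car V. \<forall>F. bilin F \<longrightarrow>
        sw (d0 H m n p q W (f v)) F = sw (d0 H m n p q V v) (\<lambda>x y. F (f (proj (car V) x)) y))"

text \<open>The two codomains are independent, so that for instance maps into
  \<open>ground \<otimes>\<^sub>S V\<close> and into \<open>V\<close> can be compared
  directly.\<close>

lemma lin_map_tensor_eqI:
  assumes "vspace V" "vspace W" "f \<in> lin_map (V \<otimes>\<^sub>S W) X" "g \<in> lin_map (V \<otimes>\<^sub>S W) Y"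
    and "\<And>v w. v \<in> V \<Longrightarrow> w \<in> W \<Longrightarrow> f (v \<otimes> w) = g (v \<otimes> w)"
  shows "f = g"
proof (rule extensionalityI [OF lin_mapD(5) [OF assms(3)] lin_mapD(5) [OF assms(4)]])
  note VW = vspace_tensor_space [OF assms(1,2)]
  fix t assume t: "t \<in> V \<otimes>\<^sub>S W"
  have "f (proj (V \<otimes>\<^sub>S W) t) = g (proj (V \<otimes>\<^sub>S W) t)"
    by (rule tensor_ext [OF assms(1) lin_map_proj [OF VW assms(3)] lin_map_proj [OF VW assms(4)] _ t])
       (simp add: VW assms(5))
  then show "f t = g t" using t VW by simp
qed

context yd_pair
begin

lemma mor_twt:
  assumes "f \<in> lin_map (car V) (car W)" "\<forall>\<theta>. \<forall>v\<in>car V. f (tw V \<theta> v) = tw W \<theta> (f v)" "v \<in> car V"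
  shows "f (twt V a b c d v) = twt W a b c d (f v)"
  by (rule twt_transfer [OF V.V.twisted_space_axioms W.V.twisted_space_axioms])
     (use assms lin_mapD(1) [OF assms(1)] in auto)

text \<open>A linear map that commutes with the automorphisms commutes with all their powers, so the
  twists can be moved through \<open>f\<close> in the conditions of linearity and
  colinearity.\<close>

lemma Mor_in_YD_hom_iff: "Mor V W f \<in> YD_hom H V W \<longleftrightarrow> yd_mor H m n p q V W f"
proof -
  have "(\<forall>v\<in>car V. \<forall>h\<in>car H. f (act V v h) = act W (f v) h)
      \<longleftrightarrow> (\<forall>v\<in>car V. \<forall>h. f (a0 H V v h) = a0 H W (f v) h)" (is "?l \<longleftrightarrow> ?r")
    and "(\<forall>v\<in>car V. coact W (f v) = sweedler (car V) (car H) (coact V v) (\<lambda>v0 v1. f v0 \<otimes> v1))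
      \<longleftrightarrow> (\<forall>v\<in>car V. \<forall>F. bilin F \<longrightarrow>
        sw (W.d (f v)) F = sw (V.d v) (\<lambda>x y. F (f (proj (car V) x)) y))" (is "?cl \<longleftrightarrow> ?cr")
    if f: "f \<in> lin_map (car V) (car W)" and tw: "\<forall>\<theta>. \<forall>v\<in>car V. f (tw V \<theta> v) = tw W \<theta> (f v)"
  proof -
    note in_W = lin_mapD(1) [OF f]
    note twt = mor_twt [OF f tw]
    show "?l \<longleftrightarrow> ?r"
    proof safe
      fix v h assume "?l" and v: "v \<in> car V"
      then show "f (a0 H V v h) = a0 H W (f v) h"
        by (simp add: a0_def tact_def twt in_W)
    next
      fix v h assume r: "?r" and v: "v \<in> car V" "h \<in> car H"
      show "f (act V v h) = act W (f v) h"
        using r [rule_format, of "twt V 1 0 0 0 v" "twt H 0 1 0 0 h"] v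
        by (simp add: a0_def twt in_W) (simp add: tact_def in_W)
    qed
    have dec_sw: "sw (dec (car W) (car H) (sw (V.cV v) (\<lambda>v0 v1. f v0 \<otimes> v1))) F = sw (V.cV v) (\<lambda>v0 v1. F (f v0) v1)" (is "?l = _")
      if F: "bilin F" for v F
    proof -
      have "?l = sw (V.cV v) (\<lambda>v0 v1. sw (dec (car W) (car H) (f v0 \<otimes> v1)) F)"
        by (rule sw_dec_sw [OF W.V.vspace_car V.H.vspace_car F V.co.cdec_in]) (simp add: in_W)
      also have "\<dots> = sw (V.cV v) (\<lambda>v0 v1. F (f v0) v1)"
        by (rule sw_cong [OF V.co.cdec_in]) (simp add: in_W sw_dec_tensor F)
      finally show ?thesis .
    qed
    show "?cl \<longleftrightarrow> ?cr"
    proof safe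
      fix v and F :: "('k, 'x) arr \<Rightarrow> ('k, 'x) arr \<Rightarrow> ('k, 'x) arr"
      assume l: ?cl and v: "v \<in> car V" and F: "bilin F"
      have "W.cV (f v) = dec (car W) (car H) (sw (V.cV v) (\<lambda>v0 v1. f v0 \<otimes> v1))"
        using l v by (simp add: cdec_def in_W sweedler_sw)
      then have "sw (W.d (f v)) F
        = sw (V.cV v) (\<lambda>v0 v1. F (twt W 0 0 (-1) 0 (f v0)) (twt H (1 - m) (1 - n) (1 - p) (- q) v1))"
        unfolding sw_d0 by (simp, intro dec_sw lin_intros bilin_lins [OF F])
      also have "\<dots> = sw (V.d v) (\<lambda>x y. F (f (proj (car V) x)) y)"
        unfolding sw_d0 by (rule sw_cong [OF V.co.cdec_in]) (simp add: twt)
      finally show "sw (W.d (f v)) F = sw (V.d v) (\<lambda>x y. F (f (proj (car V) x)) y)" .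
    next
      fix v assume r: ?cr and v: "v \<in> car V"
      have "bilin (\<lambda>x y. twt W 0 0 1 0 x \<otimes> twt H (m - 1) (n - 1) (p - 1) q y)"
        by (intro lin_intros)
      with r v have "sw (W.d (f v)) (\<lambda>x y. twt W 0 0 1 0 x \<otimes> twt H (m - 1) (n - 1) (p - 1) q y)
        = sw (V.d v) (\<lambda>x y. twt W 0 0 1 0 (f (proj (car V) x)) \<otimes> twt H (m - 1) (n - 1) (p - 1) q y)"
        by blast
      then have "sw (W.cV (f v)) (\<lambda>x y. proj (car W) x \<otimes> proj (car H) y)
        = sw (V.cV v) (\<lambda>x y. twt W 0 0 1 0 (f (twt V 0 0 (-1) 0 x)) \<otimes> proj (car H) y)"
        by (simp add: sw_d0)
      also have "\<dots> = sw (V.cV v) (\<lambda>x y. f x \<otimes> y)"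
        by (rule sw_cong [OF V.co.cdec_in]) (simp add: twt in_W)
      also have "sw (W.cV (f v)) (\<lambda>x y. proj (car W) x \<otimes> proj (car H) y) = coact W (f v)"
        using W.co.sw_cdec_proj [of "f v" "(\<otimes>)"] v by (simp add: W.co.cdec_tensor in_W)
      finally show "coact W (f v) = sweedler (car V) (car H) (coact V v) (\<lambda>v0 v1. f v0 \<otimes> v1)"
        using v by (simp add: V.co.sweedler_cdec)
    qed
  qed
  then show ?thesis
    unfolding YD_hom_def yd_mor_def by auto
qed

lemma yd_mor_tensorI:
  assumes "yd_mod H Z m n p q" and f: "f \<in> lin_map (car X) (car Z)"
    and tw: "\<And>\<theta> v w. v \<in> car V \<Longrightarrow> w \<in> car W \<Longrightarrow> f (tw V \<theta> v \<otimes> tw W \<theta> w) = tw Z \<theta> (f (v \<otimes> w))"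
    and a0: "\<And>v w h. v \<in> car V \<Longrightarrow> w \<in> car W \<Longrightarrow>
      sw (dH0 H h) (\<lambda>x y. f (a0 H V v x \<otimes> a0 H W w y)) = a0 H Z (f (v \<otimes> w)) h"
    and d0: "\<And>v w F. v \<in> car V \<Longrightarrow> w \<in> car W \<Longrightarrow> bilin F \<Longrightarrow> sw (d0 H m n p q Z (f (v \<otimes> w))) F
      = sw (V.d v) (\<lambda>v0 v1. sw (W.d w) (\<lambda>w0 w1. F (f (proj (car V) v0 \<otimes> proj (car W) w0)) (m0 H v1 w1)))"
  shows "yd_mor H m n p q X Z f"
  unfolding yd_mor_def
proof (intro conjI ballI allI impI)
  interpret Z: yd_mod H Z m n p q by fact
  note lin_f = lin_map_proj [OF T.vspace_X f] and f_in = lin_mapD(1) [OF f]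
  fix s assume s: "s \<in> car X"
  show "f (tw X \<theta> s) = tw Z \<theta> (f s)" for \<theta>
  proof -
    have "f (proj (car X) (tw X \<theta> (proj (car X) s))) = tw Z \<theta> (proj (car Z) (f (proj (car X) s)))"
      by (rule T.ext_X [OF lin_comp [OF lin_f T.lin_twX]
            lin_comp [OF lin_map_proj [OF Z.V.vspace_car Z.V.tw_lin_map] lin_f] s])
         (simp add: tensor_in_X T.tw_tensor V.V.tw_in W.V.tw_in tw f_in)
    then show ?thesis using s by (simp add: T.X.tw_in f_in)
  qed
  show "f (a0 H X s h) = a0 H Z (f s) h" for h
  proof -
    have "f (proj (car X) (a0 H X s h)) = a0 H Z (f (proj (car X) s)) h"
    proof (rule T.ext_X [OF lin_comp [OF lin_f bilin_left [OF X.bilin_a0 lin_ident]] bilin_left [OF Z.bilin_a0 lin_f] s])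
      fix v w assume vw: "v \<in> car V" "w \<in> car W"
      have "f (proj (car X) (a0 H X (v \<otimes> w) h)) = sw (dH0 H h) (\<lambda>x y. f (proj (car X) (a0 H V v x \<otimes> a0 H W w y)))"
        using vw by (simp only: a0_tensor sw_lin [OF lin_f])
      then show "f (proj (car X) (a0 H X (v \<otimes> w) h)) = a0 H Z (f (proj (car X) (v \<otimes> w))) h"
        using vw by (simp add: tensor_in_X a0)
    qed
    moreover have "a0 H X s h \<in> car X" by (simp add: a0_def)
    ultimately show ?thesis using s by simp
  qed
  show "sw (d0 H m n p q Z (f s)) F = sw (dX s) (\<lambda>x y. F (f (proj (car X) x)) y)" if F: "bilin F" for F
  proof -
    have bl: "bilin (\<lambda>x y. F (f (proj (car X) x)) y)"
      by (intro bilinI bilin_lins [OF F] lin_f lin_ident)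
    have "sw (d0 H m n p q Z (f (proj (car X) s))) F = sw (dX s) (\<lambda>x y. F (f (proj (car X) x)) y)"
    proof (rule T.ext_X [OF lin_comp [OF Z.lin_d0 [OF F] lin_f] X.lin_d0 [OF bl] s])
      fix v w assume vw: "v \<in> car V" "w \<in> car W"
      have "sw (dX (v \<otimes> w)) (\<lambda>x y. F (f (proj (car X) x)) y) = sw (V.d v) (\<lambda>v0 v1. sw (W.d w)
          (\<lambda>w0 w1. F (f (proj (car V) v0 \<otimes> proj (car W) w0)) (m0 H v1 w1)))"
        unfolding d0_tensor [OF vw bl]
        by (intro sw_cong [OF V.d0_in] sw_cong [OF W.d0_in]) (simp add: tensor_in_X)
      then show "sw (d0 H m n p q Z (f (proj (car X) (v \<otimes> w)))) F = sw (dX (v \<otimes> w)) (\<lambda>x y. F (f (proj (car X) x)) y)"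
        using vw by (simp add: tensor_in_X d0 F)
    qed
    then show ?thesis using s by simp
  qed
qed (rule f)

lemma YD_homE:
  assumes "\<phi> \<in> YD_hom H V W"
  obtains f where "\<phi> = Mor V W f" "yd_mor H m n p q V W f"
  using assms Mor_in_YD_hom_iff unfolding YD_hom_def by blast

end

lemma yd_morD:
  assumes "yd_mor H m n p q V W f"
  shows "f \<in> lin_map (car V) (car W)" "v \<in> car V \<Longrightarrow> f v \<in> car W"
    "v \<in> car V \<Longrightarrow> f (tw V \<theta> v) = tw W \<theta> (f v)"
    "v \<in> car V \<Longrightarrow> f (a0 H V v h) = a0 H W (f v) h"
    "v \<in> car V \<Longrightarrow> bilin F \<Longrightarrow>
        sw (d0 H m n p q W (f v)) F = sw (d0 H m n p q V v) (\<lambda>x y. F (f (proj (car V) x)) y)"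
  using assms lin_mapD(1) unfolding yd_mor_def by blast+

lemma (in yd_mod) yd_mor_id: "yd_mor H m n p q V V (\<lambda>v\<in>car V. v)"
  unfolding yd_mor_def
proof (intro conjI ballI allI impI)
  show "(\<lambda>v\<in>car V. v) \<in> lin_map (car V) (car V)"
    by (intro lin_mapI V.vspace_car lin_ident)
  show "sw (d0 H m n p q V ((\<lambda>v\<in>car V. v) v)) F
    = sw (d0 H m n p q V v) (\<lambda>x y. F ((\<lambda>v\<in>car V. v) (proj (car V) x)) y)" if "v \<in> car V" for v F
    using that by (simp, intro sw_cong [OF d0_in]) simp
qed (simp_all add: V.tw_in)

lemma yd_mor_compose:
  assumes "yd_mod H V m n p q" "yd_mod H W m n p q" "yd_mod H U m n p q"
    and f: "yd_mor H m n p q V W f" and g: "yd_mor H m n p q W U g"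
  shows "yd_mor H m n p q V U (compose (car V) g f)"
  unfolding yd_mor_def
proof (intro conjI ballI allI impI)
  interpret V: yd_mod H V m n p q by fact
  interpret W: yd_mod H W m n p q by fact
  interpret U: yd_mod H U m n p q by fact
  note fD = yd_morD [OF f] and gD = yd_morD [OF g]
  have "lin (\<lambda>x. g (proj (car W) (f (proj (car V) x))))"
    using lin_comp [OF lin_map_proj [OF W.V.vspace_car gD(1)] lin_map_proj [OF V.V.vspace_car fD(1)]] .
  then have lin: "lin (\<lambda>x. g (f (proj (car V) x)))"
    using fD(2) by simp
  show "compose (car V) g f \<in> lin_map (car V) (car U)"
    unfolding lin_map_iff [OF V.V.vspace_car] using lin fD(2) gD(2)
    by (simp add: compose_def Pi_iff)
  show "compose (car V) g f (tw V \<theta> v) = tw U \<theta> (compose (car V) g f v)" if "v \<in> car V" for \<theta> v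
    using that by (simp add: compose_def V.V.tw_in fD gD)
  show "compose (car V) g f (a0 H V v h) = a0 H U (compose (car V) g f v) h" if "v \<in> car V" for v h
    using that by (simp add: compose_def fD gD)
  show "sw (U.d (compose (car V) g f v)) F
    = sw (V.d v) (\<lambda>x y. F (compose (car V) g f (proj (car V) x)) y)"
    if v: "v \<in> car V" and F: "bilin F" for v F
  proof -
    have bl: "bilin (\<lambda>x y. F (g (proj (car W) x)) y)"
      by (intro bilinI bilin_lins [OF F] lin_map_proj [OF W.V.vspace_car gD(1)] lin_ident)
    have "sw (U.d (g (f v))) F = sw (W.d (f v)) (\<lambda>x y. F (g (proj (car W) x)) y)"
      by (rule gD(5) [OF fD(2) [OF v] F])
    also have "\<dots> = sw (V.d v) (\<lambda>x y. F (g (proj (car W) (f (proj (car V) x)))) y)"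
      by (rule fD(5) [OF v bl])
    finally show ?thesis
      using v by (simp add: compose_def fD(2))
  qed
qed

text \<open>Saves a separate verification that the inverse braiding is linear and colinear: the laws
  for \<open>g\<close> follow from those for \<open>f\<close> by cancelling
  \<open>f\<close>.\<close>

lemma yd_mor_inverse:
  assumes "yd_mod H V m n p q" "yd_mod H W m n p q"
    and f: "yd_mor H m n p q V W f" and g: "g \<in> lin_map (car W) (car V)"
    and fg: "\<And>w. w \<in> car W \<Longrightarrow> f (g w) = w" and gf: "\<And>v. v \<in> car V \<Longrightarrow> g (f v) = v"
  shows "yd_mor H m n p q W V g"
  unfolding yd_mor_def
proof (intro conjI ballI allI impI)
  interpret V: yd_mod H V m n p q by fact
  interpret W: yd_mod H W m n p q by fact
  note fD = yd_morD [OF f] and g_in = lin_mapD(1) [OF g]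
  fix w assume w: "w \<in> car W"
  show "g (tw W \<theta> w) = tw V \<theta> (g w)" for \<theta>
    using gf [of "tw V \<theta> (g w)"] fD(3) [of "g w" \<theta>] fg w g_in by (simp add: V.V.tw_in)
  show "g (a0 H W w h) = a0 H V (g w) h" for h
    using gf [of "a0 H V (g w) h"] fD(4) [of "g w" h] fg w g_in by simp
  show "sw (V.d (g w)) F = sw (W.d w) (\<lambda>x y. F (g (proj (car W) x)) y)"
    if F: "bilin F" for F
  proof -
    have bl: "bilin (\<lambda>x y. F (g (proj (car W) x)) y)"
      by (intro bilinI bilin_lins [OF F] lin_map_proj [OF W.V.vspace_car g] lin_ident)
    have "sw (W.d w) (\<lambda>x y. F (g (proj (car W) x)) y)
      = sw (V.d (g w)) (\<lambda>x y. F (g (proj (car W) (f (proj (car V) x)))) y)"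
      using fD(5) [OF g_in [OF w] bl] fg [OF w] by simp
    also have "\<dots> = sw (V.d (g w)) F"
      by (rule sw_cong [OF V.d0_in]) (simp add: fD(2) gf)
    finally show ?thesis ..
  qed
qed (rule g)

lemma yd_mor_tensor:
  assumes "yd_mod H V m n p q" "yd_mod H W m n p q" "yd_mod H V' m n p q" "yd_mod H W' m n p q"
    and f: "yd_mor H m n p q V V' f" and g: "yd_mor H m n p q W W' g"
  shows "yd_mor H m n p q (YD_tensor H V W) (YD_tensor H V' W') (tensor_map (car V) (car W) f g)"
    and "v \<in> car V \<Longrightarrow> w \<in> car W \<Longrightarrow> tensor_map (car V) (car W) f g (v \<otimes> w) = f v \<otimes> g w"
    and "tensor_map (car V) (car W) f g \<in> lin_map (car V \<otimes>\<^sub>S car W) (car V' \<otimes>\<^sub>S car W')"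
proof -
  interpret V: yd_mod H V m n p q by fact
  interpret W: yd_mod H W m n p q by fact
  interpret V': yd_mod H V' m n p q by fact
  interpret W': yd_mod H W' m n p q by fact
  interpret VW: yd_pair H V W m n p q ..
  interpret VW': yd_pair H V' W' m n p q ..
  note fD = yd_morD [OF f] and gD = yd_morD [OF g]
  let ?t = "tensor_map (car V) (car W) f g"
  note vs = V.V.vspace_car W.V.vspace_car V'.V.vspace_car W'.V.vspace_car VW.T.vspace_X VW'.T.vspace_X
  note t = tensor_map_in_lin_map [OF vs(1-4) fD(1) gD(1)]
  show t_pure: "?t (v \<otimes> w) = f v \<otimes> g w" if "v \<in> car V" "w \<in> car W" for v w
    by (rule t(2) [OF that])
  show "?t \<in> lin_map (car V \<otimes>\<^sub>S car W) (car V' \<otimes>\<^sub>S car W')" by (rule t(1))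
  have t_lin: "?t \<in> lin_map (car VW.X) (car VW'.X)"
    using t(1) by (simp add: VW.T.car_X VW'.T.car_X)
  note pure = fD gD t_pure vs VW'.tensor_in_X
  show "yd_mor H m n p q VW.X VW'.X ?t"
  proof (rule VW.yd_mor_tensorI [OF VW'.yd_mod_tensor t_lin])
    fix v w assume vw: "v \<in> car V" "w \<in> car W"
    show "?t (tw V \<theta> v \<otimes> tw W \<theta> w) = tw VW'.X \<theta> (?t (v \<otimes> w))" for \<theta>
      using vw by (simp add: pure VW'.T.tw_tensor V.V.tw_in W.V.tw_in)
    show "sw (dH0 H h) (\<lambda>x y. ?t (a0 H V v x \<otimes> a0 H W w y)) = a0 H VW'.X (?t (v \<otimes> w)) h" for h
      using vw by (simp add: pure VW'.a0_tensor)
    show "sw (VW'.dX (?t (v \<otimes> w))) F = sw (V.d v) (\<lambda>v0 v1. sw (W.d w)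
        (\<lambda>w0 w1. F (?t (proj (car V) v0 \<otimes> proj (car W) w0)) (m0 H v1 w1)))" if F: "bilin F" for F
    proof -
      note lins = lin_intros bilin_lins [OF F]
      have "sw (VW'.dX (?t (v \<otimes> w))) F
        = sw (V'.d (f v)) (\<lambda>v0 v1. sw (W'.d (g w)) (\<lambda>w0 w1. F (v0 \<otimes> w0) (m0 H v1 w1)))"
        using vw by (simp add: pure VW'.d0_tensor F)
      also have "\<dots> = sw (V.d v) (\<lambda>v0 v1. sw (W'.d (g w)) (\<lambda>w0 w1. F (f (proj (car V) v0) \<otimes> w0) (m0 H v1 w1)))"
        by (rule fD(5) [OF vw(1)]) (intro lins)
      also have "\<dots> = sw (V.d v) (\<lambda>v0 v1. sw (W.d w)
          (\<lambda>w0 w1. F (f (proj (car V) v0) \<otimes> g (proj (car W) w0)) (m0 H v1 w1)))"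
        by (rule sw_eqI, rule gD(5) [OF vw(2)]) (intro lins)
      finally show ?thesis by (simp add: pure)
    qed
  qed
qed

section \<open>The braiding\<close>

context yd_pair
begin

definition br_fn :: "('k, 'x) arr \<Rightarrow> ('k, 'x) arr"
  where "br_fn = (\<lambda>t\<in>car X. sw (dec (car V) (car W) t) P.br)"

lemma sw_dec_P:
  assumes B: "bilin B" "\<And>v w. B v w \<in> Z" and Z: "vspace Z"
  shows "(\<lambda>t\<in>car X. sw (dec (car V) (car W) t) B) \<in> lin_map (car X) Z"
proof -
  have "(\<lambda>t\<in>car X. sw (dec (car V) (car W) (proj (car X) t)) B) \<in> lin_map (car X) Z"
  proof (rule lin_mapI [OF T.vspace_X])
    show "lin (\<lambda>t. sw (dec (car V) (car W) (proj (car X) t)) B)"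
      unfolding T.car_X
      by (intro lin_sw_dec B V.V.vspace_car W.V.vspace_car lin_proj vspace_tensor_space proj_in)
    show "sw (dec (car V) (car W) (proj (car X) t)) B \<in> Z" for t
      by (rule sw_in [OF vspace_subspace [OF Z], where V = UNIV and W = UNIV]) (simp_all add: B)
  qed
  then show ?thesis by (simp add: cong: restrict_cong)
qed

lemma br_fn_tensor: "v \<in> car V \<Longrightarrow> w \<in> car W \<Longrightarrow> br_fn (v \<otimes> w) = P.br v w"
  by (simp add: br_fn_def tensor_in_X sw_dec_tensor P.bilin_br)

text \<open>The \<beta>^(-1) that \<open>a0\<close> applies to its second argument turns the
  exponent 1 - n of \<beta> in \<open>d0\<close> into the -n of the braiding; its \<alpha>^(-1) is
  the one on v.\<close>

lemma YD_braiding: "YD_braiding H m n p q V W = Mor X (YD_tensor H W V) br_fn"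
proof -
  have "sw (dec (car V) (car W) t) (\<lambda>v w. sw (dec (car W) (car H) (coact W w)) (\<lambda>w0 w1. pw W Omega (-1) w0
      \<otimes> act V (pw V Alpha (-1) v) (twp H (- m + 1) (- n) (- p + 1) (- q) w1)))
    = sw (dec (car V) (car W) t) P.br" if "t \<in> car V \<otimes>\<^sub>S car W" for t
  proof (rule sw_cong [OF dec_tensor(1) [OF V.V.vspace_car that]])
    fix v w assume vw: "v \<in> car V" "w \<in> car W"
    show "sw (dec (car W) (car H) (coact W w)) (\<lambda>w0 w1. pw W Omega (-1) w0
      \<otimes> act V (pw V Alpha (-1) v) (twp H (- m + 1) (- n) (- p + 1) (- q) w1)) = P.br v w"
      unfolding P.br_def sw_d0 W.co.dec_cdec [OF vw(2)]
      by (rule sw_cong [OF W.co.cdec_in])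
         (simp add: vw V.V.pw_twt W.V.pw_twt V.H.twp_twt V.act.tact_act a0_def)
  qed
  then show ?thesis
    unfolding YD_braiding_def br_fn_def T.car_X sweedler_sw by (auto intro!: restrict_ext)
qed

lemma br_yd_mor: "yd_mor H m n p q X (YD_tensor H W V) br_fn"
proof -
  interpret R: yd_pair H W V m n p q ..
  have br_in: "P.br v w \<in> car R.X" for v w
    using P.br_in by (simp add: R.T.car_X)
  have br_lin: "br_fn \<in> lin_map (car X) (car R.X)"
    unfolding br_fn_def by (rule sw_dec_P [OF P.bilin_br br_in R.T.vspace_X])
  have twt_br: "P.br (twt V a b c d v) (twt W a b c d w) = twt R.X a b c d (P.br v w)" for a b c d v w
  proof -
    have "P.br (twt V a b c d v) (twt W a b c d w)
      = sw (W.d w) (\<lambda>w0 w1. twt W a b c d w0 \<otimes> twt V a b c d (a0 H V v w1))"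
      unfolding P.br_def V.twt_a0 by (rule W.d0_twt) (intro lin_intros)
    also have "\<dots> = sw (W.d w) (\<lambda>w0 w1. twt R.X a b c d (w0 \<otimes> a0 H V v w1))"
      by (rule sw_cong [OF W.d0_in]) (simp add: R.T.twt_tensor)
    also have "\<dots> = twt R.X a b c d (P.br v w)"
      unfolding P.br_def by (rule sw_lin [OF R.T.X.lin_twt, symmetric])
    finally show ?thesis .
  qed
  show ?thesis
  proof (rule yd_mor_tensorI [OF R.yd_mod_tensor br_lin])
    fix v w assume vw: "v \<in> car V" "w \<in> car W"
    have "P.br (tw V \<theta> v) (tw W \<theta> w) = tw R.X \<theta> (P.br v w)" for \<theta>
      using vw by (simp only: V.V.tw_eq_twt W.V.tw_eq_twt R.T.X.tw_eq_twt br_in twt_br)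
    then show "br_fn (tw V \<theta> v \<otimes> tw W \<theta> w) = tw R.X \<theta> (br_fn (v \<otimes> w))" for \<theta>
      using vw by (simp add: V.V.tw_in W.V.tw_in br_fn_tensor)
    show "sw (dH0 H h) (\<lambda>x y. br_fn (a0 H V v x \<otimes> a0 H W w y)) = a0 H R.X (br_fn (v \<otimes> w)) h" (is "?l = _") for h
    proof -
      have "?l = sw (W.d w) (\<lambda>w0 w1. sw (dH0 H h) (\<lambda>x y. a0 H W w0 x \<otimes> a0 H V (a0 H V v w1) y))"
        by (simp add: br_fn_tensor P.br_linear)
      also have "\<dots> = sw (W.d w) (\<lambda>w0 w1. a0 H R.X (w0 \<otimes> a0 H V v w1) h)"
        by (rule sw_cong [OF W.d0_in]) (simp add: R.a0_tensor)
      also have "\<dots> = a0 H R.X (P.br v w) h"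
        unfolding P.br_def
        by (rule sw_lin [symmetric]) (intro bilin_lins [OF R.X.bilin_a0] lin_ident)
      finally show ?thesis using vw by (simp add: br_fn_tensor)
    qed
    show "sw (R.dX (br_fn (v \<otimes> w))) F = sw (V.d v) (\<lambda>v0 v1. sw (W.d w)
        (\<lambda>w0 w1. F (br_fn (proj (car V) v0 \<otimes> proj (car W) w0)) (m0 H v1 w1)))" if F: "bilin F" for F
    proof -
      have "sw (R.dX (P.br v w)) F = sw (W.d w) (\<lambda>w0 w1. sw (R.dX (w0 \<otimes> a0 H V v w1)) F)"
        unfolding P.br_def by (rule sw_lin [OF R.X.lin_d0 [OF F]])
      also have "\<dots> = sw (W.d w) (\<lambda>w0 w1. sw (W.d w0) (\<lambda>w00 w01. sw (V.d (a0 H V v w1)) (\<lambda>v0 v1.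
          F (w00 \<otimes> v0) (m0 H w01 v1))))"
        by (rule sw_cong [OF W.d0_in]) (simp add: R.d0_tensor F)
      also have "\<dots> = sw (V.d v) (\<lambda>v0 v1. sw (W.d w) (\<lambda>w0 w1. F (P.br v0 w0) (m0 H v1 w1)))"
        by (rule P.br_colinear [OF F])
      also have "\<dots> = sw (V.d v) (\<lambda>v0 v1. sw (W.d w)
          (\<lambda>w0 w1. F (br_fn (proj (car V) v0 \<otimes> proj (car W) w0)) (m0 H v1 w1)))"
        by (intro sw_cong [OF V.d0_in] sw_cong [OF W.d0_in]) (simp add: br_fn_tensor)
      finally show ?thesis using vw by (simp add: br_fn_tensor)
    qed
  qed
qed

end

section \<open>The inverse of the braiding\<close>

locale hopf_pair = yd_pair H V W m n p q + A: bihom_hopf_algebra H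
  for H :: "('k::field, 'x, 'y) hopf_rec_scheme" and V W m n p q +
  assumes antip_bij: "bij_betw (antip H) (car H) (car H)"
begin

abbreviation "Y \<equiv> YD_tensor H W V"

sublocale R: yd_pair H W V m n p q
  by unfold_locales

definition br_inv_fn :: "('k, 'x) arr \<Rightarrow> ('k, 'x) arr"
  where "br_inv_fn = (\<lambda>t\<in>car Y. sw (dec (car W) (car V) t) (P.br_inv (T0 H)))"

lemmas T0 = A.T0 [OF antip_bij]

lemma br_inv_fn_lin_map: "br_inv_fn \<in> lin_map (car Y) (car X)"
  unfolding br_inv_fn_def
  by (rule R.sw_dec_P [OF P.bilin_br_inv [OF T0(3)] _ T.vspace_X]) (simp add: T.car_X P.br_inv_in)

lemma br_inv_fn_tensor: "v \<in> car V \<Longrightarrow> w \<in> car W \<Longrightarrow> br_inv_fn (w \<otimes> v) = P.br_inv (T0 H) w v"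
  by (simp add: br_inv_fn_def R.tensor_in_X sw_dec_tensor P.bilin_br_inv T0(3))

lemma br_inv_br: "t \<in> car X \<Longrightarrow> br_inv_fn (br_fn t) = t"
  and br_br_inv: "s \<in> car Y \<Longrightarrow> br_fn (br_inv_fn s) = s"
proof -
  note br_lin = yd_morD(1) [OF br_yd_mor]
  note lin_br = lin_map_proj [OF T.vspace_X br_lin] lin_map_proj [OF R.T.vspace_X br_inv_fn_lin_map]
  show "br_inv_fn (br_fn t) = t" if t: "t \<in> car X"
  proof -
    have "br_inv_fn (proj (car Y) (br_fn (proj (car X) t))) = t"
    proof (rule T.ext_X [OF lin_comp [OF lin_br(2) lin_br(1)] lin_ident t])
      fix v w assume vw: "v \<in> car V" "w \<in> car W"
      have "br_inv_fn (proj (car Y) (P.br v w))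
        = sw (W.d w) (\<lambda>w0 w1. br_inv_fn (proj (car Y) (w0 \<otimes> a0 H V v w1)))"
        unfolding P.br_def by (rule sw_lin [OF lin_br(2)])
      also have "\<dots> = sw (W.d w) (\<lambda>w0 w1. P.br_inv (T0 H) w0 (a0 H V v w1))"
        by (rule sw_cong [OF W.d0_in]) (simp add: R.tensor_in_X br_inv_fn_tensor)
      also have "\<dots> = v \<otimes> w"
        using P.br_inv_br [OF T0(3) T0(1), where v = v and w = w] vw by simp
      finally show "br_inv_fn (proj (car Y) (br_fn (proj (car X) (v \<otimes> w)))) = v \<otimes> w"
        using vw by (simp add: tensor_in_X br_fn_tensor)
    qed
    then show ?thesis using t lin_mapD(1) [OF br_lin] by simp
  qed
  show "br_fn (br_inv_fn s) = s" if s: "s \<in> car Y"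
  proof -
    have "br_fn (proj (car X) (br_inv_fn (proj (car Y) s))) = s"
    proof (rule R.T.ext_X [OF lin_comp [OF lin_br(1) lin_br(2)] lin_ident s])
      fix w v assume vw: "w \<in> car W" "v \<in> car V"
      have "br_fn (proj (car X) (P.br_inv (T0 H) w v))
        = sw (W.d w) (\<lambda>w0 w1. br_fn (proj (car X) (a0 H V v (T0 H w1) \<otimes> w0)))"
        unfolding P.br_inv_def by (rule sw_lin [OF lin_br(1)])
      also have "\<dots> = sw (W.d w) (\<lambda>w0 w1. P.br (a0 H V v (T0 H w1)) w0)"
        by (rule sw_cong [OF W.d0_in]) (simp add: tensor_in_X br_fn_tensor)
      also have "\<dots> = w \<otimes> v"
        using P.br_br_inv [OF T0(3) T0(2), where v = v and w = w] vw by simp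
      finally show "br_fn (proj (car X) (br_inv_fn (proj (car Y) (w \<otimes> v)))) = w \<otimes> v"
        using vw by (simp add: R.tensor_in_X br_inv_fn_tensor)
    qed
    then show ?thesis using s lin_mapD(1) [OF br_inv_fn_lin_map] by simp
  qed
qed

text \<open>Inside \<open>T0\<close>, the antipode inverse is preceded by \<alpha>^(-1) \<beta>
  \<omega>^(-1) \<psi>. Combined with the \<beta>^(-1) of \<open>a0\<close> and the twist of
  \<open>d0\<close>, this yields \<alpha>^(-m) \<beta>^(1-n) \<omega>^(-p) \<psi>^(1-q).\<close>

lemma YD_braiding_inv: "YD_braiding_inv H m n p q V W = Mor Y X br_inv_fn"
proof -
  have "sw (dec (car W) (car V) t) (\<lambda>w v. sw (dec (car W) (car H) (coact W w)) (\<lambda>w0 w1.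
        act V (pw V Alpha (-1) v) (inv_into (car H) (antip H) (twp H (- m) (- n + 1) (- p) (- q + 1) w1))
          \<otimes> pw W Omega (-1) w0))
    = sw (dec (car W) (car V) t) (P.br_inv (T0 H))" if "t \<in> car W \<otimes>\<^sub>S car V" for t
  proof (rule sw_cong [OF dec_tensor(1) [OF W.V.vspace_car that]])
    fix w v assume vw: "w \<in> car W" "v \<in> car V"
    show "sw (dec (car W) (car H) (coact W w)) (\<lambda>w0 w1.
        act V (pw V Alpha (-1) v) (inv_into (car H) (antip H) (twp H (- m) (- n + 1) (- p) (- q + 1) w1))
          \<otimes> pw W Omega (-1) w0) = P.br_inv (T0 H) w v"
      unfolding P.br_inv_def sw_d0 W.co.dec_cdec [OF vw(1)]
      by (rule sw_cong [OF W.co.cdec_in])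
         (simp add: vw V.V.pw_twt W.V.pw_twt V.H.twp_twt V.act.tact_act a0_def T0(4,5,6))
  qed
  then show ?thesis
    unfolding YD_braiding_inv_def br_inv_fn_def R.T.car_X sweedler_sw by (auto intro!: restrict_ext)
qed

end

section \<open>The braided monoidal category\<close>

text \<open>When all constraints are identities, pentagon and triangle are trivial, naturality of
  the constraints becomes associativity and unitality of the tensor product of morphisms, and each
  hexagon is a formula for the braiding with a tensor product.\<close>

lemma (in category) strict_braided_monoidal_categoryI:
  fixes tens :: "'o \<Rightarrow> 'o \<Rightarrow> 'o" and tensm :: "'a \<Rightarrow> 'a \<Rightarrow> 'a" and unit :: 'o and c :: "'o \<Rightarrow> 'o \<Rightarrow> 'a"
  assumes tens_Ob [simp]: "\<And>A B. A \<in> Ob \<Longrightarrow> B \<in> Ob \<Longrightarrow> tens A B \<in> Ob"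
    and tens_Hom: "\<And>A B A' B' f g. \<lbrakk>A \<in> Ob; B \<in> Ob; A' \<in> Ob; B' \<in> Ob; f \<in> Hom A A'; g \<in> Hom B B'\<rbrakk>
      \<Longrightarrow> tensm f g \<in> Hom (tens A B) (tens A' B')"
    and tens_Id: "\<And>A B. \<lbrakk>A \<in> Ob; B \<in> Ob\<rbrakk> \<Longrightarrow> tensm (ide A) (ide B) = ide (tens A B)"
    and tens_Comp: "\<And>A A' A'' B B' B'' f f' g g'. \<lbrakk>A \<in> Ob; A' \<in> Ob; A'' \<in> Ob; B \<in> Ob; B' \<in> Ob; B'' \<in> Ob;
        f \<in> Hom A A'; f' \<in> Hom A' A''; g \<in> Hom B B'; g' \<in> Hom B' B''\<rbrakk>
      \<Longrightarrow> tensm (Comp f' f) (Comp g' g) = Comp (tensm f' g') (tensm f g)"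
    and unit_Ob [simp]: "unit \<in> Ob"
    and assoc_Ob: "\<And>A B C. \<lbrakk>A \<in> Ob; B \<in> Ob; C \<in> Ob\<rbrakk> \<Longrightarrow> tens (tens A B) C = tens A (tens B C)"
    and assoc_Hom: "\<And>A B C A' B' C' f g h. \<lbrakk>A \<in> Ob; B \<in> Ob; C \<in> Ob; A' \<in> Ob; B' \<in> Ob; C' \<in> Ob;
        f \<in> Hom A A'; g \<in> Hom B B'; h \<in> Hom C C'\<rbrakk> \<Longrightarrow> tensm (tensm f g) h = tensm f (tensm g h)"
    and unit_left: "\<And>A. A \<in> Ob \<Longrightarrow> tens unit A = A" and unit_right: "\<And>A. A \<in> Ob \<Longrightarrow> tens A unit = A"
    and unit_left_Hom: "\<And>A B f. \<lbrakk>A \<in> Ob; B \<in> Ob; f \<in> Hom A B\<rbrakk> \<Longrightarrow> tensm (ide unit) f = f"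
    and unit_right_Hom: "\<And>A B f. \<lbrakk>A \<in> Ob; B \<in> Ob; f \<in> Hom A B\<rbrakk> \<Longrightarrow> tensm f (ide unit) = f"
    and c_iso: "\<And>A B. \<lbrakk>A \<in> Ob; B \<in> Ob\<rbrakk> \<Longrightarrow> is_iso Hom ide Comp (tens A B) (tens B A) (c A B)"
    and c_natural: "\<And>A B A' B' f g. \<lbrakk>A \<in> Ob; B \<in> Ob; A' \<in> Ob; B' \<in> Ob; f \<in> Hom A A'; g \<in> Hom B B'\<rbrakk>
      \<Longrightarrow> Comp (c A' B') (tensm f g) = Comp (tensm g f) (c A B)"
    and hexagon: "\<And>A B C. \<lbrakk>A \<in> Ob; B \<in> Ob; C \<in> Ob\<rbrakk>
      \<Longrightarrow> c A (tens B C) = Comp (tensm (ide B) (c A C)) (tensm (c A B) (ide C))"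
    and hexagon': "\<And>A B C. \<lbrakk>A \<in> Ob; B \<in> Ob; C \<in> Ob\<rbrakk>
      \<Longrightarrow> c (tens A B) C = Comp (tensm (c A C) (ide B)) (tensm (ide A) (c B C))"
  shows "strict_braided_monoidal_category Ob Hom ide Comp tens tensm unit c"
proof -
  have ide_iso: "is_iso Hom ide Comp A A (ide A)" if "A \<in> Ob" for A
    using Id_in [OF that] Id_left [OF that that Id_in [OF that]] unfolding is_iso_def is_inverse_def by blast
  have ide_inverse: "f = ide A" if "A \<in> Ob" "is_inverse Hom ide Comp A A (ide A) f" for A f
    using that Id_right by (metis is_inverse_def)
  have c_in: "c A B \<in> Hom (tens A B) (tens B A)" if "A \<in> Ob" "B \<in> Ob" for A B
    using c_iso [OF that] by (auto simp: is_iso_def is_inverse_def)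
  note ide_left = Id_left [OF _ _ Id_in]
  show ?thesis
  proof
    fix A B C assume ABC: "A \<in> Ob" "B \<in> Ob" "C \<in> Ob"
    show "is_iso Hom ide Comp (tens (tens A B) C) (tens A (tens B C)) (ide (tens (tens A B) C))"
      using ABC ide_iso by (simp add: assoc_Ob)
    have in_Hom: "tensm (ide B) (c A C) \<in> Hom (tens B (tens A C)) (tens B (tens C A))"
      "tensm (c A B) (ide C) \<in> Hom (tens (tens A B) C) (tens (tens B A) C)"
      "tensm (c A C) (ide B) \<in> Hom (tens (tens A C) B) (tens (tens C A) B)"
      "tensm (ide A) (c B C) \<in> Hom (tens A (tens B C)) (tens A (tens C B))"
      by (intro tens_Hom Id_in c_in; simp add: ABC)+
    have "Comp (ide (tens (tens B A) C)) (tensm (c A B) (ide C)) = tensm (c A B) (ide C)"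
      by (rule Id_left [OF _ _ in_Hom(2)]) (simp_all add: ABC)
    moreover have "Comp (ide (tens (tens B C) A)) (Comp (c A (tens B C)) (ide (tens (tens A B) C))) = c A (tens B C)"
      using Id_right [OF _ _ c_in [of A "tens B C"]] Id_left [OF _ _ c_in [of A "tens B C"]] ABC
      by (simp add: assoc_Ob)
    ultimately show "Comp (ide (tens (tens B C) A)) (Comp (c A (tens B C)) (ide (tens (tens A B) C)))
      = Comp (tensm (ide B) (c A C)) (Comp (ide (tens (tens B A) C)) (tensm (c A B) (ide C)))"
      using hexagon [OF ABC] by simp
    fix a1 a2 a3
    assume "is_inverse Hom ide Comp (tens (tens C A) B) (tens C (tens A B)) (ide (tens (tens C A) B)) a1"
      "is_inverse Hom ide Comp (tens (tens A B) C) (tens A (tens B C)) (ide (tens (tens A B) C)) a2"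
      "is_inverse Hom ide Comp (tens (tens A C) B) (tens A (tens C B)) (ide (tens (tens A C) B)) a3"
    then have a: "a1 = ide (tens C (tens A B))" "a2 = ide (tens (tens A B) C)" "a3 = ide (tens A (tens C B))"
      using ide_inverse ABC by (simp_all add: assoc_Ob)
    have "Comp a1 (Comp (c (tens A B) C) a2) = c (tens A B) C"
      unfolding a using Id_right [OF _ _ c_in [of "tens A B" C]] Id_left [OF _ _ c_in [of "tens A B" C]] ABC
      by simp
    moreover have "Comp a3 (tensm (ide A) (c B C)) = tensm (ide A) (c B C)"
      unfolding a by (rule Id_left [OF _ _ in_Hom(4)]) (simp_all add: ABC)
    ultimately show "Comp a1 (Comp (c (tens A B) C) a2) = Comp (tensm (c A C) (ide B)) (Comp a3 (tensm (ide A) (c B C)))"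
      using hexagon' [OF ABC] by simp
  next
    fix A B C A' B' C' f g h
    assume ABC: "A \<in> Ob" "B \<in> Ob" "C \<in> Ob" "A' \<in> Ob" "B' \<in> Ob" "C' \<in> Ob"
      and fgh: "f \<in> Hom A A'" "g \<in> Hom B B'" "h \<in> Hom C C'"
    have "tensm f (tensm g h) \<in> Hom (tens A (tens B C)) (tens A' (tens B' C'))"
      by (intro tens_Hom fgh; simp add: ABC)
    then show "Comp (ide (tens (tens A' B') C')) (tensm (tensm f g) h) = Comp (tensm f (tensm g h)) (ide (tens (tens A B) C))"
      using ABC fgh by (simp add: assoc_Ob assoc_Hom Id_left [of "tens A (tens B C)"] Id_right [of _ "tens A' (tens B' C')"])
  next
    fix A B C D assume ABCD: "A \<in> Ob" "B \<in> Ob" "C \<in> Ob" "D \<in> Ob"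
    then show "Comp (tensm (ide A) (ide (tens (tens B C) D))) (Comp (ide (tens (tens A (tens B C)) D)) (tensm (ide (tens (tens A B) C)) (ide D)))
      = Comp (ide (tens (tens A B) (tens C D))) (ide (tens (tens (tens A B) C) D))"
      by (simp add: tens_Id assoc_Ob ide_left)
  next
    fix A B f assume "A \<in> Ob" "B \<in> Ob" "f \<in> Hom A B"
    then show "Comp (ide (tens unit B)) (tensm (ide unit) f) = Comp f (ide (tens unit A))"
      "Comp (ide (tens B unit)) (tensm f (ide unit)) = Comp f (ide (tens A unit))"
      using Id_left Id_right by (simp_all add: unit_left unit_right unit_left_Hom unit_right_Hom)
  qed (simp_all add: tens_Hom tens_Id tens_Comp ide_iso unit_left unit_right c_iso c_natural assoc_Ob ide_left)
qed

text \<open>The two domains are bracketed differently but are the same set, so the maps can be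
  compared on pure triples.\<close>

lemma tensor3_eqI:
  assumes U: "vspace U" and V: "vspace V" and W: "vspace W"
    and f: "f \<in> lin_map ((U \<otimes>\<^sub>S V) \<otimes>\<^sub>S W) X" and g: "g \<in> lin_map (U \<otimes>\<^sub>S V \<otimes>\<^sub>S W) Y"
    and eq: "\<And>u v w. u \<in> U \<Longrightarrow> v \<in> V \<Longrightarrow> w \<in> W \<Longrightarrow> f ((u \<otimes> v) \<otimes> w) = g (u \<otimes> v \<otimes> w)"
  shows "f = g"
proof -
  note f' = f [unfolded tensor_space_assoc [OF U V W]]
  have X: "vspace (U \<otimes>\<^sub>S V \<otimes>\<^sub>S W)" by (intro vspace_tensor_space assms)
  show ?thesis
  proof (rule extensionalityI [OF lin_mapD(5) [OF f'] lin_mapD(5) [OF g]])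
    fix t assume t: "t \<in> U \<otimes>\<^sub>S V \<otimes>\<^sub>S W"
    have "f (proj (U \<otimes>\<^sub>S V \<otimes>\<^sub>S W) t) = g (proj (U \<otimes>\<^sub>S V \<otimes>\<^sub>S W) t)"
      by (rule tensor_ext3 [OF U V W lin_map_proj [OF X f'] lin_map_proj [OF X g] _ t])
         (use eq in \<open>simp add: X tensor_assoc\<close>)
    then show "f t = g t" using t X by simp
  qed
qed

lemma YD_comp_Mor: "YD_comp (Mor B C g) (Mor A B f) = Mor A C (compose (car A) g f)"
  by (simp add: YD_comp_def)

lemma YD_tensor_mor_Mor: "YD_tensor_mor H (Mor A A' f) (Mor B B' g)
    = Mor (YD_tensor H A B) (YD_tensor H A' B') (tensor_map (car A) (car B) f g)"
  by (simp add: YD_tensor_mor_def)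

lemma tensor_car: "car (YD_tensor H A B) = car A \<otimes>\<^sub>S car B"
  by (simp add: YD_tensor_def)

section \<open>The category and its tensor functor\<close>

context bihom_bialgebra
begin

context
  fixes m n p q :: int
begin

abbreviation "obj A \<equiv> yd_mod H A m n p q"
abbreviation "mor A B f \<equiv> yd_mor H m n p q A B f"

lemma YD_hom_iff:
  assumes "obj A" "obj B"
  shows "\<phi> \<in> YD_hom H A B \<longleftrightarrow> (\<exists>f. \<phi> = Mor A B f \<and> mor A B f)"
proof -
  interpret A: yd_mod H A m n p q by fact
  interpret B: yd_mod H B m n p q by fact
  interpret AB: yd_pair H A B m n p q ..
  show ?thesis using AB.YD_homE AB.Mor_in_YD_hom_iff by metis
qed

lemma vspace_yd_mod: "obj A \<Longrightarrow> vspace (car A)"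
  using yd_mod.axioms(1) yd_data.axioms(2) twisted_space.vspace_car by blast

lemma yd_mod_tensor:
  "obj A \<Longrightarrow> obj B \<Longrightarrow> obj (YD_tensor H A B)"
  by (rule yd_pair.yd_mod_tensor [OF yd_pair.intro])

lemma YD_category: "category (YD H m n p q) (YD_hom H) YD_id YD_comp"
proof
  fix A B A' B' f
  show "A = A' \<and> B = B'" if "f \<in> YD_hom H A B" "f \<in> YD_hom H A' B'"
    using that by (auto simp: YD_hom_def)
next
  fix A assume "A \<in> YD H m n p q"
  then show "YD_id A \<in> YD_hom H A A"
    using yd_mod.yd_mor_id by (auto simp: YD_iff YD_hom_iff YD_id_def)
next
  fix A B C f g assume "A \<in> YD H m n p q" "B \<in> YD H m n p q" "C \<in> YD H m n p q" "f \<in> YD_hom H A B" "g \<in> YD_hom H B C"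
  then show "YD_comp g f \<in> YD_hom H A C"
    using yd_mor_compose by (auto simp: YD_iff YD_hom_iff YD_comp_Mor)
next
  fix A B f assume "A \<in> YD H m n p q" "B \<in> YD H m n p q" "f \<in> YD_hom H A B"
  then obtain h where f: "f = Mor A B h" and "mor A B h"
    by (auto simp: YD_iff YD_hom_iff)
  then have "h \<in> car A \<rightarrow> car B" "h \<in> extensional (car A)" using yd_morD(1,2) lin_mapD(5) by blast+
  then show "YD_comp (YD_id B) f = f" "YD_comp f (YD_id A) = f"
    unfolding f YD_id_def YD_comp_Mor by (simp_all add: Id_compose compose_Id)
next
  fix A B C D f g h
  assume "A \<in> YD H m n p q" "B \<in> YD H m n p q" "C \<in> YD H m n p q" "D \<in> YD H m n p q"
    "f \<in> YD_hom H A B" "g \<in> YD_hom H B C" "h \<in> YD_hom H C D"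
  then obtain f' g' h' where f: "f = Mor A B f'" and "mor A B f'"
    and g: "g = Mor B C g'" and h: "h = Mor C D h'"
    by (auto simp: YD_iff YD_hom_iff)
  then have "f' \<in> car A \<rightarrow> car B" using yd_morD(2) by blast
  then show "YD_comp (YD_comp h g) f = YD_comp h (YD_comp g f)"
    unfolding f g h YD_comp_Mor by (simp add: compose_assoc)
qed

lemma tensor_map_id:
  assumes "obj A" "obj B"
  shows "YD_tensor_mor H (YD_id A) (YD_id B) = YD_id (YD_tensor H A B)"
proof -
  note vs = assms [THEN vspace_yd_mod]
  note ids = assms [THEN yd_mod.yd_mor_id]
  note t = yd_mor_tensor [OF assms assms ids]
  have "(\<lambda>t\<in>car A \<otimes>\<^sub>S car B. t) \<in> lin_map (car A \<otimes>\<^sub>S car B) (car A \<otimes>\<^sub>S car B)"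
    by (intro lin_mapI vspace_tensor_space vs lin_ident)
  then show ?thesis
    unfolding YD_id_def YD_tensor_mor_Mor tensor_car
    using lin_map_tensor_eqI [OF vs t(3)] t(2) by simp
qed

lemma tensor_map_compose:
  assumes "obj A" "obj A'" "obj A''"
    and "obj B" "obj B'" "obj B''"
    and f: "mor A A' f" "mor A' A'' f'"
    and g: "mor B B' g" "mor B' B'' g'"
  shows "tensor_map (car A) (car B) (compose (car A) f' f) (compose (car B) g' g)
    = compose (car A \<otimes>\<^sub>S car B) (tensor_map (car A') (car B') f' g') (tensor_map (car A) (car B) f g)"
proof -
  note m = assms(1-6) and vs = assms(1,4) [THEN vspace_yd_mod]
  note t = yd_mor_tensor [OF m(1,4,2,5) f(1) g(1)] and t' = yd_mor_tensor [OF m(2,5,3,6) f(2) g(2)]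
  note tc = yd_mor_tensor [OF m(1,4,3,6) yd_mor_compose [OF m(1-3) f] yd_mor_compose [OF m(4-6) g]]
  note ct = yd_mor_compose [OF yd_mod_tensor [OF m(1,4)] yd_mod_tensor [OF m(2,5)] yd_mod_tensor [OF m(3,6)] t(1) t'(1)]
  show ?thesis
  proof (rule lin_map_tensor_eqI [OF vs tc(3) yd_morD(1) [OF ct, unfolded tensor_car]])
    fix v w assume vw: "v \<in> car A" "w \<in> car B"
    show "tensor_map (car A) (car B) (compose (car A) f' f) (compose (car B) g' g) (v \<otimes> w)
      = compose (car A \<otimes>\<^sub>S car B) (tensor_map (car A') (car B') f' g') (tensor_map (car A) (car B) f g) (v \<otimes> w)"
      unfolding tc(2) [OF vw]
      using vw by (simp add: compose_def t(2) t'(2) yd_morD(2) [OF f(1)] yd_morD(2) [OF g(1)])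
  qed
qed

lemma tensor_mor_assoc:
  assumes "obj A" "obj B" "obj C"
    and "obj A'" "obj B'" "obj C'"
    and f: "mor A A' f" and g: "mor B B' g" and h: "mor C C' h"
  shows "tensor_map (car A \<otimes>\<^sub>S car B) (car C) (tensor_map (car A) (car B) f g) h
    = tensor_map (car A) (car B \<otimes>\<^sub>S car C) f (tensor_map (car B) (car C) g h)"
proof -
  note m = assms(1-6) and vs = assms(1-3) [THEN vspace_yd_mod]
  note fg = yd_mor_tensor [OF m(1,2,4,5) f g] and gh = yd_mor_tensor [OF m(2,3,5,6) g h]
  note l = yd_mor_tensor [OF yd_mod_tensor [OF m(1,2)] m(3) yd_mod_tensor [OF m(4,5)] m(6) fg(1) h, unfolded tensor_car]
  note r = yd_mor_tensor [OF m(1) yd_mod_tensor [OF m(2,3)] m(4) yd_mod_tensor [OF m(5,6)] f gh(1), unfolded tensor_car]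
  show ?thesis
  proof (rule tensor3_eqI [OF vs l(3) r(3)])
    fix u v w assume uvw: "u \<in> car A" "v \<in> car B" "w \<in> car C"
    show "tensor_map (car A \<otimes>\<^sub>S car B) (car C) (tensor_map (car A) (car B) f g) h ((u \<otimes> v) \<otimes> w)
      = tensor_map (car A) (car B \<otimes>\<^sub>S car C) f (tensor_map (car B) (car C) g h) (u \<otimes> v \<otimes> w)"
      unfolding l(2) [OF tensor_in [OF uvw(1,2)] uvw(3)] r(2) [OF uvw(1) tensor_in [OF uvw(2,3)]]
        fg(2) [OF uvw(1,2)] gh(2) [OF uvw(2,3)] by (rule tensor_assoc)
  qed
qed

lemma tensor_map_unit:
  assumes A: "obj A" "obj B" and f: "mor A B f"
  shows "YD_tensor_mor H (YD_id I) (Mor A B f) = Mor A B f"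
    and "YD_tensor_mor H (Mor A B f) (YD_id I) = Mor A B f"
proof -
  note vs = A [THEN vspace_yd_mod] and I = yd_mod_unit [of m n p q]
  note l = yd_mor_tensor [OF I A(1) I A(2) yd_mod.yd_mor_id [OF I] f]
    and r = yd_mor_tensor [OF A(1) I A(2) I f yd_mod.yd_mor_id [OF I]]
  have car: "car I = ground" by (simp add: YD_unit_def)
  note f_lin = yd_morD(1) [OF f]
  have "tensor_map ground (car A) (\<lambda>x\<in>ground. x) f = f"
  proof (rule lin_map_tensor_eqI [OF vspace_ground vs(1) l(3) [unfolded car]])
    show "f \<in> lin_map (ground \<otimes>\<^sub>S car A) (car B)" using f_lin by (simp add: tensor_space_ground_left vs)
    fix x v :: "('k, 'x) arr" assume x: "x \<in> ground" and v: "v \<in> car A"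
    show "tensor_map ground (car A) (\<lambda>x\<in>ground. x) f (x \<otimes> v) = f (x \<otimes> v)"
      using l(2) [unfolded car, OF x v] x v
      by (elim ground_cases) (simp add: tensor_scale_left lin_mapD(3) [OF f_lin] scale_in_ground)
  qed
  then show "YD_tensor_mor H (YD_id I) (Mor A B f) = Mor A B f"
    unfolding YD_id_def YD_tensor_mor_Mor car by (simp add: YD_tensor_unit_left [OF A(1)] YD_tensor_unit_left [OF A(2)])
  have "tensor_map (car A) ground f (\<lambda>x\<in>ground. x) = f"
  proof (rule lin_map_tensor_eqI [OF vs(1) vspace_ground r(3) [unfolded car]])
    show "f \<in> lin_map (car A \<otimes>\<^sub>S ground) (car B)" using f_lin by (simp add: tensor_space_ground_right vs)
    fix x v :: "('k, 'x) arr" assume v: "v \<in> car A" and x: "x \<in> ground"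
    show "tensor_map (car A) ground f (\<lambda>x\<in>ground. x) (v \<otimes> x) = f (v \<otimes> x)"
      using r(2) [unfolded car, OF v x] x v
      by (elim ground_cases) (simp add: tensor_scale_right lin_mapD(3) [OF f_lin] scale_in_ground)
  qed
  then show "YD_tensor_mor H (Mor A B f) (YD_id I) = Mor A B f"
    unfolding YD_id_def YD_tensor_mor_Mor car by (simp add: YD_tensor_unit_right [OF A(1)] YD_tensor_unit_right [OF A(2)])
qed

section \<open>Naturality of the braiding and the hexagon identities\<close>

text \<open>Colinearity carries \<open>g\<close> through the coaction used by the braiding, and
  linearity carries \<open>f\<close> through the action.\<close>

lemma braiding_natural:
  assumes A: "obj A" "obj B" "obj A'" "obj B'"
    and f: "mor A A' f" and g: "mor B B' g"
  shows "YD_comp (YD_braiding H m n p q A' B') (YD_tensor_mor H (Mor A A' f) (Mor B B' g))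
    = YD_comp (YD_tensor_mor H (Mor B B' g) (Mor A A' f)) (YD_braiding H m n p q A B)"
proof -
  interpret A: yd_mod H A m n p q by fact
  interpret B: yd_mod H B m n p q by fact
  interpret A': yd_mod H A' m n p q by fact
  interpret B': yd_mod H B' m n p q by fact
  interpret AB: yd_pair H A B m n p q ..
  interpret BA: yd_pair H B A m n p q ..
  interpret AB': yd_pair H A' B' m n p q ..
  interpret BA': yd_pair H B' A' m n p q ..
  note fD = yd_morD [OF f] and gD = yd_morD [OF g]
  note fg = yd_mor_tensor [OF A f g] and gf = yd_mor_tensor [OF A(2,1,4,3) g f]
  note vs = A.V.vspace_car B.V.vspace_car AB.T.vspace_X BA.T.vspace_X
  note l = yd_mor_compose [OF AB.yd_mod_tensor AB'.yd_mod_tensor BA'.yd_mod_tensor fg(1) AB'.br_yd_mor]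
  note r = yd_mor_compose [OF AB.yd_mod_tensor BA.yd_mod_tensor BA'.yd_mod_tensor AB.br_yd_mor gf(1)]
  note lin_gf = lin_map_proj [OF BA.T.vspace_X yd_morD(1) [OF gf(1)]]
  have "compose (car AB.X) AB'.br_fn (tensor_map (car A) (car B) f g)
    = compose (car AB.X) (tensor_map (car B) (car A) g f) AB.br_fn"
  proof (rule lin_map_tensor_eqI [OF vs(1,2) yd_morD(1) [OF l, unfolded AB.T.car_X] yd_morD(1) [OF r, unfolded AB.T.car_X], folded AB.T.car_X])
    fix v w assume vw: "v \<in> car A" "w \<in> car B"
    have "AB'.br_fn (f v \<otimes> g w) = sw (B'.d (g w)) (\<lambda>w0 w1. w0 \<otimes> a0 H A' (f v) w1)"
      using vw by (simp add: AB'.br_fn_tensor fD gD AB'.P.br_def)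
    also have "\<dots> = sw (B.d w) (\<lambda>w0 w1. g (proj (car B) w0) \<otimes> a0 H A' (f v) w1)"
      by (rule gD(5) [OF vw(2)]) (intro lin_intros)
    also have "\<dots> = sw (B.d w) (\<lambda>w0 w1. tensor_map (car B) (car A) g f (proj (car BA.X) (w0 \<otimes> a0 H A v w1)))"
      by (rule sw_cong [OF B.d0_in]) (simp add: gf(2) BA.tensor_in_X vw fD(4))
    also have "\<dots> = tensor_map (car B) (car A) g f (proj (car BA.X) (AB.P.br v w))"
      unfolding AB.P.br_def by (rule sw_lin [OF lin_gf, symmetric])
    also have "\<dots> = tensor_map (car B) (car A) g f (AB.P.br v w)"
      using AB.P.br_in vs by (simp add: BA.T.car_X)
    finally show "compose (car AB.X) AB'.br_fn (tensor_map (car A) (car B) f g) (v \<otimes> w)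
      = compose (car AB.X) (tensor_map (car B) (car A) g f) AB.br_fn (v \<otimes> w)"
      using vw by (simp add: compose_def AB.tensor_in_X fg(2) AB.br_fn_tensor)
  qed
  then show ?thesis
    by (simp add: AB.YD_braiding AB'.YD_braiding YD_tensor_mor_Mor YD_comp_Mor)
qed

text \<open>In the first identity, the product b1 c1 in the coaction of B \<otimes> C acts on
  \<open>A\<close> as b1 followed by c1. In the second, the diagonal action of c1 on A \<otimes> B
  splits c1 by the coproduct, and coassociativity turns this into two successive coactions on
  \<open>C\<close>.\<close>

lemma braiding_hexagons:
  assumes A: "obj A" and B: "obj B" and C: "obj C"
  shows "YD_braiding H m n p q A (YD_tensor H B C)
    = YD_comp (YD_tensor_mor H (YD_id B) (YD_braiding H m n p q A C)) (YD_tensor_mor H (YD_braiding H m n p q A B) (YD_id C))"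
    and "YD_braiding H m n p q (YD_tensor H A B) C
    = YD_comp (YD_tensor_mor H (YD_braiding H m n p q A C) (YD_id B)) (YD_tensor_mor H (YD_id A) (YD_braiding H m n p q B C))"
proof -
  interpret A: yd_mod H A m n p q by fact
  interpret B: yd_mod H B m n p q by fact
  interpret C: yd_mod H C m n p q by fact
  interpret AB: yd_pair H A B m n p q ..
  interpret BA: yd_pair H B A m n p q ..
  interpret AC: yd_pair H A C m n p q ..
  interpret CA: yd_pair H C A m n p q ..
  interpret BC: yd_pair H B C m n p q ..
  interpret CB: yd_pair H C B m n p q ..
  interpret mAB: yd_mod H AB.X m n p q by (rule AB.yd_mod_tensor)
  interpret mBC: yd_mod H BC.X m n p q by (rule BC.yd_mod_tensor)
  interpret A_BC: yd_pair H A BC.X m n p q ..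
  interpret AB_C: yd_pair H AB.X C m n p q ..
  note as = YD_tensor_assoc [where H = H and m = m and n = n and p = p and q = q]
  note vs = A.V.vspace_car B.V.vspace_car C.V.vspace_car
  note vs2 = AB.T.vspace_X AC.T.vspace_X BC.T.vspace_X BA.T.vspace_X CA.T.vspace_X CB.T.vspace_X
  note t1 = yd_mor_tensor [OF AB.yd_mod_tensor C BA.yd_mod_tensor C AB.br_yd_mor C.yd_mor_id]
    and t2 = yd_mor_tensor [OF B AC.yd_mod_tensor B CA.yd_mod_tensor B.yd_mor_id AC.br_yd_mor]
    and t3 = yd_mor_tensor [OF A BC.yd_mod_tensor A CB.yd_mod_tensor A.yd_mor_id BC.br_yd_mor]
    and t4 = yd_mor_tensor [OF AC.yd_mod_tensor B CA.yd_mod_tensor B AC.br_yd_mor B.yd_mor_id]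
  note lin_t2 = lin_map_proj [OF vspace_tensor_space [OF vs(2) vs2(2)] t2(3)]
  note lin_t4 = lin_map_proj [OF vspace_tensor_space [OF vs2(2) vs(2)] t4(3)]
  let ?t1 = "tensor_map (car AB.X) (car C) AB.br_fn (\<lambda>v\<in>car C. v)"
    and ?t2 = "tensor_map (car B) (car AC.X) (\<lambda>v\<in>car B. v) AC.br_fn"
    and ?t3 = "tensor_map (car A) (car BC.X) (\<lambda>v\<in>car A. v) BC.br_fn"
    and ?t4 = "tensor_map (car AC.X) (car B) AC.br_fn (\<lambda>v\<in>car B. v)"
  \<comment> \<open>Strict associativity rebrackets source and target, which makes the second map
    composable with the first.\<close>
  have t2': "mor (YD_tensor H BA.X C) (YD_tensor H BC.X A) ?t2"
    using t2(1) as [OF B A C] as [OF B C A] by simp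
  have t4': "mor (YD_tensor H A CB.X) (YD_tensor H C AB.X) ?t4"
    using t4(1) as [OF A C B] as [OF C A B] by simp
  note c12 = yd_mor_compose [OF AB_C.yd_mod_tensor yd_mod_tensor [OF BA.yd_mod_tensor C]
      yd_mod_tensor [OF BC.yd_mod_tensor A] t1(1) t2']
  note c34 = yd_mor_compose [OF A_BC.yd_mod_tensor yd_mod_tensor [OF A CB.yd_mod_tensor]
      yd_mod_tensor [OF C AB.yd_mod_tensor] t3(1) t4']
  have l1: "compose ((car A \<otimes>\<^sub>S car B) \<otimes>\<^sub>S car C) ?t2 ?t1
      \<in> lin_map ((car A \<otimes>\<^sub>S car B) \<otimes>\<^sub>S car C) (car (YD_tensor H BC.X A))"
    and l2: "compose (car A \<otimes>\<^sub>S car B \<otimes>\<^sub>S car C) ?t4 ?t3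
      \<in> lin_map (car A \<otimes>\<^sub>S car B \<otimes>\<^sub>S car C) (car (YD_tensor H C AB.X))"
    and b1: "A_BC.br_fn \<in> lin_map (car A \<otimes>\<^sub>S car B \<otimes>\<^sub>S car C) (car (YD_tensor H BC.X A))"
    and b2: "AB_C.br_fn \<in> lin_map ((car A \<otimes>\<^sub>S car B) \<otimes>\<^sub>S car C) (car (YD_tensor H C AB.X))"
    using yd_morD(1) [OF c12] yd_morD(1) [OF c34] yd_morD(1) [OF A_BC.br_yd_mor] yd_morD(1) [OF AB_C.br_yd_mor]
    by (simp_all add: tensor_car)
  note cars = AB.T.car_X AC.T.car_X BC.T.car_X BA.T.car_X CA.T.car_X CB.T.car_X
  note comp_assoc = tensor_space_assoc [OF vs(2,1,3)] tensor_space_assoc [OF vs(1,3,2)]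
  have "A_BC.br_fn = compose ((car A \<otimes>\<^sub>S car B) \<otimes>\<^sub>S car C) ?t2 ?t1"
  proof (rule sym, rule tensor3_eqI [OF vs l1 b1])
    fix a b c assume abc: "a \<in> car A" "b \<in> car B" "c \<in> car C"
    have br_in: "AB.P.br a b \<in> car BA.X" using AB.P.br_in by (simp add: cars)
    then have "AB.P.br a b \<otimes> c \<in> (car B \<otimes>\<^sub>S car A) \<otimes>\<^sub>S car C" using abc by (simp add: cars)
    then have in2: "AB.P.br a b \<otimes> c \<in> car B \<otimes>\<^sub>S car AC.X" by (simp add: comp_assoc cars)
    have "compose ((car A \<otimes>\<^sub>S car B) \<otimes>\<^sub>S car C) ?t2 ?t1 ((a \<otimes> b) \<otimes> c) = ?t2 (AB.P.br a b \<otimes> c)"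
      using abc by (simp add: compose_def t1(2) AB.tensor_in_X AB.br_fn_tensor)
    \<comment> \<open>After the projection has been inserted, the map is linear on all arrays and
      can be moved under the Sweedler sum.\<close>
    also have "\<dots> = ?t2 (proj (car B \<otimes>\<^sub>S car AC.X) (AB.P.br a b \<otimes> c))"
      using in2 vspace_tensor_space [OF vs(2) vs2(2)] by simp
    also have "\<dots> = sw (B.d b) (\<lambda>b0 b1. ?t2 (proj (car B \<otimes>\<^sub>S car AC.X) (b0 \<otimes> a0 H A a b1 \<otimes> c)))"
      unfolding AB.P.br_def sw_tensor_left sw_lin [OF lin_t2] tensor_assoc ..
    also have "\<dots> = sw (B.d b) (\<lambda>b0 b1. b0 \<otimes> AC.P.br (a0 H A a b1) c)"
      by (rule sw_cong [OF B.d0_in])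
         (simp add: abc vspace_tensor_space [OF vs(2) vs2(2)] AC.tensor_in_X t2(2) AC.br_fn_tensor)
    also have "\<dots> = sw (B.d b) (\<lambda>b0 b1. sw (C.d c) (\<lambda>c0 c1.
        (b0 \<otimes> c0) \<otimes> a0 H A a (m0 H b1 c1)))"
      by (simp only: AC.P.br_def sw_tensor_right tensor_assoc A.U.a_a)
    also have "\<dots> = A_BC.P.br a (b \<otimes> c)"
      unfolding A_BC.P.br_def by (rule BC.d0_tensor [OF abc(2,3), symmetric]) (intro lin_intros)
    also have "\<dots> = A_BC.br_fn (a \<otimes> b \<otimes> c)"
      using abc by (simp add: A_BC.br_fn_tensor BC.tensor_in_X)
    finally show "compose ((car A \<otimes>\<^sub>S car B) \<otimes>\<^sub>S car C) ?t2 ?t1 ((a \<otimes> b) \<otimes> c) = A_BC.br_fn (a \<otimes> b \<otimes> c)" .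
  qed
  then show "YD_braiding H m n p q A (YD_tensor H B C)
    = YD_comp (YD_tensor_mor H (YD_id B) (YD_braiding H m n p q A C)) (YD_tensor_mor H (YD_braiding H m n p q A B) (YD_id C))"
    unfolding A_BC.YD_braiding AB.YD_braiding AC.YD_braiding YD_id_def YD_tensor_mor_Mor
    by (simp add: YD_comp_def as [OF A B C] as [OF B C A] tensor_car tensor_space_assoc)
  have "AB_C.br_fn = compose (car A \<otimes>\<^sub>S car B \<otimes>\<^sub>S car C) ?t4 ?t3"
  proof (rule tensor3_eqI [OF vs b2 l2])
    fix a b c assume abc: "a \<in> car A" "b \<in> car B" "c \<in> car C"
    have br_in: "BC.P.br b c \<in> car CB.X" using BC.P.br_in by (simp add: cars)
    then have "a \<otimes> BC.P.br b c \<in> car A \<otimes>\<^sub>S car C \<otimes>\<^sub>S car B" using abc by (simp add: cars)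
    then have in2: "a \<otimes> BC.P.br b c \<in> car AC.X \<otimes>\<^sub>S car B" by (simp add: comp_assoc cars)
    have "AB_C.br_fn ((a \<otimes> b) \<otimes> c) = sw (C.d c) (\<lambda>c0 c1. c0 \<otimes> a0 H AB.X (a \<otimes> b) c1)"
      using abc by (simp add: AB_C.br_fn_tensor AB.tensor_in_X AB_C.P.br_def)
    also have "\<dots> = sw (C.d c) (\<lambda>c0 c1. sw (dH0 H c1) (\<lambda>x y. c0 \<otimes> a0 H A a x \<otimes> a0 H B b y))"
      using abc by (simp add: AB.a0_tensor sw_tensor_right)
    also have "\<dots> = sw (C.d c) (\<lambda>c0 c1. sw (C.d c0) (\<lambda>x y. x \<otimes> a0 H A a y \<otimes> a0 H B b c1))"
      by (rule C.U.d_coassoc) (intro lin_intros)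
    also have "\<dots> = sw (C.d c) (\<lambda>c0 c1. AC.P.br a c0 \<otimes> a0 H B b c1)"
      by (simp only: AC.P.br_def sw_tensor_left tensor_assoc)
    also have "\<dots> = sw (C.d c) (\<lambda>c0 c1. ?t4 (proj (car AC.X \<otimes>\<^sub>S car B) ((a \<otimes> c0) \<otimes> a0 H B b c1)))"
      by (rule sw_cong [OF C.d0_in], simp only: vspace_tensor_space [OF vs2(2) vs(2)] proj_ident tensor_in AC.tensor_in_X abc B.U.a_in t4(2))
         (simp add: abc AC.br_fn_tensor)
    also have "\<dots> = ?t4 (proj (car AC.X \<otimes>\<^sub>S car B) (a \<otimes> BC.P.br b c))"
      unfolding BC.P.br_def sw_tensor_right sw_lin [OF lin_t4] tensor_assoc ..
    also have "\<dots> = ?t4 (a \<otimes> BC.P.br b c)"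
      using in2 vspace_tensor_space [OF vs2(2) vs(2)] by simp
    also have "\<dots> = compose (car A \<otimes>\<^sub>S car B \<otimes>\<^sub>S car C) ?t4 ?t3 (a \<otimes> b \<otimes> c)"
      using abc by (simp add: compose_def t3(2) BC.tensor_in_X BC.br_fn_tensor)
    finally show "AB_C.br_fn ((a \<otimes> b) \<otimes> c) = compose (car A \<otimes>\<^sub>S car B \<otimes>\<^sub>S car C) ?t4 ?t3 (a \<otimes> b \<otimes> c)" .
  qed
  then show "YD_braiding H m n p q (YD_tensor H A B) C
    = YD_comp (YD_tensor_mor H (YD_braiding H m n p q A C) (YD_id B)) (YD_tensor_mor H (YD_id A) (YD_braiding H m n p q B C))"
    unfolding AB_C.YD_braiding BC.YD_braiding AC.YD_braiding YD_id_def YD_tensor_mor_Mor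
    by (simp add: YD_comp_def as [OF A B C] as [OF C A B] tensor_car)
qed

text \<open>Invertibility of the braiding is the point at which the antipode enters, so it is an
  assumption here, discharged afterwards by the explicit inverse.\<close>

lemma YD_strict_braided:
  assumes iso: "\<And>A B. obj A \<Longrightarrow> obj B \<Longrightarrow> is_iso (YD_hom H) YD_id YD_comp
      (YD_tensor H A B) (YD_tensor H B A) (YD_braiding H m n p q A B)"
  shows "strict_braided_monoidal_category (YD H m n p q) (YD_hom H) YD_id YD_comp
      (YD_tensor H) (YD_tensor_mor H) (YD_unit H) (YD_braiding H m n p q)"
proof -
  interpret category "YD H m n p q" "YD_hom H" YD_id YD_comp by (rule YD_category)
  show ?thesis
  proof (rule strict_braided_monoidal_categoryI, unfold YD_iff)
    show "obj (YD_tensor H A B)" if "obj A" "obj B" for A B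
      using that by (rule yd_mod_tensor)
    show "YD_tensor_mor H f g \<in> YD_hom H (YD_tensor H A B) (YD_tensor H A' B')"
      if "obj A" "obj B" "obj A'" "obj B'"
        "f \<in> YD_hom H A A'" "g \<in> YD_hom H B B'" for A B A' B' f g
    proof -
      from that obtain f' g' where f: "f = Mor A A' f'" "yd_mor H m n p q A A' f'"
        and g: "g = Mor B B' g'" "yd_mor H m n p q B B' g'"
        by (auto simp: YD_hom_iff)
      show ?thesis
        unfolding YD_hom_iff [OF yd_mod_tensor [OF that(1,2)] yd_mod_tensor [OF that(3,4)]] f(1) g(1) YD_tensor_mor_Mor
        using yd_mor_tensor(1) [OF that(1-4) f(2) g(2)] by blast
    qed
    show "YD_tensor_mor H (YD_comp f' f) (YD_comp g' g) = YD_comp (YD_tensor_mor H f' g') (YD_tensor_mor H f g)"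
      if "obj A" "obj A'" "obj A''"
        "obj B" "obj B'" "obj B''"
        "f \<in> YD_hom H A A'" "f' \<in> YD_hom H A' A''" "g \<in> YD_hom H B B'" "g' \<in> YD_hom H B' B''"
      for A A' A'' B B' B'' f f' g g'
      using that tensor_map_compose
      by (auto simp: YD_hom_iff YD_tensor_mor_Mor YD_comp_Mor tensor_car)
    show "YD_tensor_mor H (YD_tensor_mor H f g) h = YD_tensor_mor H f (YD_tensor_mor H g h)"
      if "obj A" "obj B" "obj C"
        "obj A'" "obj B'" "obj C'"
        "f \<in> YD_hom H A A'" "g \<in> YD_hom H B B'" "h \<in> YD_hom H C C'" for A B C A' B' C' f g h
      using that tensor_mor_assoc YD_tensor_assoc [of H _ m n p q]
      by (auto simp: YD_hom_iff YD_tensor_mor_Mor tensor_car)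
    show "YD_tensor_mor H (YD_id I) f = f" "YD_tensor_mor H f (YD_id I) = f"
      if "obj A" "obj B" "f \<in> YD_hom H A B" for A B f
      using that tensor_map_unit by (auto simp: YD_hom_iff)
    show "is_iso (YD_hom H) YD_id YD_comp (YD_tensor H A B) (YD_tensor H B A) (YD_braiding H m n p q A B)"
      if "obj A" "obj B" for A B
      using that by (rule iso)
    show "YD_comp (YD_braiding H m n p q A' B') (YD_tensor_mor H f g)
      = YD_comp (YD_tensor_mor H g f) (YD_braiding H m n p q A B)"
      if "obj A" "obj B" "obj A'" "obj B'"
        "f \<in> YD_hom H A A'" "g \<in> YD_hom H B B'" for A B A' B' f g
      using that braiding_natural by (auto simp: YD_hom_iff)
  qed (rule tensor_map_id yd_mod_unit YD_tensor_assoc YD_tensor_unit_left YD_tensor_unit_right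
      braiding_hexagons; assumption)+
qed

end

end

lemma (in hopf_pair) braiding_is_inverse:
  "is_inverse (YD_hom H) YD_id YD_comp X Y (YD_braiding H m n p q V W) (YD_braiding_inv H m n p q V W)"
proof -
  note br = br_yd_mor and br_inv = yd_mor_inverse [OF yd_mod_tensor R.yd_mod_tensor br_yd_mor br_inv_fn_lin_map br_br_inv br_inv_br]
  have "compose (car X) br_inv_fn br_fn = (\<lambda>t\<in>car X. t)" "compose (car Y) br_fn br_inv_fn = (\<lambda>t\<in>car Y. t)"
    by (auto simp: compose_def br_inv_br br_br_inv intro!: restrict_ext)
  then show ?thesis
    using br br_inv unfolding is_inverse_def YD_braiding YD_braiding_inv YD_comp_Mor YD_id_def
    by (simp add: V.H.YD_hom_iff [OF yd_mod_tensor R.yd_mod_tensor] V.H.YD_hom_iff [OF R.yd_mod_tensor yd_mod_tensor])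
qed

theorem theorem3p4:
  fixes H :: "('k::field, 'x) hopf_rec" and m n p q :: int
  assumes "bihom_hopf_algebra H"
    and "bij_betw (antip H) (car H) (car H)"
  shows "strict_braided_monoidal_category (YD H m n p q) (YD_hom H) YD_id YD_comp
      (YD_tensor H) (YD_tensor_mor H) (YD_unit H) (YD_braiding H m n p q)
    \<and> (\<forall>V\<in>YD H m n p q. \<forall>W\<in>YD H m n p q.
        is_inverse (YD_hom H) YD_id YD_comp (YD_tensor H V W) (YD_tensor H W V)
          (YD_braiding H m n p q V W) (YD_braiding_inv H m n p q V W))"
proof -
  interpret bihom_hopf_algebra H by fact
  have "is_inverse (YD_hom H) YD_id YD_comp (YD_tensor H V W) (YD_tensor H W V)
      (YD_braiding H m n p q V W) (YD_braiding_inv H m n p q V W)"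
    if "yd_mod H V m n p q" "yd_mod H W m n p q" for V W
  proof -
    interpret V: yd_mod H V m n p q by fact
    interpret W: yd_mod H W m n p q by fact
    interpret hopf_pair H V W m n p q by unfold_locales (rule assms(2))
    show ?thesis by (rule braiding_is_inverse)
  qed
  then show ?thesis
    using YD_strict_braided [of m n p q] by (auto simp: YD_iff is_iso_def)
qed

end
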